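(* Let $d\ge 2$ and let $\Omega$ be a bounded open subset of $\mathbb{R}^d$ with smooth boundary and outward unit normal $\vec n$. Let $A\in L^1(\Omega;\mathbf{Sym}_d^+)$ be such that $\mathrm{Div}\,A$ is a (vector-valued) bounded measure on $\Omega$, and assume that the normal trace $A\vec n$ is a (vector-valued) bounded measure on $\partial\Omega$. Then $$\int_{\Omega}(\det A(x))^{\frac1{d-1}}\,dx\;\le\;\frac1{d\,|S^{d-1}|^{\frac1{d-1}}}\,\Bigl(\|A\vec n\|_{\mathcal{M}(\partial\Omega)}+\|\mathrm{Div}\,A\|_{\mathcal{M}(\Omega)}\Bigr)^{\frac d{d-1}}.$$ In particular $(\det A)^{\frac1{d-1}}$ is integrable over $\Omega$.
   Context: $\mathbf{Sym}_d^+$ is the cone of real symmetric positive semi-definite $d\times d$ matrices. $\mathrm{Div}\,A$ is the row-wise divergence, $(\mathrm{Div}\,A)_i=\sum_{j=1}^d\partial_jA_{ij}$, in the sense of distributions. The normal trace $A\vec n$ is defined by Green's formula: for every $\psi\in C^\infty(\mathbb{R}^d;\mathbb{R}^d)$, $\langle A\vec n,\psi\rangle_{\partial\Omega}=\int_\Omega \mathrm{Tr}(A\nabla\psi)\,dx+\langle \mathrm{Div}\,A,\psi\rangle_\Omega$. $\|\cdot\|_{\mathcal{M}}$ denotes the total mass (total variation) of a vector-valued bounded measure, computed with the Euclidean norm on $\mathbb{R}^d$. $|S^{d-1}|$ is the $(d-1)$-dimensional area of the unit sphere of $\mathbb{R}^d$. *)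

theory Defs
  imports "HOL-Analysis.Analysis"
begin

section \<open>Smooth functions and smooth boundaries\<close>

text \<open>These notions are meant for open sets S.\<close>

fun Ck_on :: "nat \<Rightarrow> 'a::euclidean_space set \<Rightarrow> ('a \<Rightarrow> 'b::real_normed_vector) \<Rightarrow> bool" where
  "Ck_on 0 S f \<longleftrightarrow> continuous_on S f"
| "Ck_on (Suc k) S f \<longleftrightarrow>
     (\<forall>x\<in>S. f differentiable (at x)) \<and> (\<forall>v. Ck_on k S (\<lambda>x. frechet_derivative f (at x) v))"

definition smooth_on :: "'a::euclidean_space set \<Rightarrow> ('a \<Rightarrow> 'b::real_normed_vector) \<Rightarrow> bool" where
  "smooth_on S f \<longleftrightarrow> (\<forall>k. Ck_on k S f)"

definition partial :: "'n \<Rightarrow> (real^'n::finite \<Rightarrow> 'b::real_normed_vector) \<Rightarrow> real^'n \<Rightarrow> 'b" where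
  "partial j f x = frechet_derivative f (at x) (axis j 1)"

text \<open>The convention is \<open>(\<nabla>\<psi>)\<^sub>j\<^sub>i = \<partial>\<^sub>j \<psi>\<^sub>i\<close>, so that \<open>Tr (A \<nabla>\<psi>) = (\<Sum>i j. A\<^sub>i\<^sub>j \<partial>\<^sub>j \<psi>\<^sub>i)\<close>, which is the
  expression that pairs with the row-wise divergence of A even if A is not symmetric.\<close>

definition grad :: "(real^'n::finite \<Rightarrow> real^'n) \<Rightarrow> real^'n \<Rightarrow> real^'n^'n" where
  "grad \<psi> x = (\<chi> j i. partial j (\<lambda>y. \<psi> y $ i) x)"

definition test_function :: "'a::euclidean_space set \<Rightarrow> ('a \<Rightarrow> real) \<Rightarrow> bool" where
  "test_function \<Omega> \<phi> \<longleftrightarrow>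
     smooth_on UNIV \<phi> \<and> compact (closure {x. \<phi> x \<noteq> 0}) \<and> closure {x. \<phi> x \<noteq> 0} \<subseteq> \<Omega>"

text \<open>Near each of its boundary points, \<open>\<Omega>\<close> is the sublevel set of a smooth submersion;
  in particular it lies locally on one side of its boundary.\<close>

definition smooth_boundary :: "'a::euclidean_space set \<Rightarrow> bool" where
  "smooth_boundary \<Omega> \<longleftrightarrow>
     (\<forall>p\<in>frontier \<Omega>. \<exists>U (\<rho> :: 'a \<Rightarrow> real). open U \<and> p \<in> U \<and> smooth_on U \<rho>
        \<and> (\<forall>x\<in>U. \<exists>v. frechet_derivative \<rho> (at x) v \<noteq> 0)
        \<and> \<Omega> \<inter> U = {x\<in>U. \<rho> x < 0})"

section \<open>Vector-valued measures\<close>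

text \<open>A signed or vector measure is a countably additive set function on the sigma-algebra of M;
  only \<open>space M\<close> and \<open>sets M\<close> matter here, the values of \<open>emeasure M\<close> do not.\<close>

definition total_variation :: "'a measure \<Rightarrow> ('a set \<Rightarrow> 'b::real_normed_vector) \<Rightarrow> ennreal" where
  "total_variation M \<mu> =
     (SUP P\<in>{P. finite P \<and> P \<subseteq> sets M \<and> partition_on (space M) P}. \<Sum>E\<in>P. ennreal (norm (\<mu> E)))"

definition bounded_vector_measure :: "'a measure \<Rightarrow> ('a set \<Rightarrow> 'b::real_normed_vector) \<Rightarrow> bool" where
  "bounded_vector_measure M \<mu> \<longleftrightarrow>
     \<mu> {} = 0
     \<and> (\<forall>F :: nat \<Rightarrow> 'a set. range F \<subseteq> sets M \<longrightarrow> disjoint_family F \<longrightarrow> (\<lambda>n. \<mu> (F n)) sums \<mu> (\<Union>n. F n))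
     \<and> total_variation M \<mu> < \<infinity>"

definition total_mass :: "'a measure \<Rightarrow> ('a set \<Rightarrow> 'b::real_normed_vector) \<Rightarrow> real" where
  "total_mass M \<mu> = enn2real (total_variation M \<mu>)"

text \<open>Integration uses the Jordan decomposition. The upper variation of a signed measure \<open>\<nu>\<close> is
  \<open>E \<mapsto> sup {\<nu> F | F \<subseteq> E}\<close> and its lower variation is the upper variation of \<open>- \<nu>\<close>. The coercion
  \<open>ennreal\<close> truncates negative values, which is harmless since \<open>F = {}\<close> is allowed.\<close>

definition upper_variation :: "'a measure \<Rightarrow> ('a set \<Rightarrow> real) \<Rightarrow> 'a measure" where
  "upper_variation M \<nu> =
     measure_of (space M) (sets M) (\<lambda>E. SUP F\<in>{F\<in>sets M. F \<subseteq> E}. ennreal (\<nu> F))"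

definition signed_integral :: "'a measure \<Rightarrow> ('a set \<Rightarrow> real) \<Rightarrow> ('a \<Rightarrow> real) \<Rightarrow> real" where
  "signed_integral M \<nu> f =
     (\<integral>x. f x \<partial>upper_variation M \<nu>) - (\<integral>x. f x \<partial>upper_variation M (\<lambda>E. - \<nu> E))"

definition vector_integral :: "'a measure \<Rightarrow> ('a set \<Rightarrow> real^'n::finite) \<Rightarrow> ('a \<Rightarrow> real^'n) \<Rightarrow> real" where
  "vector_integral M \<mu> \<psi> = (\<Sum>i\<in>UNIV. signed_integral M (\<lambda>E. \<mu> E $ i) (\<lambda>x. \<psi> x $ i))"

abbreviation borel_on :: "'a::topological_space set \<Rightarrow> 'a measure" where
  "borel_on S \<equiv> restrict_space borel S"

section \<open>Matrix fields\<close>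

definition Sym_plus :: "(real^'n^'n::finite) set" where
  "Sym_plus = {S. transpose S = S \<and> (\<forall>v. 0 \<le> v \<bullet> (S *v v))}"

text \<open>The distribution \<open>Div A\<close> on \<open>\<Omega>\<close> is the vector measure \<open>\<mu>\<close>, and the normal trace of A, defined
  by Green's formula, is the vector measure \<open>\<nu>\<close> on the boundary. Such measures are unique.\<close>

definition has_Div ::
  "(real^'n::finite) set \<Rightarrow> (real^'n \<Rightarrow> real^'n^'n) \<Rightarrow> ((real^'n) set \<Rightarrow> real^'n) \<Rightarrow> bool" where
  "has_Div \<Omega> A \<mu> \<longleftrightarrow>
     (\<forall>i \<phi>. test_function \<Omega> \<phi> \<longrightarrow>
        signed_integral (borel_on \<Omega>) (\<lambda>E. \<mu> E $ i) \<phi>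
        = - (\<integral>x. (\<Sum>j\<in>UNIV. A x $ i $ j * partial j \<phi> x) \<partial>lebesgue_on \<Omega>))"

definition has_normal_trace ::
  "(real^'n::finite) set \<Rightarrow> (real^'n \<Rightarrow> real^'n^'n) \<Rightarrow> ((real^'n) set \<Rightarrow> real^'n)
    \<Rightarrow> ((real^'n) set \<Rightarrow> real^'n) \<Rightarrow> bool" where
  "has_normal_trace \<Omega> A \<mu> \<nu> \<longleftrightarrow>
     (\<forall>\<psi>. smooth_on UNIV \<psi> \<longrightarrow>
        vector_integral (borel_on (frontier \<Omega>)) \<nu> \<psi>
        = (\<integral>x. trace (A x ** grad \<psi> x) \<partial>lebesgue_on \<Omega>) + vector_integral (borel_on \<Omega>) \<mu> \<psi>)"

section \<open>Area of hypersurfaces\<close>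

text \<open>The library has no (d-1)-dimensional surface measure. The area of a compact smooth
  hypersurface is obtained as its Minkowski content; the lemma below gives the usual value
  for the unit sphere.\<close>

definition hypersurface_area :: "'a::euclidean_space set \<Rightarrow> real" where
  "hypersurface_area S =
     Lim (at_right 0) (\<lambda>r. measure lebesgue {x. infdist x S < r} / (2 * r))"

lemma infdist_unit_sphere:
  fixes x :: "'a::euclidean_space"
  shows "infdist x (sphere 0 1) = \<bar>norm x - 1\<bar>"
proof -
  have ne: "sphere (0::'a) 1 \<noteq> {}" by simp
  have lower: "\<bar>norm x - 1\<bar> \<le> dist x y" if "y \<in> sphere 0 1" for y
    using that norm_triangle_ineq3[of x y] by (simp add: dist_norm)
  obtain b :: 'a where b: "b \<in> Basis" using nonempty_Basis by blast
  define y where "y = (if x = 0 then b else x /\<^sub>R norm x)"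
  have y: "y \<in> sphere 0 1" using b by (auto simp: y_def)
  have "dist x y = \<bar>norm x - 1\<bar>"
  proof (cases "x = 0")
    case True
    then show ?thesis using b by (simp add: y_def)
  next
    case False
    then have "x - y = (norm x - 1) *\<^sub>R (x /\<^sub>R norm x)"
      by (simp add: y_def algebra_simps)
    then have "norm (x - y) = \<bar>norm x - 1\<bar> * norm (x /\<^sub>R norm x)"
      by (metis norm_scaleR)
    then show ?thesis using False by (simp add: dist_norm)
  qed
  then have "infdist x (sphere 0 1) \<le> \<bar>norm x - 1\<bar>"
    using infdist_le[OF y, of x] by simp
  moreover have "\<bar>norm x - 1\<bar> \<le> infdist x (sphere 0 1)"
    unfolding infdist_notempty[OF ne] using lower ne by (intro cINF_greatest) auto
  ultimately show ?thesis by simp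
qed

lemma hypersurface_area_unit_sphere:
  "hypersurface_area (sphere (0::'a::euclidean_space) 1) = DIM('a) * unit_ball_vol DIM('a)"
proof -
  let ?d = "DIM('a)" and ?\<omega> = "unit_ball_vol DIM('a)"
  have shell: "measure lebesgue {x::'a. infdist x (sphere 0 1) < r} = ?\<omega> * ((1 + r) ^ ?d - (1 - r) ^ ?d)"
    if "0 < r" "r < 1" for r
  proof -
    have "{x::'a. infdist x (sphere 0 1) < r} = ball 0 (1 + r) - cball 0 (1 - r)"
      using that by (auto simp: infdist_unit_sphere)
    also have "measure lebesgue \<dots> = measure lebesgue (ball (0::'a) (1 + r)) - measure lebesgue (cball (0::'a) (1 - r))"
      using that by (intro measurable_measure_Diff) (auto simp: fmeasurableD)
    also have "\<dots> = ?\<omega> * ((1 + r) ^ ?d - (1 - r) ^ ?d)"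
      using that by (simp add: content_ball content_cball right_diff_distrib)
    finally show ?thesis .
  qed
  have "((\<lambda>r::real. (1 + r) ^ ?d - (1 - r) ^ ?d) has_real_derivative 2 * ?d) (at 0)"
    by (auto intro!: derivative_eq_intros)
  then have "((\<lambda>r::real. ((1 + r) ^ ?d - (1 - r) ^ ?d) / r) \<longlongrightarrow> 2 * ?d) (at_right 0)"
    by (auto simp: has_field_derivative_iff intro: tendsto_mono[OF at_le])
  from tendsto_mult[OF tendsto_const[of "?\<omega> / 2"] this]
  have "((\<lambda>r. ?\<omega> * ((1 + r) ^ ?d - (1 - r) ^ ?d) / (2 * r)) \<longlongrightarrow> ?d * ?\<omega>) (at_right 0)"
    by (simp add: mult.commute)
  then have "((\<lambda>r. measure lebesgue {x::'a. infdist x (sphere 0 1) < r} / (2 * r)) \<longlongrightarrow> ?d * ?\<omega>) (at_right 0)"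
  proof (rule Lim_transform_eventually)
    show "\<forall>\<^sub>F r in at_right 0. ?\<omega> * ((1 + r) ^ ?d - (1 - r) ^ ?d) / (2 * r)
            = measure lebesgue {x::'a. infdist x (sphere 0 1) < r} / (2 * r)"
      using eventually_at_right_real[of 0 "1::real"]
      by (auto elim!: eventually_mono simp: shell)
  qed
  then show ?thesis
    unfolding hypersurface_area_def by (intro tendsto_Lim) (auto simp: trivial_limit_at_right_real)
qed

end

theory Submission
  imports Defs "HOL-Complex_Analysis.Great_Picard"
begin

text \<open>The proof is by transport. Green's formula bounds \<open>\<integral> Tr (A D\<^sup>2u)\<close> by the total mass for every smooth convex
  u with \<open>\<bar>\<nabla>u\<bar> \<le> 1\<close>. Let g be a nonnegative density whose integral is the volume of the unit ball. Kantorovich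
  duality gives a 1-Lipschitz convex U whose subgradients over any compact set E have measure at least
  \<open>\<integral>\<^sub>E g\<close>, that is, \<open>det D\<^sup>2U \<ge> g\<close> in the sense of Alexandrov. For a fixed positive matrix A this implies the linear
  inequality \<open>Tr (A D\<^sup>2U) \<ge> d (g det A)\<^bsup>1/d\<^esup>\<close> for functions touching U from above; comparing U with its
  evolution under the heat semigroup of A turns it into an inequality between distributions, which survives
  mollification of U. Hence \<open>d \<integral> (g det A)\<^bsup>1/d\<^esup>\<close> is at most the total mass, and the theorem follows by taking for g a
  multiple of (a truncation of) \<open>(det A)\<^bsup>1/(d-1)\<^esup>\<close>.\<close>

text \<open>\<open>A\<close> is only integrable and U is only known to be convex and Lipschitz, so
  there is no pointwise Hessian of U to work with. The inequality is therefore proved with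
  \<open>A\<close> frozen: at each point x the matrix \<open>A x = B ** transpose B\<close> is a
  constant, a linear substitution turns its operator into the Laplacian, and the result is read off
  for the mollified Hessian at the same x. As only lower bounds are wanted when the mollifier
  shrinks, Fatou's lemma suffices. The unit ball is the target of the transport because its points
  are the gradients of U, and Green's formula charges the total mass M with the factor sup |grad u|.
  The exponent comes from asking that (g det A)^(1/d) be g itself, which gives g = (det
  A)^(1/(d-1)). If N is the integral of this g and w the volume of the unit ball, normalizing g
  leads to d N <= M (N/w)^(1/d). Solving for N requires N to be finite, hence the truncation, and d
  w = |S^(d-1)| gives the constant. The transport argument works with a continuous g, so the
  truncated weight is approximated by continuous ones.\<close>

section \<open>Real symmetric matrices\<close>

lemma inner_symmetric_matrix:
  fixes A :: "real^'n^'n"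
  assumes "transpose A = A"
  shows "x \<bullet> (A *v y) = (A *v x) \<bullet> y"
  by (metis assms dot_lmul_matrix transpose_matrix_vector)

text \<open>A maximizer \<open>v\<close> of the quadratic form on the unit sphere of
  \<open>S\<close> is an eigenvector. Since \<open>S\<close> is invariant, the residual
  \<open>w = A *v v - l *\<^sub>R v\<close> is itself an admissible direction, and moving from
  \<open>v\<close> along \<open>w\<close> would violate maximality unless
  \<open>w = 0\<close>.\<close>

lemma symmetric_matrix_eigenvector_in_subspace:
  fixes A :: "real^'n^'n"
  assumes sym: "transpose A = A" and S: "subspace S" "S \<noteq> {0}"
    and inv: "\<And>x. x \<in> S \<Longrightarrow> A *v x \<in> S"
  obtains v l where "v \<in> S" "norm v = 1" "A *v v = l *\<^sub>R v"
proof -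
  obtain x0 where "x0 \<in> S" "x0 \<noteq> 0" using S subspace_0 by blast
  then have "x0 /\<^sub>R norm x0 \<in> sphere 0 1 \<inter> S" using S by (simp add: subspace_scale)
  then have ne: "sphere 0 1 \<inter> S \<noteq> {}" by blast
  have cpt: "compact (sphere 0 1 \<inter> S)"
    by (simp add: S closed_subspace compact_Int_closed)
  have cont: "continuous_on (sphere 0 1 \<inter> S) (\<lambda>x. x \<bullet> (A *v x))"
    by (intro continuous_intros linear_continuous_on_compose[OF continuous_on_id]) auto
  obtain v where v: "v \<in> sphere 0 1 \<inter> S"
    and vmax: "\<And>y. y \<in> sphere 0 1 \<inter> S \<Longrightarrow> y \<bullet> (A *v y) \<le> v \<bullet> (A *v v)"
    using continuous_attains_sup[OF cpt ne cont] by blast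
  define l where "l = v \<bullet> (A *v v)"
  have quad: "y \<bullet> (A *v y) \<le> l * (norm y)\<^sup>2" if "y \<in> S" for y
  proof (cases "y = 0")
    case False
    then have "y /\<^sub>R norm y \<in> sphere 0 1 \<inter> S" using that S by (simp add: subspace_scale)
    from vmax[OF this] have "(y \<bullet> (A *v y)) / (norm y)\<^sup>2 \<le> l"
      by (simp add: l_def matrix_vector_mult_scaleR power2_eq_square divide_simps)
    with False show ?thesis by (simp add: divide_simps)
  qed simp
  have vS: "v \<in> S" and nv: "norm v = 1" using v by auto
  define w where "w = A *v v - l *\<^sub>R v"
  have wS: "w \<in> S" unfolding w_def using vS S inv by (intro subspace_diff subspace_scale)
  have vv: "v \<bullet> v = 1" using nv by (simp add: norm_eq_1)
  have "w \<bullet> v = (A *v v) \<bullet> v - l * (v \<bullet> v)" by (simp add: w_def inner_diff_left)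
  moreover have "(A *v v) \<bullet> v = l" unfolding l_def by (rule inner_commute)
  ultimately have wv: "w \<bullet> v = 0" by (simp add: vv)
  have wAv: "w \<bullet> (A *v v) = w \<bullet> w"
    using wv by (simp add: w_def inner_diff_right)
  define c where "c = l * (w \<bullet> w) - w \<bullet> (A *v w)"
  \<comment> \<open>The quadratic bound at \<open>v + t *\<^sub>R w\<close>: the terms of order 0
    cancel because \<open>l\<close> is the value at \<open>v\<close>, so the term of order 1 in
    \<open>t\<close> must not exceed the one of order 2. For small \<open>t > 0\<close> this fails
    unless \<open>w = 0\<close>.\<close>
  have bound: "2 * t * (w \<bullet> w) \<le> t\<^sup>2 * c" for t
  proof -
    have "v + t *\<^sub>R w \<in> S" using vS wS S by (intro subspace_add subspace_scale)
    from quad[OF this] have "(v + t *\<^sub>R w) \<bullet> (A *v (v + t *\<^sub>R w)) \<le> l * ((v + t *\<^sub>R w) \<bullet> (v + t *\<^sub>R w))"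
      by (simp add: dot_square_norm)
    moreover have "v \<bullet> (A *v w) = w \<bullet> w"
      using inner_symmetric_matrix[OF sym, of v w] wAv by (simp add: inner_commute)
    ultimately show ?thesis
      using wv wAv by (simp add: matrix_vector_right_distrib matrix_vector_mult_scaleR inner_add_left
        inner_add_right inner_commute l_def[symmetric] vv c_def algebra_simps power2_eq_square)
  qed
  have "w \<bullet> w = 0"
  proof (rule ccontr)
    assume "w \<bullet> w \<noteq> 0"
    then have pos: "w \<bullet> w > 0" by (simp add: order_less_le)
    define t where "t = (w \<bullet> w) / (\<bar>c\<bar> + 1)"
    have "t > 0" using pos by (simp add: t_def)
    have "2 * (w \<bullet> w) \<le> t * c" using bound[of t] \<open>t > 0\<close> by (simp add: power2_eq_square)
    also have "\<dots> \<le> t * (\<bar>c\<bar> + 1)" using \<open>t > 0\<close> by (intro mult_left_mono) auto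
    also have "\<dots> = w \<bullet> w" by (simp add: t_def)
    finally show False using pos by simp
  qed
  then have "A *v v = l *\<^sub>R v" by (simp add: w_def)
  with vS nv that show ?thesis by blast
qed

text \<open>Take an orthonormal set of eigenvectors of maximal cardinality. Its orthogonal
  complement is invariant under the symmetric matrix, so if it were nontrivial it would supply one
  more eigenvector.\<close>

lemma symmetric_matrix_eigenbasis:
  fixes A :: "real^'n^'n"
  assumes sym: "transpose A = A"
  obtains h :: "'n \<Rightarrow> real^'n" and l where
    "\<And>i j. h i \<bullet> h j = (if i = j then 1 else 0)" "\<And>i. A *v h i = l i *\<^sub>R h i"
proof -
  define P where "P B \<longleftrightarrow> finite B \<and> pairwise orthogonal B \<and> (\<forall>b\<in>B. norm b = 1 \<and> (\<exists>l. A *v b = l *\<^sub>R b))"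
    for B :: "(real^'n) set"
  have ind: "independent B" if "P B" for B
    using that unfolding P_def by (intro pairwise_orthogonal_independent) auto
  have le: "card B \<le> CARD('n)" if "P B" for B
    using independent_bound[OF ind[OF that]] by simp
  have "P {}" by (simp add: P_def)
  obtain B where B: "P B" and Bmax: "\<And>C. P C \<Longrightarrow> card C \<le> card B"
    using ex_has_greatest_nat[of P "{}" card "CARD('n)"] le \<open>P {}\<close> by (metis (mono_tags, lifting) le_eq_less_or_eq less_Suc_eq_le)
  define S where "S = {x. \<forall>b\<in>B. orthogonal b x}"
  have subS: "subspace S" unfolding S_def by (rule subspace_orthogonal_to_vectors)
  have invS: "A *v x \<in> S" if "x \<in> S" for x
  proof -
    { fix b assume b: "b \<in> B"
      then obtain l where l: "A *v b = l *\<^sub>R b" using B by (auto simp: P_def)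
      have "b \<bullet> (A *v x) = (A *v b) \<bullet> x" by (rule inner_symmetric_matrix[OF sym])
      also have "\<dots> = 0" using that b by (simp add: l S_def orthogonal_def)
      finally have "b \<bullet> (A *v x) = 0" . }
    then show ?thesis by (simp add: S_def orthogonal_def)
  qed
  have S0: "S = {0}"
  proof (rule ccontr)
    assume "S \<noteq> {0}"
    from symmetric_matrix_eigenvector_in_subspace[OF sym subS this invS]
    obtain v l where v: "v \<in> S" "norm v = 1" "A *v v = l *\<^sub>R v" by blast
    have "v \<notin> B"
    proof
      assume "v \<in> B"
      then have "v \<bullet> v = 0" using v(1) by (simp add: S_def orthogonal_def)
      then show False using v(2) by simp
    qed
    have "P (insert v B)"
      using B v \<open>v \<notin> B\<close> by (auto simp: P_def pairwise_insert S_def orthogonal_commute)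
    from Bmax[OF this] show False using B \<open>v \<notin> B\<close> by (simp add: P_def)
  qed
  have "span B = UNIV"
  proof (rule ccontr)
    assume "span B \<noteq> UNIV"
    then obtain a where "a \<noteq> 0" "\<And>x. x \<in> span B \<Longrightarrow> a \<bullet> x = 0"
      using span_not_UNIV_orthogonal by blast
    then have "a \<in> S" by (auto simp: S_def orthogonal_def inner_commute span_base)
    with S0 \<open>a \<noteq> 0\<close> show False by simp
  qed
  then have cB: "card B = CARD('n)"
    using dim_eq_card[of B UNIV] ind[OF B] by (simp add: dim_UNIV)
  have fB: "finite B" using B by (simp add: P_def)
  have "\<exists>h. bij_betw h (UNIV::'n set) B"
    by (rule finite_same_card_bij[OF finite fB cB[symmetric]])
  then obtain h where h: "bij_betw h (UNIV::'n set) B" ..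
  then have hB: "h i \<in> B" for i by (auto simp: bij_betw_def)
  have inj: "h i = h j \<longleftrightarrow> i = j" for i j
    by (rule inj_eq[OF bij_betw_imp_inj_on[OF h]])
  have "\<forall>i. \<exists>l. A *v h i = l *\<^sub>R h i" using B hB by (auto simp: P_def)
  from choice[OF this] have "\<exists>l. \<forall>i. A *v h i = l i *\<^sub>R h i" .
  then obtain l where "\<And>i. A *v h i = l i *\<^sub>R h i" by blast
  moreover have "h i \<bullet> h j = (if i = j then 1 else 0)" for i j
    using B hB[of i] hB[of j] inj[of i j] by (auto simp: P_def norm_eq_1 pairwise_def orthogonal_def)
  ultimately show ?thesis using that by blast
qed

definition diag_mat :: "('n \<Rightarrow> real) \<Rightarrow> real^'n^'n" where
  "diag_mat l = (\<chi> i j. if i = j then l i else 0)"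

lemma det_diag_mat: "det (diag_mat l :: real^'n^'n) = prod l UNIV"
  by (subst det_diagonal) (auto simp: diag_mat_def)

lemma trace_diag_mat: "trace (diag_mat l :: real^'n^'n) = sum l UNIV"
  by (simp add: trace_def diag_mat_def)

lemma diag_mat_mult: "diag_mat a ** diag_mat b = (diag_mat (\<lambda>i. a i * b i) :: real^'n^'n)"
  by (simp add: diag_mat_def matrix_matrix_mult_def vec_eq_iff if_distrib[of "\<lambda>x. x * _"] cong: if_cong)

lemma transpose_diag_mat: "transpose (diag_mat l) = (diag_mat l :: real^'n^'n)"
  by (auto simp: transpose_def diag_mat_def vec_eq_iff)

text \<open>The last clause expresses each eigenvalue as a value of the quadratic form, so that
  positive semi-definiteness of \<open>A\<close> gives \<open>l i \<ge> 0\<close> at once.\<close>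

lemma symmetric_matrix_diagonalize:
  fixes A :: "real^'n^'n"
  assumes sym: "transpose A = A"
  obtains Q l where "orthogonal_matrix Q" "A = Q ** diag_mat l ** transpose Q"
    "\<And>i. l i = column i Q \<bullet> (A *v column i Q)"
proof -
  obtain h :: "'n \<Rightarrow> real^'n" and l where h: "\<And>i j. h i \<bullet> h j = (if i = j then 1 else 0)"
    and l: "\<And>i. A *v h i = l i *\<^sub>R h i"
    using symmetric_matrix_eigenbasis[OF sym] by blast
  define Q :: "real^'n^'n" where "Q = (\<chi> i j. h j $ i)"
  have col: "column i Q = h i" for i by (simp add: column_def Q_def vec_eq_iff)
  have Q: "orthogonal_matrix Q"
    by (auto simp: orthogonal_matrix_orthonormal_columns col norm_eq_1 h orthogonal_def)
  have "A ** Q = Q ** diag_mat l"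
  proof -
    have "(\<Sum>k\<in>UNIV. A $ i $ k * h j $ k) = h j $ i * l j" for i j
      using arg_cong[OF l[of j], of "\<lambda>x. x $ i"] by (simp add: matrix_vector_mult_def mult.commute)
    then show ?thesis
      by (simp add: matrix_matrix_mult_def vec_eq_iff Q_def diag_mat_def if_distrib[of "\<lambda>x. _ * x"] cong: if_cong)
  qed
  then have "A = Q ** diag_mat l ** transpose Q"
    using Q by (metis matrix_mul_assoc matrix_mul_rid orthogonal_matrix_def)
  moreover have "l i = column i Q \<bullet> (A *v column i Q)" for i by (simp add: col l h)
  ultimately show ?thesis using Q that by blast
qed

lemma det_orthogonal_conj:
  fixes Q :: "real^'n^'n"
  assumes "orthogonal_matrix Q"
  shows "det (Q ** D ** transpose Q) = det D"
  using det_orthogonal_matrix[OF assms] by (auto simp: det_mul)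

lemma trace_orthogonal_conj:
  fixes Q :: "real^'n^'n"
  assumes "orthogonal_matrix Q"
  shows "trace (Q ** D ** transpose Q) = trace D"
  using assms by (metis matrix_mul_assoc matrix_mul_lid orthogonal_matrix_def trace_mul_sym)

text \<open>Arithmetic-geometric mean inequality for the eigenvalues, whose product and sum are the
  determinant and the trace.\<close>

lemma det_psd_le:
  fixes H :: "real^'n^'n"
  assumes "transpose H = H" and "\<And>v. 0 \<le> v \<bullet> (H *v v)"
  shows "0 \<le> det H" and "0 \<le> trace H" and "det H \<le> (trace H / CARD('n)) ^ CARD('n)"
proof -
  obtain Q l where Q: "orthogonal_matrix Q" "H = Q ** diag_mat l ** transpose Q"
    and l: "\<And>i. l i = column i Q \<bullet> (H *v column i Q)"
    using symmetric_matrix_diagonalize[OF assms(1)] by blast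
  have nn: "l i \<ge> 0" for i using l assms by metis
  have det: "det H = prod l UNIV" and tr: "trace H = sum l UNIV"
    by (simp_all add: Q(2) det_orthogonal_conj[OF Q(1)] trace_orthogonal_conj[OF Q(1)] det_diag_mat trace_diag_mat)
  show d0: "0 \<le> det H" and "0 \<le> trace H" by (simp_all add: det tr prod_nonneg sum_nonneg nn)
  have "(prod l UNIV) powr (1 / CARD('n)) \<le> (\<Sum>i\<in>UNIV. l i / CARD('n))"
    by (intro arith_geom_mean) (auto simp: nn)
  then have le: "det H powr (1 / CARD('n)) \<le> trace H / CARD('n)" by (simp add: det tr sum_divide_distrib)
  have "det H = (det H powr (1 / CARD('n))) ^ CARD('n)"
    using d0 by (cases "det H = 0") (auto simp: powr_powr simp flip: powr_realpow)
  also have "\<dots> \<le> (trace H / CARD('n)) ^ CARD('n)"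
    using le by (intro power_mono) auto
  finally show "det H \<le> (trace H / CARD('n)) ^ CARD('n)" .
qed

text \<open>The factor \<open>B\<close> is the linear substitution that later turns the operator Tr
  (A D^2) with constant coefficients into the Laplacian.\<close>

lemma psd_sqrt:
  fixes A :: "real^'n^'n"
  assumes "transpose A = A" and "\<And>v. 0 \<le> v \<bullet> (A *v v)"
  obtains B :: "real^'n^'n" where "A = B ** transpose B"
proof -
  obtain Q l where Q: "orthogonal_matrix Q" "A = Q ** diag_mat l ** transpose Q"
    and l: "\<And>i. l i = column i Q \<bullet> (A *v column i Q)"
    using symmetric_matrix_diagonalize[OF assms(1)] by blast
  have nn: "l i \<ge> 0" for i using l assms by metis
  define B where "B = Q ** diag_mat (\<lambda>i. sqrt (l i))"
  have "B ** transpose B = Q ** (diag_mat (\<lambda>i. sqrt (l i)) ** diag_mat (\<lambda>i. sqrt (l i))) ** transpose Q"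
    by (simp add: B_def matrix_transpose_mul transpose_diag_mat matrix_mul_assoc)
  also have "\<dots> = A" by (simp add: diag_mat_mult nn Q(2))
  finally show ?thesis using that[of B] by simp
qed

section \<open>Images under smooth maps for an arbitrary finite index type\<close>

text \<open>The change of variables lemmas of the library require an index type of class \<open>wellorder\<close>.
  The type \<open>'a idx\<close> is a copy of the finite type \<open>'a\<close> in that class, through which they transfer
  to arbitrary finite index types.\<close>

typedef ('a::finite) idx = "{..<CARD('a)}" by (auto intro!: exI[of _ 0])
instantiation idx :: (finite) "{finite,wellorder}" begin

definition less_eq_idx where "x \<le> y \<longleftrightarrow> Rep_idx x \<le> Rep_idx y"
definition less_idx where "x < y \<longleftrightarrow> Rep_idx x < Rep_idx y"

instance
proof
  show "finite (UNIV::'a idx set)"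
    unfolding type_definition.Abs_image[OF type_definition_idx, symmetric]
    by (rule finite_imageI) simp
  fix P :: "'a idx \<Rightarrow> bool" and a
  assume step: "\<And>x. (\<And>y. y < x \<Longrightarrow> P y) \<Longrightarrow> P x"
  show "P a"
  proof (induction a rule: measure_induct_rule[of Rep_idx])
    case (less x)
    show ?case by (rule step) (use less in \<open>simp add: less_idx_def\<close>)
  qed
qed (auto simp: less_eq_idx_def less_idx_def Rep_idx_inject)

end

lemma card_idx: "CARD('a::finite idx) = CARD('a)"
  using type_definition.card[OF type_definition_idx] by simp

definition reindex :: "('m \<Rightarrow> 'n) \<Rightarrow> real^'n \<Rightarrow> real^'m" where
  "reindex s x = (\<chi> i. x $ s i)"

lemma linear_reindex: "linear (reindex s)"
  by (rule linearI) (simp_all add: reindex_def vec_eq_iff)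

lemma reindex_inverse:
  fixes s :: "'m::finite \<Rightarrow> 'n::finite"
  assumes "bij s"
  shows "reindex s (reindex (inv s) x) = x" "reindex (inv s) (reindex s y) = y"
  using assms by (simp_all add: reindex_def vec_eq_iff bij_is_surj surj_f_inv_f bij_is_inj)

lemma reindex_image:
  fixes s :: "'m::finite \<Rightarrow> 'n::finite"
  assumes "bij s"
  shows "reindex s ` S = reindex (inv s) -` S"
  using reindex_inverse[OF assms] by (auto simp: image_iff) (metis)

text \<open>A bijection of the index types carries boxes to boxes with the same side lengths, and
  boxes determine \<open>lborel\<close>.\<close>

lemma lborel_reindex:
  fixes s :: "'m::finite \<Rightarrow> 'n::finite"
  assumes s: "bij s"
  shows "lborel = distr lborel borel (reindex s)"
proof (rule lborel_eqI)
  fix l u :: "real^'m" assume le: "\<And>b. b \<in> Basis \<Longrightarrow> l \<bullet> b \<le> u \<bullet> b"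
  have [measurable]: "reindex s \<in> borel \<rightarrow>\<^sub>M borel"
    by (intro borel_measurable_continuous_onI linear_continuous_on linear_linear[THEN iffD2] linear_reindex)
  have pre: "reindex s -` box l u = box (reindex (inv s) l) (reindex (inv s) u)"
  proof -
    have "(\<forall>i. l $ i < x $ s i \<and> x $ s i < u $ i) \<longleftrightarrow> (\<forall>j. l $ inv s j < x $ j \<and> x $ j < u $ inv s j)" for x
      using s by (metis bij_is_surj surj_f_inv_f bij_is_inj inv_f_f)
    then show ?thesis by (auto simp: reindex_def mem_box_cart)
  qed
  have le': "\<And>b. b \<in> Basis \<Longrightarrow> reindex (inv s) l \<bullet> b \<le> reindex (inv s) u \<bullet> b"
  proof -
    have "l $ i \<le> u $ i" for i using le[of "axis i 1"] by (simp add: inner_axis)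
    then show "\<And>b. b \<in> Basis \<Longrightarrow> reindex (inv s) l \<bullet> b \<le> reindex (inv s) u \<bullet> b"
      by (auto simp: Basis_vec_def inner_axis reindex_def)
  qed
  have prodB: "(\<Prod>b\<in>Basis. (x::real^'k::finite) \<bullet> b) = (\<Prod>i\<in>UNIV. x $ i)" for x
  proof -
    have B: "Basis = (\<lambda>i. axis i (1::real)) ` (UNIV::'k set)" by (auto simp: Basis_vec_def)
    have inj: "inj (\<lambda>i::'k. axis i (1::real))" by (auto simp: inj_on_def axis_eq_axis)
    show ?thesis unfolding B prod.reindex[OF inj] by (simp add: inner_axis o_def)
  qed
  have "emeasure (distr lborel borel (reindex s)) (box l u) = (\<Prod>b\<in>Basis. (reindex (inv s) u - reindex (inv s) l) \<bullet> b)"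
    using le' by (simp add: emeasure_distr pre emeasure_lborel_box)
  also have "(\<Prod>b\<in>Basis. (reindex (inv s) u - reindex (inv s) l) \<bullet> b) = (\<Prod>j\<in>UNIV. (u - l) $ inv s j)"
    by (simp add: prodB reindex_def)
  also have "\<dots> = (\<Prod>i\<in>UNIV. (u - l) $ i)"
    by (rule prod.reindex_bij_betw[OF bij_imp_bij_inv[OF s], unfolded bij_betw_def[symmetric]])
  also have "\<dots> = (\<Prod>b\<in>Basis. (u - l) \<bullet> b)" by (simp only: prodB)
  finally show "emeasure (distr lborel borel (reindex s)) (box l u) = (\<Prod>b\<in>Basis. (u - l) \<bullet> b)" .
qed simp

lemma lebesgue_reindex:
  fixes s :: "'m::finite \<Rightarrow> 'n::finite"
  assumes s: "bij s"
  shows "reindex s \<in> lebesgue \<rightarrow>\<^sub>M lebesgue" "lebesgue = distr lebesgue lebesgue (reindex s)"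
proof -
  have m[measurable]: "reindex s \<in> borel \<rightarrow>\<^sub>M borel"
    by (intro borel_measurable_continuous_onI linear_continuous_on linear_linear[THEN iffD2] linear_reindex)
  have m': "reindex s \<in> measurable lborel lborel" by simp
  have d: "distr lborel lborel (reindex s) = lborel"
    using lborel_reindex[OF s] by (metis distr_cong sets_lborel)
  have eq: "null_sets lborel = null_sets (distr lebesgue lborel (reindex s))"
  proof -
    have "distr lebesgue lborel (reindex s) = distr lborel lborel (reindex s)"
      by (rule distr_completion) simp
    then show ?thesis by (simp add: d)
  qed
  show 1: "reindex s \<in> lebesgue \<rightarrow>\<^sub>M lebesgue"
    by (simp add: completion.measurable_completion2 eq[symmetric] measurable_completion)
  have "lebesgue = completion (distr lebesgue lborel (reindex s))"
    using distr_completion[OF m'] d by simp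
  also have "\<dots> = distr lebesgue lebesgue (reindex s)"
    by (rule completion.completion_distr_eq) (auto simp: eq measurable_completion)
  finally show "lebesgue = distr lebesgue lebesgue (reindex s)" .
qed

lemma measure_reindex_image:
  fixes s :: "'m::finite \<Rightarrow> 'n::finite"
  assumes s: "bij s" and S: "S \<in> lmeasurable"
  shows "reindex s ` S \<in> lmeasurable" "measure lebesgue (reindex s ` S) = measure lebesgue S"
proof -
  have i: "bij (inv s)" using s by (rule bij_imp_bij_inv)
  have S': "S \<in> sets lebesgue" using S by auto
  have sets: "reindex s ` S \<in> sets lebesgue"
    unfolding reindex_image[OF s] using measurable_sets[OF lebesgue_reindex(1)[OF i] S'] by simp
  have em: "emeasure lebesgue (reindex s ` S) = emeasure lebesgue S"
    unfolding reindex_image[OF s]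
    using emeasure_distr[OF lebesgue_reindex(1)[OF i] S'] lebesgue_reindex(2)[OF i] by simp
  show "reindex s ` S \<in> lmeasurable" using S sets em unfolding fmeasurable_def by (simp del: emeasure_completion)
  show "measure lebesgue (reindex s ` S) = measure lebesgue S" by (simp add: measure_def em)
qed

text \<open>Conjugation by \<open>s\<close> is a sign-preserving bijection between the permutations
  of the two index types, and it matches the terms of the Leibniz expansions.\<close>

lemma det_reindex:
  fixes s :: "'m::finite \<Rightarrow> 'n::finite" and A :: "real^'n^'n"
  assumes s: "bij s"
  shows "det (\<chi> i j. A $ s i $ s j) = det A"
proof -
  let ?f = "map_permutation (UNIV::'m set) s" and ?g = "map_permutation (UNIV::'n set) (inv s)"
  have b: "bij_betw s UNIV UNIV" "bij_betw (inv s) UNIV UNIV" using s by (simp_all add: bij_imp_bij_inv)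
  have "(\<Sum>p | p permutes (UNIV::'m set). of_int (sign p) * (\<Prod>i\<in>UNIV. A $ s i $ s (p i)))
      = (\<Sum>p | p permutes (UNIV::'n set). of_int (sign p) * (\<Prod>i\<in>UNIV. A $ i $ p i))"
  proof (rule sum.reindex_bij_witness[where i = ?g and j = ?f])
    fix p assume "p \<in> {p. p permutes (UNIV::'m set)}"
    then have p: "p permutes (UNIV::'m set)" by simp
    show "?g (?f p) = p"
      by (rule map_permutation_compose_inv[OF b(1) p]) (simp add: s bij_is_inj)
    show "?f p \<in> {p. p permutes (UNIV::'n set)}"
      using map_permutation_permutes[OF b(1) p] by simp
    have "(\<Prod>i\<in>UNIV. A $ i $ ?f p i) = (\<Prod>i\<in>UNIV. A $ s i $ ?f p (s i))"
      by (rule prod.reindex_bij_betw[OF b(1), symmetric])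
    also have "\<dots> = (\<Prod>i\<in>UNIV. A $ s i $ s (p i))"
      using s by (simp add: map_permutation_apply bij_is_inj)
    finally show "of_int (sign (?f p)) * (\<Prod>i\<in>UNIV. A $ i $ ?f p i) = of_int (sign p) * (\<Prod>i\<in>UNIV. A $ s i $ s (p i))"
      using sign_map_permutation[of s UNIV p] p s by (simp add: bij_is_inj)
  next
    fix p assume "p \<in> {p. p permutes (UNIV::'n set)}"
    then have p: "p permutes (UNIV::'n set)" by simp
    show "?f (?g p) = p"
      by (rule map_permutation_compose_inv[OF b(2) p]) (simp add: s bij_is_surj surj_f_inv_f)
    show "?g p \<in> {p. p permutes (UNIV::'m set)}"
      using map_permutation_permutes[OF b(2) p] by simp
  qed
  then show ?thesis by (simp add: det_def)
qed

lemma idx_bij: obtains s :: "'a::finite idx \<Rightarrow> 'a" where "bij s"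
  using finite_same_card_bij[OF finite[of "UNIV::'a idx set"] finite[of "UNIV::'a set"] card_idx] by blast

lemma matrix_reindex:
  fixes s :: "'m::finite \<Rightarrow> 'n::finite" and L :: "real^'n \<Rightarrow> real^'n"
  assumes s: "bij s"
  shows "matrix (\<lambda>x. reindex s (L (reindex (inv s) x))) = (\<chi> i j. matrix L $ s i $ s j)"
proof -
  have "reindex (inv s) (axis j 1) = (axis (s j) 1 :: real^'n)" for j
    using s by (auto simp: reindex_def axis_def vec_eq_iff bij_is_surj surj_f_inv_f bij_is_inj)
  then show ?thesis by (simp add: matrix_def reindex_def)
qed

lemma has_derivative_reindex: "(reindex s has_derivative reindex s) F"
  by (intro linear_imp_has_derivative linear_reindex)

lemma measure_linear_image_finite:
  fixes f :: "real^'n::finite \<Rightarrow> real^'n"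
  assumes f: "linear f" and S: "S \<in> lmeasurable"
  shows "f ` S \<in> lmeasurable" "measure lebesgue (f ` S) = \<bar>det (matrix f)\<bar> * measure lebesgue S"
proof -
  obtain s :: "'n idx \<Rightarrow> 'n" where s: "bij s" by (rule idx_bij)
  have i: "bij (inv s)" using s by (rule bij_imp_bij_inv)
  let ?g = "\<lambda>x. reindex s (f (reindex (inv s) x))"
  have g: "linear ?g"
    using linear_compose[OF linear_compose[OF linear_reindex[of "inv s"] f] linear_reindex[of s]] by (simp add: o_def)
  have img: "f ` S = reindex (inv s) ` (?g ` reindex s ` S)"
    using s by (simp add: image_image reindex_inverse)
  note S' = measure_reindex_image[OF s S]
  have m: "?g ` reindex s ` S \<in> lmeasurable"
    by (rule measurable_linear_image[OF g S'(1)])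
  show "f ` S \<in> lmeasurable" unfolding img by (rule measure_reindex_image(1)[OF i m])
  have "measure lebesgue (f ` S) = \<bar>det (matrix ?g)\<bar> * measure lebesgue (reindex s ` S)"
    unfolding img measure_reindex_image(2)[OF i m] by (rule measure_linear_image[OF g S'(1)])
  then show "measure lebesgue (f ` S) = \<bar>det (matrix f)\<bar> * measure lebesgue S"
    by (simp add: S'(2) matrix_reindex[OF s] det_reindex[OF s])
qed

text \<open>An area-formula type bound that counts the image once, however often it is covered. It
  will be applied to the gradient map of a smooth function on a set where its Hessian is
  controlled.\<close>

lemma measure_C1_image_le:
  fixes f :: "real^'n::finite \<Rightarrow> real^'n" and H :: "real^'n \<Rightarrow> real^'n^'n"
  assumes S: "compact S" and H: "continuous_on S H"
    and der: "\<And>x. x \<in> S \<Longrightarrow> (f has_derivative (\<lambda>v. H x *v v)) (at x)"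
    and bd: "\<And>x. x \<in> S \<Longrightarrow> \<bar>det (H x)\<bar> \<le> B"
  shows "measure lebesgue (f ` S) \<le> B * measure lebesgue S"
proof -
  obtain s :: "'n idx \<Rightarrow> 'n" where s: "bij s" by (rule idx_bij)
  have i: "bij (inv s)" using s by (rule bij_imp_bij_inv)
  let ?g = "\<lambda>x. reindex s (f (reindex (inv s) x))"
  let ?g' = "\<lambda>x v. reindex s (H (reindex (inv s) x) *v reindex (inv s) v)"
  let ?S = "reindex s ` S"
  have img: "f ` S = reindex (inv s) ` (?g ` ?S)"
    using s by (simp add: image_image reindex_inverse)
  have cS: "compact ?S"
    by (intro compact_continuous_image S linear_continuous_on linear_linear[THEN iffD2] linear_reindex)
  have inS: "reindex (inv s) x \<in> S" if "x \<in> ?S" for x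
    using that s by (auto simp: reindex_inverse)
  have dg: "(?g has_derivative ?g' x) (at x within ?S)" if "x \<in> ?S" for x
    using has_derivative_compose[OF has_derivative_compose[OF has_derivative_reindex der[OF inS[OF that]]] has_derivative_reindex]
    by (rule has_derivative_at_withinI)
  have det: "det (matrix (?g' x)) = det (H (reindex (inv s) x))" for x
    using matrix_reindex[OF s, of "\<lambda>v. H (reindex (inv s) x) *v v"]
    by (simp add: det_reindex[OF s])
  have "continuous_on ?S (\<lambda>x. H (reindex (inv s) x))"
    using inS by (intro continuous_on_compose2[OF H] linear_continuous_on linear_linear[THEN iffD2] linear_reindex) auto
  then have cont: "continuous_on ?S (\<lambda>x. \<bar>det (H (reindex (inv s) x))\<bar>)"
    unfolding det_def by (intro continuous_intros continuous_on_component) auto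
  have int: "(\<lambda>x. \<bar>det (matrix (?g' x))\<bar>) integrable_on ?S"
    unfolding det
    by (rule set_borel_integral_eq_integral(1))
       (unfold set_integrable_def, rule borel_integrable_compact[OF cS cont])
  have bd': "\<bar>det (matrix (?g' x))\<bar> \<le> B" if "x \<in> ?S" for x
    unfolding det by (rule bd[OF inS[OF that]])
  note r = measurable_bounded_differentiable_image[OF lmeasurable_compact[OF cS] dg int bd']
    measure_bounded_differentiable_image[OF lmeasurable_compact[OF cS] dg int bd']
  have "measure lebesgue (f ` S) = measure lebesgue (?g ` ?S)"
    unfolding img by (rule measure_reindex_image(2)[OF i r(1)])
  also have "\<dots> \<le> B * measure lebesgue ?S" by (rule r(2))
  also have "\<dots> = B * measure lebesgue S"
    by (simp add: measure_reindex_image(2)[OF s lmeasurable_compact[OF S]])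
  finally show ?thesis .
qed

section \<open>Gaussian averages\<close>

text \<open>The difference quotients converge pointwise, and the mean value inequality on the ball
  bounds the error quotient by \<open>2 * D y\<close>, so dominated convergence applies along every
  sequence.\<close>

lemma has_derivative_integral_dominated:
  fixes f :: "'a::real_normed_vector \<Rightarrow> 'b \<Rightarrow> real"
  assumes r: "r > 0"
    and f: "\<And>x. x \<in> ball x0 r \<Longrightarrow> integrable M (f x)"
    and d: "\<And>x y. x \<in> ball x0 r \<Longrightarrow> ((\<lambda>x. f x y) has_derivative f' x y) (at x)"
    and bd: "\<And>x y v. x \<in> ball x0 r \<Longrightarrow> \<bar>f' x y v\<bar> \<le> D y * norm v"
    and D: "integrable M D" and D0: "\<And>y. 0 \<le> D y"
    and m: "\<And>v. (\<lambda>y. f' x0 y v) \<in> borel_measurable M"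
  shows "((\<lambda>x. \<integral>y. f x y \<partial>M) has_derivative (\<lambda>v. \<integral>y. f' x0 y v \<partial>M)) (at x0)"
proof -
  have x0: "x0 \<in> ball x0 r" using r by simp
  have lin: "linear (f' x0 y)" for y using d[OF x0] by (rule has_derivative_linear)
  have int': "integrable M (\<lambda>y. f' x0 y v)" for v
    by (rule Bochner_Integration.integrable_bound[OF integrable_mult_left[OF D, of "norm v"] m])
       (use bd[OF x0] in \<open>auto intro!: AE_I2 order_trans[OF bd[OF x0]]\<close>)
  have bl: "bounded_linear (\<lambda>v. \<integral>y. f' x0 y v \<partial>M)"
  proof (rule bounded_linear_intro[where K="\<integral>y. D y \<partial>M"])
    show "norm (\<integral>y. f' x0 y v \<partial>M) \<le> norm v * (\<integral>y. D y \<partial>M)" for v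
    proof -
      have "norm (\<integral>y. f' x0 y v \<partial>M) \<le> (\<integral>y. norm (f' x0 y v) \<partial>M)" by (rule integral_norm_bound)
      also have "\<dots> \<le> (\<integral>y. D y * norm v \<partial>M)"
        by (rule integral_mono) (use int' D bd[OF x0] in auto)
      finally show ?thesis by (simp add: mult.commute)
    qed
  qed (simp_all add: linear_add[OF lin] linear_scale[OF lin] int')
  have diff_bound: "\<bar>f (x0 + h) y - f x0 y\<bar> \<le> D y * norm h" if "x0 + h \<in> ball x0 r" for h y
  proof -
    have "norm (f (x0 + h) y - f x0 y) \<le> D y * norm ((x0 + h) - x0)"
    proof (rule differentiable_bound[of "ball x0 r" "\<lambda>x. f x y" "\<lambda>x. f' x y"])
      show "onorm (f' x y) \<le> D y" if "x \<in> ball x0 r" for x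
        by (rule onorm_bound[OF D0]) (use bd[OF that] in simp)
    qed (use that x0 in \<open>auto intro!: has_derivative_at_withinI d\<close>)
    then show ?thesis by simp
  qed
  have "(\<lambda>h. norm ((\<integral>y. f (x0 + h) y \<partial>M) - (\<integral>y. f x0 y \<partial>M) - (\<integral>y. f' x0 y h \<partial>M)) / norm h) \<midarrow>0\<rightarrow> 0"
    unfolding tendsto_at_iff_sequentially comp_def
  proof (intro allI impI)
    fix X :: "nat \<Rightarrow> 'a" assume X: "\<forall>i. X i \<in> UNIV - {0}" "X \<longlonglongrightarrow> 0"
    from X(2) r obtain N where N: "\<And>n. n \<ge> N \<Longrightarrow> norm (X n) < r"
      by (metis LIMSEQ_iff diff_zero)
    define Y where "Y n = X (n + N)" for n
    have Y0: "Y n \<noteq> 0" and Yr: "x0 + Y n \<in> ball x0 r" for n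
      using X(1) N by (auto simp: Y_def dist_norm)
    have Ylim: "Y \<longlonglongrightarrow> 0" unfolding Y_def by (rule LIMSEQ_ignore_initial_segment[OF X(2)])
    define g where "g n y = (f (x0 + Y n) y - f x0 y - f' x0 y (Y n)) / norm (Y n)" for n y
    have gm: "g n \<in> borel_measurable M" for n
    proof -
      have [measurable]: "f (x0 + Y n) \<in> borel_measurable M" "f x0 \<in> borel_measurable M" "(\<lambda>y. f' x0 y (Y n)) \<in> borel_measurable M"
        by (intro borel_measurable_integrable f Yr x0 int')+
      show ?thesis unfolding g_def by measurable
    qed
    have g0: "(\<lambda>n. g n y) \<longlonglongrightarrow> 0" for y
    proof -
      have "(\<lambda>h. norm (f (x0 + h) y - f x0 y - f' x0 y h) / norm h) \<midarrow>0\<rightarrow> 0"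
        using d[OF x0, of y] by (simp add: has_derivative_at)
      then have "(\<lambda>n. norm (f (x0 + Y n) y - f x0 y - f' x0 y (Y n)) / norm (Y n)) \<longlonglongrightarrow> 0"
        unfolding tendsto_at_iff_sequentially comp_def using Y0 Ylim by auto
      then have "(\<lambda>n. \<bar>g n y\<bar>) \<longlonglongrightarrow> 0" by (simp add: g_def)
      then show ?thesis by (rule tendsto_rabs_zero_cancel)
    qed
    have gb: "norm (g n y) \<le> 2 * D y" for n y
    proof -
      have "\<bar>f (x0 + Y n) y - f x0 y - f' x0 y (Y n)\<bar> \<le> D y * norm (Y n) + D y * norm (Y n)"
        using diff_bound[OF Yr, of n y] bd[OF x0, of y "Y n"] by linarith
      then show ?thesis using Y0[of n] by (simp add: g_def divide_simps)
    qed
    have "(\<lambda>n. \<integral>y. g n y \<partial>M) \<longlonglongrightarrow> (\<integral>y. 0 \<partial>M)"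
      by (rule integral_dominated_convergence[where w="\<lambda>y. 2 * D y"])
         (use gm g0 gb D in auto)
    moreover have "(\<integral>y. g n y \<partial>M) = ((\<integral>y. f (x0 + Y n) y \<partial>M) - (\<integral>y. f x0 y \<partial>M) - (\<integral>y. f' x0 y (Y n) \<partial>M)) / norm (Y n)" for n
      unfolding g_def using f[OF Yr] f[OF x0] int' by simp
    ultimately have "(\<lambda>n. \<bar>((\<integral>y. f (x0 + Y n) y \<partial>M) - (\<integral>y. f x0 y \<partial>M) - (\<integral>y. f' x0 y (Y n) \<partial>M)) / norm (Y n)\<bar>) \<longlonglongrightarrow> 0"
      by (intro tendsto_rabs_zero) simp
    then have "(\<lambda>n. norm ((\<integral>y. f (x0 + X (n + N)) y \<partial>M) - (\<integral>y. f x0 y \<partial>M) - (\<integral>y. f' x0 y (X (n + N)) \<partial>M)) / norm (X (n + N))) \<longlonglongrightarrow> 0"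
      by (simp add: Y_def)
    then show "(\<lambda>n. norm ((\<integral>y. f (x0 + X n) y \<partial>M) - (\<integral>y. f x0 y \<partial>M) - (\<integral>y. f' x0 y (X n) \<partial>M)) / norm (X n)) \<longlonglongrightarrow> 0"
      by (rule LIMSEQ_offset)
  qed
  with bl show ?thesis by (simp add: has_derivative_at)
qed

text \<open>The norm dominates the mean of the absolute coordinates, so
  \<open>exp (- norm z)\<close> is at most a product of one-dimensional exponentials of rate
  \<open>1 / DIM('a)\<close>, whose integral factorizes.\<close>

lemma integrable_exp_minus_norm: "integrable lborel (\<lambda>z::'a::euclidean_space. exp (- norm z))"
proof -
  define c where "c = 1 / real DIM('a)"
  have c: "c > 0" by (simp add: c_def)
  have "(\<integral>\<^sup>+z. ennreal (exp (- norm (z::'a))) \<partial>lborel) \<le> (\<integral>\<^sup>+z. ennreal (\<Prod>b\<in>(Basis::'a set). exp (- c * \<bar>z \<bullet> b\<bar>)) \<partial>lborel)"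
  proof (intro nn_integral_mono ennreal_leI)
    fix z :: 'a
    have "(\<Sum>b\<in>(Basis::'a set). \<bar>z \<bullet> b\<bar>) \<le> (\<Sum>b\<in>(Basis::'a set). norm z)"
      by (intro sum_mono Basis_le_norm)
    then have "c * (\<Sum>b\<in>(Basis::'a set). \<bar>z \<bullet> b\<bar>) \<le> norm z"
      by (simp add: c_def field_simps)
    then show "exp (- norm z) \<le> (\<Prod>b\<in>Basis. exp (- c * \<bar>z \<bullet> b\<bar>))"
      by (simp flip: exp_sum add: sum_distrib_left sum_negf)
  qed
  also have "\<dots> = (\<integral>\<^sup>+z. (\<Prod>b\<in>(Basis::'a set). ennreal (exp (- c * \<bar>z \<bullet> b\<bar>))) \<partial>lborel)"
    by (simp add: prod_ennreal)
  also have "\<dots> = (\<Prod>b\<in>(Basis::'a set). (\<integral>\<^sup>+x. ennreal (exp (- c * \<bar>x\<bar>)) \<partial>lborel))"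
    by (rule nn_integral_lborel_prod[where f="\<lambda>_ x. ennreal (exp (- c * \<bar>x\<bar>))"]) auto
  also have "\<dots> < \<infinity>"
  proof -
    have half: "(\<integral>\<^sup>+x. ennreal (exp (- c * x)) * indicator {0..} x \<partial>lborel) = ennreal (1 / c)"
    proof -
      have "(\<integral>\<^sup>+x. ennreal (exp (- c * x)) * indicator {0..} x \<partial>lborel) = ennreal (0 - (- exp (- c * 0) / c))"
      proof (rule nn_integral_FTC_atLeast)
        show "DERIV (\<lambda>x. - exp (- c * x) / c) x :> exp (- c * x)" for x
          using c by (auto intro!: derivative_eq_intros)
        have "((\<lambda>x. - exp (- (c * x)) / c) \<longlongrightarrow> - 0 / c) at_top"
          by (intro tendsto_intros filterlim_compose[OF exp_at_bot] filterlim_tendsto_pos_mult_at_top[OF tendsto_const c, THEN filterlim_uminus_at_top[THEN iffD1], simplified])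
             (use c in \<open>auto intro: filterlim_ident\<close>)
        then show "((\<lambda>x. - exp (- c * x) / c) \<longlongrightarrow> 0) at_top" by simp
      qed auto
      then show ?thesis by simp
    qed
    have refl: "(\<integral>\<^sup>+x. ennreal (exp (c * x)) * indicator {..0} x \<partial>lborel) = ennreal (1 / c)"
      by (subst half[symmetric], subst nn_integral_real_affine[where c="-1" and t=0])
         (auto simp: indicator_def intro!: nn_integral_cong)
    have "(\<integral>\<^sup>+x. ennreal (exp (- c * \<bar>x\<bar>)) \<partial>lborel)
        \<le> (\<integral>\<^sup>+x. ennreal (exp (- c * x)) * indicator {0..} x + ennreal (exp (c * x)) * indicator {..0} x \<partial>lborel)"
      by (rule nn_integral_mono) (auto simp: indicator_def abs_if)
    also have "\<dots> = ennreal (1 / c) + ennreal (1 / c)"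
      by (subst nn_integral_add) (auto simp: half[simplified] refl)
    also have "\<dots> < \<infinity>" by simp
    finally show ?thesis by (simp add: power_less_top_ennreal)
  qed
  finally show ?thesis by (intro integrableI_bounded) auto
qed

lemma lborel_integral_affine:
  fixes f :: "'a::euclidean_space \<Rightarrow> real"
  assumes c: "c \<noteq> 0" and [measurable]: "f \<in> borel_measurable borel"
  shows "(\<integral>x. f x \<partial>lborel) = \<bar>c\<bar> ^ DIM('a) * (\<integral>x. f (t + c *\<^sub>R x) \<partial>lborel)"
proof -
  have "(\<integral>x. f x \<partial>lborel) = (\<integral>x. f x \<partial>density (distr lborel borel (\<lambda>x::'a. t + c *\<^sub>R x)) (\<lambda>_. ennreal (\<bar>c\<bar> ^ DIM('a))))"
    by (subst lborel_affine[OF c, of t]) simp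
  also have "\<dots> = \<bar>c\<bar> ^ DIM('a) * (\<integral>x. f (t + c *\<^sub>R x) \<partial>lborel)"
    by (subst integral_density) (auto simp: integral_distr)
  finally show ?thesis .
qed

section \<open>Polynomials times Gaussians, and convolution with them\<close>

lemma real_polynomial_function_has_derivative:
  fixes p :: "'a::real_normed_vector \<Rightarrow> real"
  assumes "real_polynomial_function p"
  shows "\<exists>dp. (\<forall>z. (p has_derivative dp z) (at z)) \<and> (\<forall>v. real_polynomial_function (\<lambda>z. dp z v))"
  using assms
proof induction
  case (linear f)
  then show ?case by (intro exI[of _ "\<lambda>_. f"]) (auto intro: bounded_linear_imp_has_derivative)
next
  case (const c)
  then show ?case by (intro exI[of _ "\<lambda>_ _. 0"]) auto
next
  case (add f g)
  then obtain df dg where "\<forall>z. (f has_derivative df z) (at z)" "\<forall>v. real_polynomial_function (\<lambda>z. df z v)"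
    "\<forall>z. (g has_derivative dg z) (at z)" "\<forall>v. real_polynomial_function (\<lambda>z. dg z v)" by blast
  then show ?case
    by (intro exI[of _ "\<lambda>z v. df z v + dg z v"]) (auto intro!: has_derivative_add)
next
  case (mult f g)
  then obtain df dg where "\<forall>z. (f has_derivative df z) (at z)" "\<forall>v. real_polynomial_function (\<lambda>z. df z v)"
    "\<forall>z. (g has_derivative dg z) (at z)" "\<forall>v. real_polynomial_function (\<lambda>z. dg z v)" by blast
  moreover from this mult.hyps have "real_polynomial_function (\<lambda>z. f z * dg z v + df z v * g z)" for v
    by (intro real_polynomial_function.intros(3) real_polynomial_function.intros(4)) auto
  ultimately show ?case
    by (intro exI[of _ "\<lambda>z v. f z * dg z v + df z v * g z"]) (auto intro!: has_derivative_mult)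
qed

lemma real_polynomial_function_le:
  fixes p :: "'a::real_normed_vector \<Rightarrow> real"
  assumes "real_polynomial_function p"
  shows "\<exists>C n. C \<ge> 0 \<and> (\<forall>z. \<bar>p z\<bar> \<le> C * (1 + norm z) ^ n)"
  using assms
proof induction
  case (linear f)
  then obtain K where K: "K \<ge> 0" "\<And>z. norm (f z) \<le> norm z * K" using bounded_linear.nonneg_bounded by blast
  have "\<bar>f z\<bar> \<le> K * (1 + norm z) ^ 1" for z
    using K(2)[of z] K(1) by (simp add: distrib_left mult.commute)
  with K show ?case by blast
next
  case (const c)
  then show ?case by (intro exI[of _ "\<bar>c\<bar>"] exI[of _ 0]) auto
next
  case (add f g)
  then obtain C m D n where *: "C \<ge> 0" "\<And>z. \<bar>f z\<bar> \<le> C * (1 + norm z) ^ m" "D \<ge> 0" "\<And>z. \<bar>g z\<bar> \<le> D * (1 + norm z) ^ n"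
    by blast
  have "\<bar>f z + g z\<bar> \<le> (C + D) * (1 + norm z) ^ max m n" for z
  proof -
    have "C * (1 + norm z) ^ m \<le> C * (1 + norm z) ^ max m n" "D * (1 + norm z) ^ n \<le> D * (1 + norm z) ^ max m n"
      using * by (auto intro!: mult_left_mono power_increasing)
    then show ?thesis using *(2,4)[of z] by (simp add: distrib_right)
  qed
  with * show ?case by (metis add_nonneg_nonneg)
next
  case (mult f g)
  then obtain C m D n where *: "C \<ge> 0" "\<And>z. \<bar>f z\<bar> \<le> C * (1 + norm z) ^ m" "D \<ge> 0" "\<And>z. \<bar>g z\<bar> \<le> D * (1 + norm z) ^ n"
    by blast
  have "\<bar>f z * g z\<bar> \<le> (C * D) * (1 + norm z) ^ (m + n)" for z
  proof -
    have "\<bar>f z\<bar> * \<bar>g z\<bar> \<le> (C * (1 + norm z) ^ m) * (D * (1 + norm z) ^ n)"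
      using * by (intro mult_mono) auto
    then show ?thesis by (simp add: abs_mult power_add ac_simps)
  qed
  with * show ?case by (metis mult_nonneg_nonneg)
qed

definition gauss :: "real \<Rightarrow> 'a::euclidean_space \<Rightarrow> real" where
  "gauss t z = exp (- (z \<bullet> z) / (2 * t))"

lemma gauss_has_derivative:
  assumes "t > 0"
  shows "(gauss t has_derivative (\<lambda>v. - ((z \<bullet> v) / t) * gauss t z)) (at z)"
proof -
  have "((\<lambda>z. z \<bullet> z) has_derivative (\<lambda>v. z \<bullet> v + v \<bullet> z)) (at z)"
    by (rule has_derivative_inner[OF has_derivative_ident has_derivative_ident])
  from has_derivative_mult_right[OF this, of "- 1 / (2 * t)"]
  have "((\<lambda>z. - (z \<bullet> z) / (2 * t)) has_derivative (\<lambda>v. - 1 / (2 * t) * (z \<bullet> v + v \<bullet> z))) (at z)"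
    by simp
  from has_derivative_exp[OF this]
  have 1: "(gauss t has_derivative (\<lambda>v. - 1 / (2 * t) * (z \<bullet> v + v \<bullet> z) * exp (- (z \<bullet> z) / (2 * t)))) (at z)"
    unfolding gauss_def[abs_def] by (simp only: mult_ac)
  have "- 1 / (2 * t) * (z \<bullet> v + v \<bullet> z) = - ((z \<bullet> v) / t)" for v
    unfolding inner_commute[of v z] using assms by (simp add: divide_simps)
  with 1 show ?thesis by (simp only: gauss_def)
qed

lemma polynomial_gaussian_le:
  fixes p :: "'a::euclidean_space \<Rightarrow> real"
  assumes p: "real_polynomial_function p" and t: "t > 0"
  shows "\<exists>C\<ge>0. \<forall>z. \<bar>p z * gauss t z\<bar> \<le> C * exp (- 3 * norm z)"
proof -
  obtain C n where C: "C \<ge> 0" "\<And>z. \<bar>p z\<bar> \<le> C * (1 + norm z) ^ n"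
    using real_polynomial_function_le[OF p] by blast
  define K where "K = C * (fact n * exp 1 * exp (8 * t))"
  have "\<bar>p z * gauss t z\<bar> \<le> K * exp (- 3 * norm z)" for z
  proof -
    define r where "r = norm z"
    have r: "r \<ge> 0" "z \<bullet> z = r\<^sup>2" by (simp_all add: r_def dot_square_norm)
    have "(\<Sum>k\<in>{n}. (1 + r) ^ k /\<^sub>R fact k) \<le> (\<Sum>k. (1 + r) ^ k /\<^sub>R fact k)"
      by (rule sum_le_suminf[OF summable_exp_generic]) (use r in auto)
    then have "(1 + r) ^ n / fact n \<le> exp (1 + r)"
      by (simp add: exp_def divide_inverse mult.commute)
    then have 1: "(1 + r) ^ n \<le> fact n * exp (1 + r)" by (simp add: divide_simps mult.commute)
    \<comment> \<open>Completing the square with slope 4: one unit pays for the factor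
      \<open>exp r\<close> that bounds the polynomial, and three remain as the decay rate.\<close>
    have "0 \<le> (r - 4 * t)\<^sup>2 / (2 * t)" using t by simp
    also have "\<dots> = r\<^sup>2 / (2 * t) - 4 * r + 8 * t"
      using t by (simp add: power2_eq_square field_simps)
    finally have 2: "r - r\<^sup>2 / (2 * t) \<le> 8 * t - 3 * r" by simp
    have 3: "\<bar>p z\<bar> \<le> C * (fact n * exp (1 + r))"
      using C(2)[of z] mult_left_mono[OF 1 C(1)] unfolding r_def by linarith
    have "\<bar>p z * gauss t z\<bar> = \<bar>p z\<bar> * exp (- r\<^sup>2 / (2 * t))"
      by (simp add: abs_mult r(2) gauss_def)
    also have "\<dots> \<le> (C * (fact n * exp (1 + r))) * exp (- r\<^sup>2 / (2 * t))"
      by (rule mult_right_mono[OF 3]) simp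
    also have "\<dots> = C * (fact n * exp 1) * exp (r - r\<^sup>2 / (2 * t))"
    proof -
      have "exp (1 + r) * exp (- r\<^sup>2 / (2 * t)) = exp (1 + r + - r\<^sup>2 / (2 * t))" by (rule exp_add[symmetric])
      also have "1 + r + - r\<^sup>2 / (2 * t) = 1 + (r - r\<^sup>2 / (2 * t))" by simp
      also have "exp \<dots> = exp 1 * exp (r - r\<^sup>2 / (2 * t))" by (rule exp_add)
      finally show ?thesis by (simp only: mult.assoc)
    qed
    also have "\<dots> \<le> C * (fact n * exp 1) * exp (8 * t - 3 * r)"
      by (rule mult_left_mono) (use C(1) 2 in auto)
    also have "\<dots> = K * exp (- 3 * norm z)"
      by (simp add: K_def r_def[symmetric] exp_add[symmetric] mult.assoc)
    finally show ?thesis .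
  qed
  moreover have "K \<ge> 0" using C(1) by (simp add: K_def)
  ultimately show ?thesis by blast
qed


text \<open>The decay rate 3 of the kernels absorbs the growth of U and still leaves an integrable bound,
  locally uniformly in the translation.\<close>

definition gconv :: "('a::euclidean_space \<Rightarrow> real) \<Rightarrow> ('a \<Rightarrow> real) \<Rightarrow> 'a \<Rightarrow> real" where
  "gconv U k x = (\<integral>y. U y * k (x - y) \<partial>lborel)"

text \<open>This class contains the Gaussian and is closed under directional derivatives, so every
  derivative of \<open>gconv U k\<close> is again a convolution of the same kind. Smoothness to all
  orders rests on this.\<close>

definition poly_gauss :: "real \<Rightarrow> ('a::euclidean_space \<Rightarrow> real) set" where
  "poly_gauss t = {\<lambda>z. p z * gauss t z | p. real_polynomial_function p}"

lemma poly_gauss_mult: "real_polynomial_function p \<Longrightarrow> (\<lambda>z. p z * gauss t z) \<in> poly_gauss t"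
  unfolding poly_gauss_def by auto

lemma gauss_in: "gauss t \<in> poly_gauss t"
  using poly_gauss_mult[OF real_polynomial_function.intros(2)[of 1], of t] by simp

definition exp_growth :: "('a::euclidean_space \<Rightarrow> real) \<Rightarrow> bool" where
  "exp_growth U \<longleftrightarrow> U \<in> borel_measurable borel \<and> (\<exists>M\<ge>0. \<forall>y. \<bar>U y\<bar> \<le> M * exp (norm y))"

lemma poly_gauss_le:
  assumes "k \<in> poly_gauss t" "t > 0"
  shows "\<exists>C\<ge>0. \<forall>z. \<bar>k z\<bar> \<le> C * exp (- 3 * norm z)"
  using assms polynomial_gaussian_le by (auto simp: poly_gauss_def)

lemma poly_gauss_has_derivative:
  assumes k: "k \<in> poly_gauss t" and t: "t > 0"
  shows "\<exists>dk. (\<forall>z. (k has_derivative dk z) (at z)) \<and> (\<forall>v. (\<lambda>z. dk z v) \<in> poly_gauss t)"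
proof -
  obtain p where p: "real_polynomial_function p" and k: "k = (\<lambda>z. p z * gauss t z)"
    using k by (auto simp: poly_gauss_def)
  obtain dp where dp: "\<And>z. (p has_derivative dp z) (at z)" "\<And>v. real_polynomial_function (\<lambda>z. dp z v)"
    using real_polynomial_function_has_derivative[OF p] by blast
  define dk where "dk z v = (dp z v - p z * (z \<bullet> v) / t) * gauss t z" for z v
  have "(k has_derivative dk z) (at z)" for z
    using has_derivative_mult[OF dp(1) gauss_has_derivative[OF t, of z]] unfolding k
    by (rule has_derivative_eq_rhs) (simp add: fun_eq_iff dk_def algebra_simps)
  moreover have "(\<lambda>z. dk z v) \<in> poly_gauss t" for v
  proof -
    have "real_polynomial_function (\<lambda>z. p z * (z \<bullet> v) / t)"
      by (rule real_polynomial_function_divide[OF real_polynomial_function.intros(4)[OF p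
            real_polynomial_function.intros(1)[OF bounded_linear_inner_left]]])
    from poly_gauss_mult[OF real_polynomial_function_diff[OF dp(2) this]] show ?thesis
      unfolding dk_def .
  qed
  ultimately show ?thesis by blast
qed

lemma poly_gauss_measurable:
  assumes "k \<in> poly_gauss t" "t > 0"
  shows "k \<in> borel_measurable borel"
proof -
  obtain dk where "\<And>z. (k has_derivative dk z) (at z)"
    using poly_gauss_has_derivative[OF assms] by blast
  then have "continuous_on UNIV k"
    by (meson continuous_at_imp_continuous_on has_derivative_continuous)
  then show ?thesis by (rule borel_measurable_continuous_onI)
qed

lemma exp_shift_le:
  fixes x y x0 :: "'a::real_normed_vector"
  assumes "x \<in> ball x0 1"
  shows "exp (norm y) * exp (- 3 * norm (x - y)) \<le> exp (3 * (norm x0 + 1)) * exp (- norm y)"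
proof -
  have "norm x \<le> norm x0 + 1" using assms norm_triangle_ineq3[of x x0]
    by (simp add: dist_norm norm_minus_commute)
  moreover have "norm y \<le> norm x + norm (x - y)"
    using norm_triangle_ineq2[of y x] by (simp add: norm_minus_commute)
  ultimately have "norm y \<le> norm x0 + 1 + norm (x - y)" by linarith
  moreover have "0 \<le> norm (x - y)" "0 \<le> norm x0" by simp_all
  ultimately have "norm y + - 3 * norm (x - y) \<le> 3 * (norm x0 + 1) + - norm y" by argo
  then show ?thesis by (simp flip: exp_add)
qed

lemma exp_growth_mult_le:
  assumes U: "\<And>y. \<bar>U y\<bar> \<le> M * exp (norm y)" and M: "M \<ge> 0"
    and k: "\<And>z. \<bar>k z\<bar> \<le> C * exp (- 3 * norm z)" and C: "C \<ge> 0"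
    and x: "x \<in> ball x0 1"
  shows "\<bar>U y * k (x - y)\<bar> \<le> M * C * exp (3 * (norm x0 + 1)) * exp (- norm y)"
proof -
  have "\<bar>U y * k (x - y)\<bar> \<le> (M * exp (norm y)) * (C * exp (- 3 * norm (x - y)))"
    unfolding abs_mult using U k M C by (intro mult_mono) auto
  also have "\<dots> = M * C * (exp (norm y) * exp (- 3 * norm (x - y)))" by (simp add: ac_simps)
  also have "\<dots> \<le> M * C * (exp (3 * (norm x0 + 1)) * exp (- norm y))"
    using M C by (intro mult_left_mono exp_shift_le[OF x]) auto
  finally show ?thesis by (simp add: ac_simps)
qed

lemma gconv_integrable:
  assumes U: "exp_growth U" and k: "k \<in> poly_gauss t" and t: "t > 0"
  shows "integrable lborel (\<lambda>y. U y * k (x - y))"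
proof -
  obtain M where M: "M \<ge> 0" "\<And>y. \<bar>U y\<bar> \<le> M * exp (norm y)" and [measurable]: "U \<in> borel_measurable borel"
    using U by (auto simp: exp_growth_def)
  obtain C where C: "C \<ge> 0" "\<And>z. \<bar>k z\<bar> \<le> C * exp (- 3 * norm z)" using poly_gauss_le[OF k t] by blast
  have [measurable]: "k \<in> borel_measurable borel" by (rule poly_gauss_measurable[OF k t])
  show ?thesis
  proof (rule Bochner_Integration.integrable_bound[where f="\<lambda>y. M * C * exp (3 * (norm x + 1)) * exp (- norm y)"])
    show "AE y in lborel. norm (U y * k (x - y)) \<le> norm (M * C * exp (3 * (norm x + 1)) * exp (- norm y))"
      using exp_growth_mult_le[OF M(2,1) C(2,1), of x x] M(1) C(1) by (auto intro!: AE_I2 simp: abs_mult)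
  qed (use integrable_exp_minus_norm in auto)
qed

text \<open>The derivative falls on the kernel, so a measurable \<open>U\<close> of exponential
  growth is smoothed.\<close>

lemma gconv_has_derivative:
  fixes U :: "'a::euclidean_space \<Rightarrow> real"
  assumes U: "exp_growth U" and k: "k \<in> poly_gauss t" and t: "t > 0"
    and dk: "\<And>z. (k has_derivative dk z) (at z)" "\<And>v. (\<lambda>z. dk z v) \<in> poly_gauss t"
  shows "(gconv U k has_derivative (\<lambda>v. gconv U (\<lambda>z. dk z v) x)) (at x)"
proof -
  obtain M where M: "M \<ge> 0" "\<And>y. \<bar>U y\<bar> \<le> M * exp (norm y)" and [measurable]: "U \<in> borel_measurable borel"
    using U by (auto simp: exp_growth_def)
  have "\<forall>b. \<exists>C\<ge>0. \<forall>z. \<bar>dk z b\<bar> \<le> C * exp (- 3 * norm z)"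
    using poly_gauss_le[OF dk(2) t] by blast
  then obtain C where C: "\<And>b. C b \<ge> 0" "\<And>b z. \<bar>dk z b\<bar> \<le> C b * exp (- 3 * norm z)" by metis
  \<comment> \<open>Each \<open>dk z\<close> is linear, so its bounds on the finitely many basis
    vectors add up to one bound for all directions.\<close>
  define D where "D = (\<Sum>b\<in>Basis. C b)"
  have D: "D \<ge> 0" by (simp add: D_def sum_nonneg C)
  have dk_le: "\<bar>dk z v\<bar> \<le> (D * norm v) * exp (- 3 * norm z)" for z v
  proof -
    have lin: "linear (dk z)" using dk(1) by (rule has_derivative_linear)
    have "dk z v = dk z (\<Sum>b\<in>Basis. (v \<bullet> b) *\<^sub>R b)" by (simp add: euclidean_representation)
    also have "\<dots> = (\<Sum>b\<in>Basis. (v \<bullet> b) * dk z b)" by (simp add: linear_sum[OF lin] linear_scale[OF lin])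
    finally have "\<bar>dk z v\<bar> \<le> (\<Sum>b\<in>Basis. \<bar>v \<bullet> b\<bar> * \<bar>dk z b\<bar>)"
      by (metis (no_types, lifting) abs_mult sum.cong sum_abs)
    also have "\<dots> \<le> (\<Sum>b\<in>Basis. norm v * (C b * exp (- 3 * norm z)))"
      by (intro sum_mono mult_mono C(2) Basis_le_norm) auto
    also have "\<dots> = (D * norm v) * exp (- 3 * norm z)"
      by (simp add: D_def sum_distrib_left sum_distrib_right ac_simps)
    finally show ?thesis .
  qed
  define B where "B y = M * D * exp (3 * (norm x + 1)) * exp (- norm y)" for y :: 'a
  have km: "(\<lambda>z. dk z v) \<in> borel_measurable borel" for v by (rule poly_gauss_measurable[OF dk(2) t])
  have "((\<lambda>x. \<integral>y. U y * k (x - y) \<partial>lborel) has_derivative (\<lambda>v. \<integral>y. U y * dk (x - y) v \<partial>lborel)) (at x)"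
  proof (rule has_derivative_integral_dominated[where r=1 and D=B and f'="\<lambda>x y v. U y * dk (x - y) v"])
    show "integrable lborel (\<lambda>y. U y * k (x - y))" for x by (rule gconv_integrable[OF U k t])
    show "((\<lambda>x. U y * k (x - y)) has_derivative (\<lambda>v. U y * dk (x' - y) v)) (at x')" for x' y
    proof -
      have "((\<lambda>x. x - y) has_derivative (\<lambda>v. v)) (at x')" by (auto intro!: derivative_eq_intros)
      from has_derivative_compose[OF this dk(1)] show ?thesis
        by (intro has_derivative_mult_right) simp
    qed
    show "\<bar>U y * dk (x' - y) v\<bar> \<le> B y * norm v" if "x' \<in> ball x 1" for x' y v
      using exp_growth_mult_le[OF M(2,1), of "\<lambda>z. dk z v" "D * norm v" x' x y] dk_le D that
      by (simp add: B_def ac_simps)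
    show "integrable lborel B" unfolding B_def using integrable_exp_minus_norm by auto
    show "0 \<le> B y" for y using M D by (simp add: B_def)
    show "(\<lambda>y. U y * dk (x - y) v) \<in> borel_measurable lborel" for v
      using measurable_compose[OF _ km[of v], of "\<lambda>y. x - y" borel] by simp
  qed simp
  then show ?thesis by (simp add: gconv_def[abs_def])
qed

lemma real_polynomial_function_inner [intro]: "real_polynomial_function (\<lambda>z. z \<bullet> v)"
  by (rule real_polynomial_function.intros(1)[OF bounded_linear_inner_left])

lemma real_polynomial_function_inner_self [intro]:
  "real_polynomial_function (\<lambda>z::'a::euclidean_space. z \<bullet> z)"
proof -
  have "(\<lambda>z::'a. z \<bullet> z) = (\<lambda>z. \<Sum>b\<in>Basis. (z \<bullet> b) * (z \<bullet> b))"
    by (rule ext) (rule euclidean_inner)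
  moreover have "real_polynomial_function (\<lambda>z::'a. \<Sum>b\<in>Basis. (z \<bullet> b) * (z \<bullet> b))"
    by (intro real_polynomial_function_sum real_polynomial_function.intros(4)) auto
  ultimately show ?thesis by simp
qed

lemma exp_growth_const: "exp_growth (\<lambda>_. c)"
  unfolding exp_growth_def by (auto intro!: exI[of _ "\<bar>c\<bar>"] mult_le_cancel_left1[THEN iffD2])

lemma poly_gauss_integrable:
  assumes "k \<in> poly_gauss t" "t > 0" shows "integrable lborel k"
proof -
  have "integrable lborel (\<lambda>y. 1 * k (0 - y))" by (rule gconv_integrable[OF exp_growth_const assms])
  then have "integrable (distr lborel borel (\<lambda>y. - y)) k"
    using poly_gauss_measurable[OF assms] by (subst integrable_distr_eq) auto
  moreover have "(lborel :: 'a measure) = distr lborel borel (\<lambda>y. - y)"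
    using lborel_affine[of "-1" "0::'a"] by (simp add: density_1)
  ultimately show ?thesis by simp
qed

text \<open>By translation invariance of the integral.\<close>
lemma integral_poly_gauss_derivative:
  assumes k: "k \<in> poly_gauss t" and t: "t > 0"
    and dk: "\<And>z. (k has_derivative dk z) (at z)" "\<And>v. (\<lambda>z. dk z v) \<in> poly_gauss t"
  shows "(\<integral>z. dk z v \<partial>lborel) = 0"
proof -
  have inv: "gconv (\<lambda>_. 1) k x = (\<integral>z. k z \<partial>lborel)" if "k \<in> poly_gauss t" for x :: 'a and k
    using lborel_integral_affine[of "-1" k x] poly_gauss_measurable[OF that t] by (simp add: gconv_def)
  have "(gconv (\<lambda>_. 1) k has_derivative (\<lambda>v. gconv (\<lambda>_. 1) (\<lambda>z. dk z v) 0)) (at 0)"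
    by (rule gconv_has_derivative[OF exp_growth_const k t dk])
  moreover have "(gconv (\<lambda>_. 1) k has_derivative (\<lambda>v. 0)) (at 0)"
  proof -
    have "gconv (\<lambda>_. 1) k = (\<lambda>_. \<integral>z. k z \<partial>lborel)" by (rule ext) (rule inv[OF k])
    then show ?thesis by simp
  qed
  ultimately have "(\<lambda>v. gconv (\<lambda>_. 1) (\<lambda>z. dk z v) 0) = (\<lambda>v. 0)" by (rule has_derivative_unique)
  then show ?thesis using inv[OF dk(2)] by (metis (no_types))
qed


lemma gauss_inner_has_derivative:
  assumes "t > 0"
  shows "((\<lambda>z. (z \<bullet> c) * gauss t z) has_derivative (\<lambda>v. ((v \<bullet> c) - (z \<bullet> c) * (z \<bullet> v) / t) * gauss t z)) (at z)"
proof -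
  have "((\<lambda>z. z \<bullet> c) has_derivative (\<lambda>v. v \<bullet> c)) (at z)"
    by (rule bounded_linear_imp_has_derivative[OF bounded_linear_inner_left])
  from has_derivative_mult[OF this gauss_has_derivative[OF assms, of z]]
  show ?thesis by (rule has_derivative_eq_rhs) (simp add: fun_eq_iff algebra_simps)
qed

lemma gauss_inner_in: "(\<lambda>z. (z \<bullet> c) * gauss t z) \<in> poly_gauss t"
  by (rule poly_gauss_mult) auto

lemma gauss_inner_inner_in:
  "(\<lambda>z. (a - (z \<bullet> c) * (z \<bullet> v) / t) * gauss t z) \<in> poly_gauss t"
proof (rule poly_gauss_mult)
  have "real_polynomial_function (\<lambda>z. (z \<bullet> c) * (z \<bullet> v) / t)"
    by (rule real_polynomial_function_divide[OF real_polynomial_function.intros(4)]) auto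
  then show "real_polynomial_function (\<lambda>z. a - (z \<bullet> c) * (z \<bullet> v) / t)"
    by (rule real_polynomial_function_diff[OF real_polynomial_function.intros(2)])
qed

section \<open>The standard Gaussian density, its moments and its averages\<close>

definition gauss_mass :: "'a::euclidean_space itself \<Rightarrow> real" where
  "gauss_mass _ = (\<integral>z. gauss 1 (z::'a) \<partial>lborel)"

definition gdens :: "'a::euclidean_space \<Rightarrow> real" where
  "gdens z = gauss 1 z / gauss_mass TYPE('a)"

lemma gauss_pos: "gauss t z > 0" by (simp add: gauss_def)

lemma gauss_measurable [measurable]: "gauss t \<in> borel_measurable borel"
  unfolding gauss_def[abs_def] by measurable

lemma gauss_mass_pos: "gauss_mass TYPE('a::euclidean_space) > 0"
proof -
  have int: "integrable lborel (gauss 1 :: 'a \<Rightarrow> real)" by (rule poly_gauss_integrable[OF gauss_in]) simp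
  have "(\<integral>z. gauss 1 (z::'a) \<partial>lborel) \<noteq> 0"
  proof
    assume "(\<integral>z. gauss 1 (z::'a) \<partial>lborel) = 0"
    then have "AE z::'a in lborel. gauss 1 z = 0"
      using integral_nonneg_eq_0_iff_AE[OF int] by (simp add: less_imp_le[OF gauss_pos])
    then have "AE z::'a in lborel. False" by (rule AE_mp) (auto intro!: AE_I2 simp: gauss_def)
    then have "emeasure lborel (UNIV::'a set) = 0"
      using AE_iff_measurable[of "UNIV::'a set" lborel "\<lambda>_. False"] by simp
    then show False by simp
  qed
  moreover have "(\<integral>z. gauss 1 (z::'a) \<partial>lborel) \<ge> 0"
    by (intro integral_nonneg_AE) (auto simp: less_imp_le[OF gauss_pos])
  ultimately show ?thesis by (simp add: gauss_mass_def)
qed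

lemma gdens_pos: "gdens z > 0"
  by (simp add: gdens_def gauss_pos gauss_mass_pos)

lemma gdens_minus [simp]: "gdens (- z) = gdens z"
  by (simp add: gdens_def gauss_def)

lemma gdens_measurable [measurable]: "gdens \<in> borel_measurable borel"
  unfolding gdens_def[abs_def] by measurable

lemma gdens_integral: "integrable lborel (gdens :: 'a::euclidean_space \<Rightarrow> real)" "(\<integral>z. gdens (z::'a) \<partial>lborel) = 1"
proof -
  have "integrable lborel (gauss 1 :: 'a \<Rightarrow> real)" by (rule poly_gauss_integrable[OF gauss_in]) simp
  then show "integrable lborel (gdens :: 'a \<Rightarrow> real)" "(\<integral>z. gdens (z::'a) \<partial>lborel) = 1"
    using gauss_mass_pos[where 'a='a] by (simp_all add: gdens_def[abs_def] gauss_mass_def)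
qed

text \<open>Gaussian integration by parts: the derivative of
  \<open>(z \<bullet> c) * gauss 1 z\<close> in the direction \<open>b\<close> integrates to 0, and
  its two terms are \<open>b \<bullet> c\<close> times the mass and minus the second moment.\<close>

lemma gdens_second_moment:
  fixes b c :: "'a::euclidean_space"
  shows "integrable lborel (\<lambda>z. (z \<bullet> b) * (z \<bullet> c) * gdens z)"
    and "(\<integral>z. (z \<bullet> b) * (z \<bullet> c) * gdens z \<partial>lborel) = b \<bullet> c"
proof -
  have i1: "integrable lborel (\<lambda>z::'a. (z \<bullet> b) * (z \<bullet> c) * gauss 1 z)"
    by (rule poly_gauss_integrable[OF poly_gauss_mult]) (auto intro: real_polynomial_function.intros(4))
  then show "integrable lborel (\<lambda>z. (z \<bullet> b) * (z \<bullet> c) * gdens z)"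
    by (simp add: gdens_def)
  have i2: "integrable lborel (\<lambda>z::'a. (b \<bullet> c) * gauss 1 z)"
    by (intro integrable_mult_right poly_gauss_integrable[OF gauss_in]) simp
  have "(\<integral>z. ((b \<bullet> c) - (z \<bullet> c) * (z \<bullet> b) / 1) * gauss 1 z \<partial>lborel) = 0"
    by (rule integral_poly_gauss_derivative[OF gauss_inner_in[of c] _ gauss_inner_has_derivative])
       (rule gauss_inner_inner_in zero_less_one)+
  then have "(\<integral>z. (b \<bullet> c) * gauss 1 z - (z \<bullet> b) * (z \<bullet> c) * gauss 1 z \<partial>lborel) = 0"
    by (simp add: algebra_simps)
  then have "(\<integral>z. (z \<bullet> b) * (z \<bullet> c) * gauss 1 z \<partial>lborel) = (b \<bullet> c) * gauss_mass TYPE('a)"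
    by (subst (asm) Bochner_Integration.integral_diff[OF i2 i1]) (simp add: gauss_mass_def)
  then show "(\<integral>z. (z \<bullet> b) * (z \<bullet> c) * gdens z \<partial>lborel) = b \<bullet> c"
    using gauss_mass_pos[where 'a='a] by (simp add: gdens_def)
qed

text \<open>The time of the heat semigroup is \<open>s\<^sup>2\<close>.\<close>

definition heat :: "('a::euclidean_space \<Rightarrow> real) \<Rightarrow> real \<Rightarrow> 'a \<Rightarrow> real" where
  "heat U s x = (\<integral>z. U (x + s *\<^sub>R z) * gdens z \<partial>lborel)"

text \<open>In \<open>heat\<close> the scale acts on the argument of \<open>U\<close>, which gives
  convexity and Lipschitz bounds and makes sense at time 0; in \<open>gconv\<close> it sits in the
  kernel, which gives derivatives. The substitution \<open>y = x + sqrt t *\<^sub>R z\<close> links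
  the two.\<close>

lemma heat_eq_gconv:
  fixes U :: "'a::euclidean_space \<Rightarrow> real"
  assumes U: "U \<in> borel_measurable borel" and t: "t > 0"
  shows "heat U (sqrt t) x = t powr (- real DIM('a) / 2) / gauss_mass TYPE('a) * gconv U (gauss t) x"
proof -
  have [measurable]: "U \<in> borel_measurable borel" by (rule U)
  have g: "gauss t (x - (x + sqrt t *\<^sub>R z)) = gauss 1 z" for z
    using t by (simp add: gauss_def field_simps power2_eq_square[symmetric])
  have "gconv U (gauss t) x = \<bar>sqrt t\<bar> ^ DIM('a) * (\<integral>z. U (x + sqrt t *\<^sub>R z) * gauss t (x - (x + sqrt t *\<^sub>R z)) \<partial>lborel)"
    unfolding gconv_def by (rule lborel_integral_affine) (use t in auto)
  also have "\<dots> = sqrt t ^ DIM('a) * (heat U (sqrt t) x * gauss_mass TYPE('a))"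
    using t gauss_mass_pos[where 'a='a] unfolding g by (simp add: heat_def gdens_def)
  also have "sqrt t ^ DIM('a) = t powr (real DIM('a) / 2)"
    using t by (simp add: powr_half_sqrt[symmetric] powr_powr flip: powr_realpow)
  finally show ?thesis using t gauss_mass_pos[where 'a='a]
    by (simp add: powr_minus powr_minus_divide field_simps)
qed

lemma heat_integrable:
  fixes U :: "'a::euclidean_space \<Rightarrow> real"
  assumes U: "exp_growth U"
  shows "integrable lborel (\<lambda>z. U (x + s *\<^sub>R z) * gdens z)"
proof -
  obtain M where M: "M \<ge> 0" "\<And>y. \<bar>U y\<bar> \<le> M * exp (norm y)" and [measurable]: "U \<in> borel_measurable borel"
    using U by (auto simp: exp_growth_def)
  show ?thesis
  proof (cases "s = 0")
    case True then show ?thesis using gdens_integral(1)[where 'a='a] by simp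
  next
    case False
    define t where "t = s\<^sup>2"
    have t: "t > 0" using False by (simp add: t_def)
    have "integrable lborel (\<lambda>y. U y * gauss t (x - y))" by (rule gconv_integrable[OF U gauss_in t])
    then have "integrable (density (distr lborel borel (\<lambda>y. x + s *\<^sub>R y)) (\<lambda>_. ennreal (\<bar>s\<bar> ^ DIM('a)))) (\<lambda>y. U y * gauss t (x - y))"
      using lborel_affine[OF False, of x] by simp
    then have "integrable (distr lborel borel (\<lambda>y. x + s *\<^sub>R y)) (\<lambda>y. \<bar>s\<bar> ^ DIM('a) *\<^sub>R (U y * gauss t (x - y)))"
      by (subst (asm) integrable_density) auto
    then have "integrable (distr lborel borel (\<lambda>y. x + s *\<^sub>R y)) (\<lambda>y. U y * gauss t (x - y))"
      using False by simp
    then have "integrable lborel (\<lambda>z. U (x + s *\<^sub>R z) * gauss t (x - (x + s *\<^sub>R z)))"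
      by (subst (asm) integrable_distr_eq) auto
    moreover have "gauss t (x - (x + s *\<^sub>R z)) = gauss 1 z" for z
      using False by (simp add: gauss_def t_def power2_eq_square)
    ultimately show ?thesis by (simp add: gdens_def)
  qed
qed

section \<open>Subgradients of convex functions\<close>

text \<open>For convex \<open>U\<close> the Lebesgue measure of this set is the Monge-Ampere measure
  of \<open>E\<close>, the substitute for the integral of det D^2U over \<open>E\<close>.\<close>

definition subdiff :: "('a::real_inner \<Rightarrow> real) \<Rightarrow> 'a set \<Rightarrow> 'a set" where
  "subdiff U E = {p. \<exists>x\<in>E. \<forall>z. U x + p \<bullet> (z - x) \<le> U z}"

text \<open>Pairs of a point and a subgradient form a closed set, and the Lipschitz constant bounds
  the subgradients, so the set is the projection of a compact one. Its measurability below comes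
  from here.\<close>

lemma compact_subdiff:
  fixes U :: "'a::euclidean_space \<Rightarrow> real"
  assumes lip: "L-lipschitz_on UNIV U" and E: "compact E"
  shows "compact (subdiff U E)"
proof -
  have cont: "continuous_on UNIV U" by (rule lipschitz_on_continuous_on[OF lip])
  define S where "S = (E \<times> cball 0 L) \<inter> (\<Inter>z. {q. U (fst q) + snd q \<bullet> (z - fst q) \<le> U z})"
  have "closed {q::'a\<times>'a. U (fst q) + snd q \<bullet> (z - fst q) \<le> U z}" for z
    by (intro closed_Collect_le continuous_intros continuous_on_compose2[OF cont]) auto
  then have "compact S" unfolding S_def
    by (intro compact_Int_closed compact_Times E compact_cball closed_INT) auto
  moreover have "subdiff U E = snd ` S"
  proof
    show "snd ` S \<subseteq> subdiff U E" unfolding S_def subdiff_def by force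
    show "subdiff U E \<subseteq> snd ` S"
    proof
      fix p assume "p \<in> subdiff U E"
      then obtain x where x: "x \<in> E" "\<And>z. U x + p \<bullet> (z - x) \<le> U z" by (auto simp: subdiff_def)
      have "p \<bullet> p \<le> U (x + p) - U x" using x(2)[of "x + p"] by simp
      also have "\<dots> \<le> dist (U (x + p)) (U x)" by (simp add: dist_real_def)
      also have "\<dots> \<le> L * norm p" using lipschitz_onD[OF lip, of "x + p" x] by (simp add: dist_norm)
      finally have "norm p * norm p \<le> L * norm p" by (simp add: dot_square_norm power2_eq_square)
      then have "norm p \<le> L" using lipschitz_on_nonneg[OF lip] by (cases "p = 0") auto
      with x have "(x, p) \<in> S" by (auto simp: S_def)
      then show "p \<in> snd ` S" by force
    qed
  qed
  ultimately show ?thesis by (simp add: compact_continuous_image continuous_on_snd)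
qed

lemma has_real_derivative_along_line:
  fixes f :: "'a::real_inner \<Rightarrow> real"
  assumes "(f has_derivative (\<lambda>v. p \<bullet> v)) (at (y + t *\<^sub>R v))"
  shows "((\<lambda>t. f (y + t *\<^sub>R v)) has_real_derivative (p \<bullet> v)) (at t)"
proof -
  have "((\<lambda>t. y + t *\<^sub>R v) has_derivative (\<lambda>h. h *\<^sub>R v)) (at t)"
    by (auto intro!: derivative_eq_intros)
  from has_derivative_compose[OF this assms] show ?thesis
    by (simp add: has_field_derivative_def mult_commute_abs)
qed

lemma inner_has_real_derivative_along_line:
  fixes p :: "real^'n \<Rightarrow> real^'n"
  assumes "(p has_derivative (\<lambda>v. H *v v)) (at y)"
  shows "((\<lambda>t. p (y + t *\<^sub>R v) \<bullet> w) has_real_derivative ((H *v v) \<bullet> w)) (at 0)"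
proof -
  have "((\<lambda>t. y + t *\<^sub>R v) has_derivative (\<lambda>h. h *\<^sub>R v)) (at 0)"
    by (auto intro!: derivative_eq_intros)
  from has_derivative_inner_left[OF has_derivative_compose[OF this, of p "\<lambda>v. H *v v"], of w] assms
  show ?thesis by (simp add: has_field_derivative_def matrix_vector_mult_scaleR mult_commute_abs)
qed

text \<open>If the second derivative along \<open>v\<close> were negative, the slope along
  \<open>v\<close> would be negative just after \<open>y\<close>, and the mean value theorem would
  produce a smaller value of \<open>f\<close> nearby.\<close>

lemma local_min_second_order:
  fixes f :: "real^'n \<Rightarrow> real"
  assumes S: "open S" "y \<in> S" and min: "\<And>x. x \<in> S \<Longrightarrow> f y \<le> f x"
    and f: "\<And>x. x \<in> S \<Longrightarrow> (f has_derivative (\<lambda>v. p x \<bullet> v)) (at x)"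
    and p: "(p has_derivative (\<lambda>v. H *v v)) (at y)"
  shows "p y = 0" and "0 \<le> v \<bullet> (H *v v)"
proof -
  have "(\<lambda>v. p y \<bullet> v) = (\<lambda>v. 0)"
    by (rule differential_zero_maxmin[OF S(2,1) f[OF S(2)]]) (use min in auto)
  then have "p y \<bullet> p y = 0" by metis
  then show py: "p y = 0" by simp
  show "0 \<le> v \<bullet> (H *v v)"
  proof (rule ccontr)
    assume "\<not> 0 \<le> v \<bullet> (H *v v)"
    then have neg: "v \<bullet> (H *v v) < 0" by simp
    have "((\<lambda>t. p (y + t *\<^sub>R v) \<bullet> v) has_real_derivative (v \<bullet> (H *v v))) (at 0)"
      using inner_has_real_derivative_along_line[OF p, of v v] by (simp add: inner_commute)
    from DERIV_neg_dec_right[OF this neg] obtain d where d: "d > 0"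
      and dec: "\<And>h. 0 < h \<Longrightarrow> h < d \<Longrightarrow> p (y + h *\<^sub>R v) \<bullet> v < 0"
      using py by auto
    have "continuous_on UNIV (\<lambda>t. y + t *\<^sub>R v)" by (intro continuous_intros)
    then have "open ((\<lambda>t. y + t *\<^sub>R v) -` S)" using S(1) by (simp add: open_vimage)
    moreover have "(0::real) \<in> (\<lambda>t. y + t *\<^sub>R v) -` S" using S(2) by simp
    ultimately obtain e where e: "e > 0" "ball 0 e \<subseteq> (\<lambda>t. y + t *\<^sub>R v) -` S" by (meson openE)
    define t where "t = min d e / 2"
    have t: "t > 0" "t < d" "t < e" using d e by (auto simp: t_def min_def)
    have inS: "y + h *\<^sub>R v \<in> S" if "0 \<le> h" "h \<le> t" for h
      using subsetD[OF e(2), of h] that t by (simp add: dist_real_def)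
    have der: "((\<lambda>t. f (y + t *\<^sub>R v)) has_real_derivative (p (y + h *\<^sub>R v) \<bullet> v)) (at h)" if "0 \<le> h" "h \<le> t" for h
      by (rule has_real_derivative_along_line[OF f[OF inS[OF that]]])
    obtain z where z: "0 < z" "z < t" "f (y + t *\<^sub>R v) - f (y + 0 *\<^sub>R v) = (t - 0) * (p (y + z *\<^sub>R v) \<bullet> v)"
      using MVT2[OF t(1), of "\<lambda>t. f (y + t *\<^sub>R v)" "\<lambda>h. p (y + h *\<^sub>R v) \<bullet> v"] der by auto
    have "(t - 0) * (p (y + z *\<^sub>R v) \<bullet> v) < 0" using dec[of z] z t by (simp add: mult_pos_neg)
    then have "f (y + t *\<^sub>R v) < f y" using z(3) by simp
    with min[OF inS[of t]] t show False by simp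
  qed
qed

lemma trace_plus_scaled_mat: "trace (H + c *\<^sub>R mat 1 :: real^'n^'n) = trace H + c * CARD('n)"
  by (simp add: trace_def mat_def sum.distrib)

text \<open>If the trace were smaller, push \<open>\<phi>\<close> down a little: over the small set where U then lies above it,
  every subgradient of U is a gradient of \<open>\<phi>\<close> at a point where the Hessian of \<open>\<phi>\<close> is positive
  semi-definite, so by the arithmetic-geometric inequality there are too few subgradients.\<close>

lemma convex_touching_trace_ge:
  fixes U :: "real^'n::finite \<Rightarrow> real" and q :: real
  assumes lip: "L-lipschitz_on UNIV U" and q: "q > 0"
    and MA: "\<And>E. compact E \<Longrightarrow> E \<subseteq> ball x1 r \<Longrightarrow> q ^ CARD('n) * measure lebesgue E \<le> measure lebesgue (subdiff U E)"
    and x0: "x0 \<in> ball x1 r" and \<rho>: "\<rho> > 0"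
    and \<phi>: "\<And>x. x \<in> ball x0 \<rho> \<Longrightarrow> (\<phi> has_derivative (\<lambda>v. p x \<bullet> v)) (at x)"
    and p: "\<And>x. x \<in> ball x0 \<rho> \<Longrightarrow> (p has_derivative (\<lambda>v. H x *v v)) (at x)"
    and sym: "\<And>x. x \<in> ball x0 \<rho> \<Longrightarrow> transpose (H x) = H x"
    and H: "continuous_on (ball x0 \<rho>) H"
    and touch: "\<And>x. x \<in> ball x0 \<rho> \<Longrightarrow> U x \<le> \<phi> x + (U x0 - \<phi> x0)"
  shows "CARD('n) * q \<le> trace (H x0)"
proof (rule ccontr)
  let ?d = "CARD('n)"
  assume "\<not> ?d * q \<le> trace (H x0)"
  then have less: "trace (H x0) / ?d < q" by (simp add: divide_simps mult.commute)
  define s where "s = trace (H x0) / ?d"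
  \<comment> \<open>\<open>q1\<close> lies strictly between the mean eigenvalue \<open>s\<close> and
    \<open>q\<close>; the maximum keeps it positive even if \<open>s\<close> is negative.\<close>
  define q1 where "q1 = max (q / 2) ((s + q) / 2)"
  have q1: "0 < q1" "q1 < q" "s < q1"
  proof -
    have "s < q" using less by (simp add: s_def)
    then show "0 < q1" "q1 < q" "s < q1" using q by (auto simp: q1_def less_max_iff_disj)
  qed
  \<comment> \<open>Half of the gap \<open>q1 - s\<close> allows the trace of \<open>H\<close> to
    vary near \<open>x0\<close>, the other half pays for the term
    \<open>(2 * \<eta>) *\<^sub>R mat 1\<close> in \<open>Hf\<close>.\<close>
  define \<eta> where "\<eta> = (q1 - s) / 4"
  have \<eta>: "\<eta> > 0" using q1 by (simp add: \<eta>_def)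
  have contU: "continuous_on UNIV U" by (rule lipschitz_on_continuous_on[OF lip])
  have cont_tr: "continuous_on (ball x0 \<rho>) (\<lambda>y. trace (H y))"
    unfolding trace_def by (intro continuous_intros continuous_on_component H)
  have "open {y \<in> ball x0 \<rho>. trace (H y) < ?d * (q1 - 2 * \<eta>)}"
    using continuous_open_preimage[OF cont_tr open_ball, of "{..< ?d * (q1 - 2 * \<eta>)}"]
    by (simp add: vimage_def Int_def)
  define G where "G = ball x1 r \<inter> {y \<in> ball x0 \<rho>. trace (H y) < ?d * (q1 - 2 * \<eta>)}"
  have op: "open G"
    unfolding G_def using \<open>open {y \<in> ball x0 \<rho>. trace (H y) < ?d * (q1 - 2 * \<eta>)}\<close> by (intro open_Int) auto
  have x0G: "x0 \<in> G"
  proof -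
    have "s < q1 - 2 * \<eta>" using \<eta> by (simp add: \<eta>_def field_simps)
    then have "trace (H x0) < ?d * (q1 - 2 * \<eta>)" by (simp add: s_def divide_simps mult.commute)
    then show ?thesis using x0 \<rho> by (simp add: G_def)
  qed
  obtain r' where r': "r' > 0"
    and sub: "cball x0 r' \<subseteq> G"
    using open_contains_cball_eq[OF op] x0G by blast
  have inb: "y \<in> ball x0 \<rho>" and inr: "y \<in> ball x1 r" and tr: "trace (H y) < ?d * (q1 - 2 * \<eta>)" if "y \<in> cball x0 r'" for y
    using sub that unfolding G_def by auto
  \<comment> \<open>\<open>\<phi>\<close> is shifted to touch \<open>U\<close> at \<open>x0\<close>,
    and a small paraboloid makes the contact strict: on the sphere of radius \<open>r'\<close> the
    gap to \<open>U\<close> is at least \<open>2 * \<delta>\<close>.\<close>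
  define f where "f x = \<phi> x + (U x0 - \<phi> x0) + \<eta> * ((x - x0) \<bullet> (x - x0))" for x
  define pf where "pf x = p x + (2 * \<eta>) *\<^sub>R (x - x0)" for x
  define Hf where "Hf x = H x + (2 * \<eta>) *\<^sub>R mat 1" for x
  define \<delta> where "\<delta> = \<eta> * r'\<^sup>2 / 2"
  have \<delta>: "\<delta> > 0" using \<eta> r' by (simp add: \<delta>_def)
  have Hfv: "Hf x *v v = H x *v v + (2 * \<eta>) *\<^sub>R v" for x v
    by (simp add: Hf_def matrix_vector_mult_add_rdistrib scaleR_matrix_vector_assoc[symmetric])
  have f: "(f has_derivative (\<lambda>v. pf x \<bullet> v)) (at x)" if "x \<in> ball x0 \<rho>" for x
  proof -
    have 1: "((\<lambda>x. x - x0) has_derivative (\<lambda>v. v)) (at x)" by (auto intro!: derivative_eq_intros)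
    have 2: "((\<lambda>x. \<eta> * ((x - x0) \<bullet> (x - x0))) has_derivative (\<lambda>v. \<eta> * ((x - x0) \<bullet> v + v \<bullet> (x - x0)))) (at x)"
      by (rule has_derivative_mult_right[OF has_derivative_inner[OF 1 1]])
    have "(f has_derivative (\<lambda>v. (p x \<bullet> v + 0) + \<eta> * ((x - x0) \<bullet> v + v \<bullet> (x - x0)))) (at x)"
      unfolding f_def[abs_def] by (rule has_derivative_add[OF has_derivative_add[OF \<phi>[OF that] has_derivative_const] 2])
    moreover have "(p x \<bullet> v + 0) + \<eta> * ((x - x0) \<bullet> v + v \<bullet> (x - x0)) = pf x \<bullet> v" for v
      by (simp add: pf_def inner_add_left inner_commute[of v])
    ultimately show ?thesis by simp
  qed
  have pf: "(pf has_derivative (\<lambda>v. Hf x *v v)) (at x)" if "x \<in> ball x0 \<rho>" for x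
  proof -
    have 1: "((\<lambda>x. (2 * \<eta>) *\<^sub>R (x - x0)) has_derivative (\<lambda>v. (2 * \<eta>) *\<^sub>R v)) (at x)"
      by (auto intro!: derivative_eq_intros)
    show ?thesis unfolding pf_def[abs_def] Hfv by (rule has_derivative_add[OF p[OF that] 1])
  qed
  have symf: "transpose (Hf x) = Hf x" if "x \<in> ball x0 \<rho>" for x
    using sym[OF that] by (auto simp: Hf_def transpose_def vec_eq_iff mat_def)
  have contf: "continuous_on (cball x0 r') f"
    by (rule continuous_at_imp_continuous_on) (use f inb has_derivative_continuous in blast)
  have contHf: "continuous_on (cball x0 r') Hf"
    unfolding Hf_def by (intro continuous_intros continuous_on_subset[OF H]) (use inb in auto)
  \<comment> \<open>Here \<open>f\<close>, pushed down by \<open>\<delta>\<close>, no longer lies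
    strictly above \<open>U\<close>. The set avoids the sphere of radius \<open>r'\<close> and
    contains a ball around \<open>x0\<close>.\<close>
  define E where "E = {x \<in> cball x0 r'. f x - \<delta> \<le> U x}"
  have cE: "compact E"
  proof -
    have "closed {x \<in> cball x0 r'. f x - \<delta> \<le> U x}"
      by (rule continuous_on_closed_Collect_le) (auto intro!: continuous_intros contf continuous_on_subset[OF contU])
    then show ?thesis unfolding E_def using compact_cball by (metis (no_types, lifting) bounded_cball bounded_subset compact_eq_bounded_closed mem_Collect_eq subsetI)
  qed
  define S where "S = {y \<in> E. \<forall>v. 0 \<le> v \<bullet> (Hf y *v v)}"
  have EsubC: "E \<subseteq> cball x0 r'" by (auto simp: E_def)
  have cS: "compact S"
  proof -
    have "closed {y \<in> E. 0 \<le> v \<bullet> (Hf y *v v)}" for v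
    proof (rule continuous_on_closed_Collect_le)
      have "continuous_on E (\<lambda>y. \<Sum>i\<in>UNIV. v $ i * (\<Sum>j\<in>UNIV. Hf y $ i $ j * v $ j))"
        by (intro continuous_intros continuous_on_component continuous_on_subset[OF contHf EsubC])
      then show "continuous_on E (\<lambda>y. v \<bullet> (Hf y *v v))"
        by (simp add: inner_vec_def matrix_vector_mult_def)
    qed (use cE compact_imp_closed in auto)
    then have "closed (\<Inter>v. {y \<in> E. 0 \<le> v \<bullet> (Hf y *v v)})" by (intro closed_INT) auto
    then have "compact (E \<inter> (\<Inter>v. {y \<in> E. 0 \<le> v \<bullet> (Hf y *v v)}))" using cE by (rule compact_Int_closed[rotated])
    moreover have "E \<inter> (\<Inter>v. {y \<in> E. 0 \<le> v \<bullet> (Hf y *v v)}) = S" by (auto simp: S_def)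
    ultimately show ?thesis by simp
  qed
  \<comment> \<open>Slide the supporting plane of slope \<open>g\<close> up until it touches
    \<open>f\<close> from below. The contact point \<open>y\<close> lies in \<open>E\<close>, hence
    off the sphere, so it is an interior minimum of \<open>f\<close> minus an affine function:
    \<open>pf y = g\<close>, and \<open>Hf y\<close> is positive semi-definite.\<close>
  have img: "subdiff U E \<subseteq> pf ` S"
  proof
    fix g assume "g \<in> subdiff U E"
    then obtain x where x: "x \<in> E" and g: "\<And>z. U x + g \<bullet> (z - x) \<le> U z" by (auto simp: subdiff_def)
    define h where "h y = f y - (U x + g \<bullet> (y - x))" for y
    have conth: "continuous_on (cball x0 r') h"
      unfolding h_def by (intro continuous_intros contf)
    obtain y where y: "y \<in> cball x0 r'" "\<And>z. z \<in> cball x0 r' \<Longrightarrow> h y \<le> h z"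
      using continuous_attains_inf[OF compact_cball _ conth] r' by auto
    have "h y \<le> h x" using y(2) x EsubC by auto
    also have "h x \<le> \<delta>" using x by (simp add: h_def E_def)
    finally have hy: "f y - \<delta> \<le> U x + g \<bullet> (y - x)" by (simp add: h_def)
    also have "\<dots> \<le> U y" by (rule g)
    finally have yE: "y \<in> E" using y(1) by (simp add: E_def)
    have "dist x0 y \<noteq> r'"
    proof
      assume "dist x0 y = r'"
      then have "(y - x0) \<bullet> (y - x0) = r'\<^sup>2" by (simp add: dot_square_norm dist_norm norm_minus_commute)
      then have "f y - \<delta> \<ge> U y + \<delta>" using touch[OF inb[OF y(1)]] by (simp add: f_def \<delta>_def)
      with yE \<delta> show False by (simp add: E_def)
    qed
    with y(1) have yb: "y \<in> ball x0 r'" by simp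
    have hder: "(h has_derivative (\<lambda>v. (pf z - g) \<bullet> v)) (at z)" if "z \<in> ball x0 r'" for z
    proof -
      have "z \<in> ball x0 \<rho>" using inb that by auto
      from f[OF this] show ?thesis unfolding h_def[abs_def]
        by (auto intro!: derivative_eq_intros simp: inner_diff_left)
    qed
    have pder: "((\<lambda>z. pf z - g) has_derivative (\<lambda>v. Hf y *v v)) (at y)"
      using has_derivative_diff[OF pf[OF inb[OF y(1)]] has_derivative_const[of g]] by simp
    note so = local_min_second_order[OF open_ball yb _ hder pder]
    have "pf y - g = 0" by (rule so(1)) (use y(2) in auto)
    moreover have "0 \<le> v \<bullet> (Hf y *v v)" for v by (rule so(2)) (use y(2) in auto)
    ultimately show "g \<in> pf ` S" using yE by (auto simp: S_def intro!: image_eqI[of _ _ y])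
  qed
  have "measure lebesgue (pf ` S) \<le> q1 ^ ?d * measure lebesgue S"
  proof (rule measure_C1_image_le[OF cS])
    have SC: "S \<subseteq> cball x0 r'" using EsubC by (auto simp: S_def)
    show "continuous_on S Hf" by (rule continuous_on_subset[OF contHf SC])
    show "(pf has_derivative (\<lambda>v. Hf x *v v)) (at x)" if "x \<in> S" for x using pf inb SC that by auto
    show "\<bar>det (Hf x)\<bar> \<le> q1 ^ ?d" if "x \<in> S" for x
    proof -
      have xc: "x \<in> cball x0 r'" using SC that by auto
      have psd: "\<And>v. 0 \<le> v \<bullet> (Hf x *v v)" using that by (simp add: S_def)
      note D = det_psd_le[OF symf[OF inb[OF xc]] psd]
      have "trace (Hf x) / ?d \<le> q1" using tr[OF xc]
        by (simp add: Hf_def trace_plus_scaled_mat divide_simps algebra_simps)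
      then have "(trace (Hf x) / ?d) ^ ?d \<le> q1 ^ ?d" using D(2) by (intro power_mono) auto
      then show ?thesis using D by simp
    qed
  qed
  also have "\<dots> \<le> q1 ^ ?d * measure lebesgue E"
    using q1 cS cE by (intro mult_left_mono measure_mono_fmeasurable) (auto simp: S_def intro: lmeasurable_compact fmeasurableD)
  finally have upper: "measure lebesgue (pf ` S) \<le> q1 ^ ?d * measure lebesgue E" .
  have cpfS: "compact (pf ` S)"
  proof (rule compact_continuous_image[OF _ cS])
    show "continuous_on S pf"
      by (rule continuous_at_imp_continuous_on)
         (use pf inb EsubC has_derivative_continuous S_def in blast)
  qed
  have "q ^ ?d * measure lebesgue E \<le> measure lebesgue (subdiff U E)"
    by (rule MA[OF cE]) (use EsubC inr in auto)
  also have "\<dots> \<le> measure lebesgue (pf ` S)"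
    using img cpfS compact_subdiff[OF lip cE]
    by (intro measure_mono_fmeasurable) (auto intro: lmeasurable_compact fmeasurableD)
  finally have le: "q ^ ?d * measure lebesgue E \<le> q1 ^ ?d * measure lebesgue E" using upper by simp
  have "measure lebesgue E > 0"
  proof -
    have "continuous_on (ball x0 r') (\<lambda>x. U x - f x)"
      by (intro continuous_intros continuous_on_subset[OF contU] continuous_on_subset[OF contf]) auto
    then have "open (ball x0 r' \<inter> (\<lambda>x. U x - f x) -` {- \<delta><..})"
      by (rule continuous_open_preimage) auto
    moreover have "x0 \<in> ball x0 r' \<inter> (\<lambda>x. U x - f x) -` {- \<delta><..}" using \<delta> r' by (simp add: f_def)
    ultimately obtain e where e: "e > 0" "ball x0 e \<subseteq> ball x0 r' \<inter> (\<lambda>x. U x - f x) -` {- \<delta><..}" by (meson openE)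
    then have "ball x0 e \<subseteq> E" by (force simp: E_def)
    then have "measure lebesgue (ball x0 e) \<le> measure lebesgue E"
      using cE by (intro measure_mono_fmeasurable) (auto intro: lmeasurable_compact)
    moreover have "0 < measure lebesgue (ball x0 e)" using e(1) by simp
    ultimately show ?thesis by linarith
  qed
  then have "q ^ ?d \<le> q1 ^ ?d" using le by simp
  moreover have "q1 ^ ?d < q ^ ?d" using q1 by (intro power_strict_mono) auto
  ultimately show False by simp
qed

section \<open>Comparison with the heat semigroup\<close>

lemma lipschitz_exp_growth:
  fixes U :: "'a::euclidean_space \<Rightarrow> real"
  assumes lip: "L-lipschitz_on UNIV U"
  shows "exp_growth U"
proof -
  have "U \<in> borel_measurable borel"
    by (intro borel_measurable_continuous_onI lipschitz_on_continuous_on[OF lip])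
  moreover have "\<bar>U y\<bar> \<le> (\<bar>U 0\<bar> + L) * exp (norm y)" for y
  proof -
    have L: "L \<ge> 0" by (rule lipschitz_on_nonneg[OF lip])
    have "\<bar>U y - U 0\<bar> \<le> L * norm y" using lipschitz_onD[OF lip, of y 0] by (simp add: dist_real_def)
    then have "\<bar>U y\<bar> \<le> \<bar>U 0\<bar> * 1 + L * norm y" by linarith
    also have "\<dots> \<le> \<bar>U 0\<bar> * exp (norm y) + L * exp (norm y)"
    proof -
      have "1 \<le> exp (norm y)" "norm y \<le> exp (norm y)"
        using exp_ge_add_one_self[of "norm y"] norm_ge_zero[of y] by linarith+
      then show ?thesis using L by (intro add_mono mult_left_mono) auto
    qed
    finally show ?thesis by (simp add: distrib_right)
  qed
  ultimately show ?thesis unfolding exp_growth_def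
    using lipschitz_on_nonneg[OF lip] by (intro conjI exI[of _ "\<bar>U 0\<bar> + L"]) auto
qed

lemma exp_growth_abs: "exp_growth U \<Longrightarrow> exp_growth (\<lambda>y. \<bar>U y\<bar>)"
  by (auto simp: exp_growth_def)

lemma exp_growth_measurable: "exp_growth U \<Longrightarrow> U \<in> borel_measurable borel"
  by (simp add: exp_growth_def)

lemma gdens_norm_integrable: "integrable lborel (\<lambda>z::'a::euclidean_space. norm z * gdens z)"
proof (rule Bochner_Integration.integrable_bound)
  have "integrable lborel (\<lambda>z::'a. (z \<bullet> z) * gauss 1 z)"
    by (rule poly_gauss_integrable[OF poly_gauss_mult]) auto
  then have "integrable lborel (\<lambda>z::'a. (z \<bullet> z) * gdens z)" by (simp add: gdens_def)
  then show "integrable lborel (\<lambda>z::'a. gdens z + (z \<bullet> z) * gdens z)"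
    by (intro Bochner_Integration.integrable_add gdens_integral)
  have "norm z \<le> 1 + z \<bullet> z" for z :: 'a
    using zero_le_power2[of "norm z - 1/2"] by (simp add: dot_square_norm power2_eq_square algebra_simps)
  then have "norm z * gdens z \<le> (1 + z \<bullet> z) * gdens z" for z :: 'a
    by (rule mult_right_mono) (rule less_imp_le[OF gdens_pos])
  then show "AE z::'a in lborel. norm (norm z * gdens z) \<le> norm (gdens z + (z \<bullet> z) * gdens z)"
    by (intro AE_I2) (simp add: less_imp_le[OF gdens_pos] distrib_right abs_mult)
qed measurable

lemma heat_zero [simp]:
  fixes U :: "'a::euclidean_space \<Rightarrow> real"
  shows "heat U 0 x = U x"
  using gdens_integral(2)[where 'a='a] by (simp add: heat_def)

lemma heat_reflect:
  fixes U :: "'a::euclidean_space \<Rightarrow> real"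
  assumes [measurable]: "U \<in> borel_measurable borel"
  shows "heat U (- s) x = heat U s x"
  unfolding heat_def
  by (subst lborel_integral_affine[of "-1" _ 0]) simp_all

text \<open>Jensen's inequality from midpoint convexity, by pairing \<open>z\<close> with
  \<open>- z\<close> under the even Gaussian.\<close>

lemma heat_ge_self:
  fixes U :: "'a::euclidean_space \<Rightarrow> real"
  assumes U: "exp_growth U" and mid: "\<And>x h. 2 * U x \<le> U (x + h) + U (x - h)"
  shows "U x \<le> heat U s x"
proof -
  have "2 * U x = (\<integral>z. (2 * U x) * gdens (z::'a) \<partial>lborel)"
    using gdens_integral(2)[where 'a='a] by simp
  also have "\<dots> \<le> (\<integral>z. U (x + s *\<^sub>R z) * gdens z + U (x + (- s) *\<^sub>R z) * gdens z \<partial>lborel)"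
  proof (rule integral_mono)
    show "integrable lborel (\<lambda>z::'a. (2 * U x) * gdens z)" using gdens_integral(1)[where 'a='a] by simp
    show "integrable lborel (\<lambda>z. U (x + s *\<^sub>R z) * gdens z + U (x + (- s) *\<^sub>R z) * gdens z)"
      by (intro Bochner_Integration.integrable_add heat_integrable U)
    show "2 * U x * gdens z \<le> U (x + s *\<^sub>R z) * gdens z + U (x + (- s) *\<^sub>R z) * gdens z" for z
      using mult_right_mono[OF mid[of x "s *\<^sub>R z"] less_imp_le[OF gdens_pos[of z]]] by (simp add: distrib_right)
  qed
  also have "\<dots> = heat U s x + heat U (- s) x"
    unfolding heat_def by (rule Bochner_Integration.integral_add[OF heat_integrable[OF U] heat_integrable[OF U]])
  finally show ?thesis using heat_reflect[OF exp_growth_measurable[OF U]] by simp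
qed

text \<open>A joint modulus of continuity in space and in the square root of time. It holds down to
  time 0, which the derivative formulas do not reach but the maximum principle needs.\<close>

lemma heat_lipschitz:
  fixes U :: "'a::euclidean_space \<Rightarrow> real"
  assumes lip: "L-lipschitz_on UNIV U"
  shows "\<bar>heat U s x - heat U s' x'\<bar> \<le> L * norm (x - x') + L * (\<integral>z. norm z * gdens (z::'a) \<partial>lborel) * \<bar>s - s'\<bar>"
proof -
  note U = lipschitz_exp_growth[OF lip]
  have "\<bar>heat U s x - heat U s' x'\<bar> = \<bar>\<integral>z. U (x + s *\<^sub>R z) * gdens z - U (x' + s' *\<^sub>R z) * gdens z \<partial>lborel\<bar>"
    unfolding heat_def by (subst Bochner_Integration.integral_diff) (auto intro: heat_integrable U)
  also have "\<dots> \<le> (\<integral>z. \<bar>U (x + s *\<^sub>R z) * gdens z - U (x' + s' *\<^sub>R z) * gdens z\<bar> \<partial>lborel)"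
    by (rule integral_abs_bound)
  also have "\<dots> \<le> (\<integral>z. (L * norm (x - x')) * gdens z + (L * \<bar>s - s'\<bar>) * (norm (z::'a) * gdens z) \<partial>lborel)"
  proof (rule integral_mono)
    show "integrable lborel (\<lambda>z. \<bar>U (x + s *\<^sub>R z) * gdens z - U (x' + s' *\<^sub>R z) * gdens z\<bar>)"
      by (intro integrable_abs Bochner_Integration.integrable_diff heat_integrable U)
    show "integrable lborel (\<lambda>z. (L * norm (x - x')) * gdens z + (L * \<bar>s - s'\<bar>) * (norm (z::'a) * gdens z))"
      by (intro Bochner_Integration.integrable_add integrable_mult_right gdens_integral gdens_norm_integrable)
    show "\<bar>U (x + s *\<^sub>R z) * gdens z - U (x' + s' *\<^sub>R z) * gdens z\<bar>
        \<le> (L * norm (x - x')) * gdens z + (L * \<bar>s - s'\<bar>) * (norm (z::'a) * gdens z)" for z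
    proof -
      have "\<bar>U (x + s *\<^sub>R z) - U (x' + s' *\<^sub>R z)\<bar> \<le> L * norm ((x - x') + (s - s') *\<^sub>R z)"
        using lipschitz_onD[OF lip, of "x + s *\<^sub>R z" "x' + s' *\<^sub>R z"] by (simp add: dist_norm algebra_simps)
      also have "\<dots> \<le> L * (norm (x - x') + \<bar>s - s'\<bar> * norm z)"
        using norm_triangle_ineq[of "x - x'" "(s - s') *\<^sub>R z"] lipschitz_on_nonneg[OF lip]
        by (intro mult_left_mono) auto
      finally have "\<bar>U (x + s *\<^sub>R z) - U (x' + s' *\<^sub>R z)\<bar> * gdens z \<le> (L * (norm (x - x') + \<bar>s - s'\<bar> * norm z)) * gdens z"
        by (rule mult_right_mono) (rule less_imp_le[OF gdens_pos])
      moreover have "\<bar>U (x + s *\<^sub>R z) * gdens z - U (x' + s' *\<^sub>R z) * gdens z\<bar> = \<bar>U (x + s *\<^sub>R z) - U (x' + s' *\<^sub>R z)\<bar> * gdens z"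
        using gdens_pos[of z] by (simp add: abs_mult left_diff_distrib[symmetric])
      ultimately show ?thesis by (simp add: algebra_simps)
    qed
  qed
  also have "\<dots> = L * norm (x - x') + L * (\<integral>z. norm z * gdens (z::'a) \<partial>lborel) * \<bar>s - s'\<bar>"
    using gdens_integral[where 'a='a] gdens_norm_integrable[where 'a='a]
    by (subst Bochner_Integration.integral_add) auto
  finally show ?thesis .
qed

section \<open>Gradient, Hessian and heat equation of the Gaussian average\<close>

lemma gconv_cmult: "gconv U (\<lambda>z. c * k z) x = c * gconv U k x"
  by (simp add: gconv_def mult.left_commute)

lemma gconv_sum:
  assumes "exp_growth U" "t > 0" "\<And>i. i \<in> I \<Longrightarrow> k i \<in> poly_gauss t"
  shows "gconv U (\<lambda>z. \<Sum>i\<in>I. k i z) x = (\<Sum>i\<in>I. gconv U (k i) x)"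
  unfolding gconv_def sum_distrib_left
  by (rule Bochner_Integration.integral_sum) (use assms gconv_integrable in blast)

definition heat_coeff :: "'n::finite itself \<Rightarrow> real \<Rightarrow> real" where
  "heat_coeff _ t = t powr (- real CARD('n) / 2) / gauss_mass TYPE(real^'n)"

definition heat_grad :: "(real^'n::finite \<Rightarrow> real) \<Rightarrow> real \<Rightarrow> real^'n \<Rightarrow> real^'n" where
  "heat_grad U t x = (\<chi> i. heat_coeff TYPE('n) t * gconv U (\<lambda>z. - (1 / t) * ((z \<bullet> axis i 1) * gauss t z)) x)"

definition heat_hess :: "(real^'n::finite \<Rightarrow> real) \<Rightarrow> real \<Rightarrow> real^'n \<Rightarrow> real^'n^'n" where
  "heat_hess U t x = (\<chi> i j. heat_coeff TYPE('n) t *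
     gconv U (\<lambda>z. - (1 / t) * (((axis j 1 \<bullet> (axis i 1::real^'n)) - (z \<bullet> axis i 1) * (z \<bullet> axis j 1) / t) * gauss t z)) x)"

lemma linear_eq_inner:
  fixes f :: "real^'n \<Rightarrow> real"
  assumes "linear f"
  shows "f v = (\<chi> j. f (axis j 1)) \<bullet> v"
proof -
  have e: "v = (\<Sum>j\<in>UNIV. v $ j *\<^sub>R axis j 1)"
    using basis_expansion[of v] by (simp add: scalar_mult_eq_scaleR)
  have "f v = f (\<Sum>j\<in>UNIV. v $ j *\<^sub>R axis j 1)" by (rule arg_cong[OF e])
  also have "\<dots> = (\<Sum>j\<in>UNIV. v $ j * f (axis j 1))"
    by (simp add: linear_sum[OF assms] linear_scale[OF assms])
  finally show ?thesis by (simp add: inner_vec_def mult.commute)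
qed

lemma heat_has_derivative:
  fixes U :: "real^'n::finite \<Rightarrow> real"
  assumes U: "exp_growth U" and t: "t > 0"
  shows "(heat U (sqrt t) has_derivative (\<lambda>v. heat_grad U t x \<bullet> v)) (at x)"
proof -
  have 1: "heat U (sqrt t) = (\<lambda>x. heat_coeff TYPE('n) t * gconv U (gauss t) x)"
    using heat_eq_gconv[OF exp_growth_measurable[OF U] t] by (simp add: fun_eq_iff heat_coeff_def)
  have in_pg: "(\<lambda>z. - ((z \<bullet> v) / t) * gauss t z) \<in> poly_gauss t" for v :: "real^'n"
  proof (rule poly_gauss_mult)
    show "real_polynomial_function (\<lambda>z. - ((z \<bullet> v) / t))"
      by (rule real_polynomial_function_minus[OF real_polynomial_function_divide[OF real_polynomial_function_inner]])
  qed
  have g: "(gconv U (gauss t) has_derivative (\<lambda>v. gconv U (\<lambda>z. - ((z \<bullet> v) / t) * gauss t z) x)) (at x)"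
    by (rule gconv_has_derivative[OF U gauss_in t gauss_has_derivative[OF t] in_pg])
  have "(heat U (sqrt t) has_derivative (\<lambda>v. heat_coeff TYPE('n) t * gconv U (\<lambda>z. - ((z \<bullet> v) / t) * gauss t z) x)) (at x)"
    unfolding 1 by (rule has_derivative_mult_right[OF g])
  moreover from has_derivative_linear[OF this]
  have "heat_coeff TYPE('n) t * gconv U (\<lambda>z. - ((z \<bullet> v) / t) * gauss t z) x = heat_grad U t x \<bullet> v" for v
    using linear_eq_inner[of "\<lambda>v. heat_coeff TYPE('n) t * gconv U (\<lambda>z. - ((z \<bullet> v) / t) * gauss t z) x" v]
    by (simp add: heat_grad_def)
  ultimately show ?thesis by simp
qed

lemma heat_grad_has_derivative:
  fixes U :: "real^'n::finite \<Rightarrow> real"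
  assumes U: "exp_growth U" and t: "t > 0"
  shows "(heat_grad U t has_derivative (\<lambda>v. heat_hess U t x *v v)) (at x)"
proof -
  let ?k = "\<lambda>i z. (z \<bullet> (axis i 1::real^'n)) * gauss t z"
  let ?dk = "\<lambda>i z v. ((v \<bullet> (axis i 1::real^'n)) - (z \<bullet> axis i 1) * (z \<bullet> v) / t) * gauss t z"
  have comp: "((\<lambda>x. heat_grad U t x $ i) has_derivative (\<lambda>v. (heat_hess U t x *v v) $ i)) (at x)" for i
  proof -
    have "(gconv U (?k i) has_derivative (\<lambda>v. gconv U (\<lambda>z. ?dk i z v) x)) (at x)"
      by (rule gconv_has_derivative[OF U gauss_inner_in t gauss_inner_has_derivative[OF t] gauss_inner_inner_in])
    from has_derivative_mult_right[OF this, of "heat_coeff TYPE('n) t * - (1 / t)"]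
    have d: "((\<lambda>x. heat_grad U t x $ i) has_derivative (\<lambda>v. heat_coeff TYPE('n) t * - (1 / t) * gconv U (\<lambda>z. ?dk i z v) x)) (at x)"
      by (simp add: heat_grad_def gconv_cmult[of U "- (1 / t)", simplified] mult.assoc)
    moreover have "heat_coeff TYPE('n) t * - (1 / t) * gconv U (\<lambda>z. ?dk i z v) x = (heat_hess U t x *v v) $ i" for v
    proof -
      have "heat_coeff TYPE('n) t * - (1 / t) * gconv U (\<lambda>z. ?dk i z v) x
          = (\<chi> j. heat_coeff TYPE('n) t * - (1 / t) * gconv U (\<lambda>z. ?dk i z (axis j 1)) x) \<bullet> v"
        by (rule linear_eq_inner[OF has_derivative_linear[OF d]])
      also have "\<dots> = (heat_hess U t x *v v) $ i"
        by (simp only: heat_hess_def inner_vec_def matrix_vector_mult_def vec_lambda_beta gconv_cmult inner_real_def mult.assoc)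
      finally show ?thesis .
    qed
    ultimately show ?thesis by simp
  qed
  then show ?thesis
    unfolding has_derivative_componentwise_within[of "heat_grad U t"]
    by (auto simp: Basis_vec_def inner_axis)
qed

lemma heat_hess_sym: "transpose (heat_hess U t x) = heat_hess U t x"
  by (simp add: heat_hess_def transpose_def vec_eq_iff inner_commute mult.commute)

lemma heat_hess_kernel_in: "(\<lambda>z. c * ((a - (z \<bullet> u) * (z \<bullet> v) / t) * gauss t z)) \<in> poly_gauss t"
proof -
  have "real_polynomial_function (\<lambda>z. (z \<bullet> u) * (z \<bullet> v) / t)"
    by (rule real_polynomial_function_divide[OF real_polynomial_function.intros(4)]) auto
  then have "real_polynomial_function (\<lambda>z. c * (a - (z \<bullet> u) * (z \<bullet> v) / t))"
    by (intro real_polynomial_function.intros(4)[OF real_polynomial_function.intros(2)] real_polynomial_function_diff real_polynomial_function.intros(2))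
  from poly_gauss_mult[OF this] show ?thesis by (simp only: mult.assoc)
qed

lemma gconv_continuous_on:
  assumes U: "exp_growth U" and k: "k \<in> poly_gauss t" and t: "t > 0"
  shows "continuous_on S (gconv U k)"
proof -
  obtain dk where "\<And>z. (k has_derivative dk z) (at z)" "\<And>v. (\<lambda>z. dk z v) \<in> poly_gauss t"
    using poly_gauss_has_derivative[OF k t] by blast
  from gconv_has_derivative[OF U k t this] show ?thesis
    by (meson continuous_at_imp_continuous_on has_derivative_continuous)
qed

lemma heat_hess_continuous:
  fixes U :: "real^'n::finite \<Rightarrow> real"
  assumes U: "exp_growth U" and t: "t > 0"
  shows "continuous_on S (heat_hess U t)"
  unfolding heat_hess_def
  by (intro continuous_on_vec_lambda continuous_on_mult_left gconv_continuous_on[OF U heat_hess_kernel_in t])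

text \<open>The Laplacian of the kernel, in the two-term form that also comes out of its time
  derivative.\<close>

lemma heat_trace_hess:
  fixes U :: "real^'n::finite \<Rightarrow> real"
  assumes U: "exp_growth U" and t: "t > 0"
  shows "trace (heat_hess U t x) = heat_coeff TYPE('n) t * (gconv U (\<lambda>z. (z \<bullet> z) * gauss t z) x / t\<^sup>2 - real CARD('n) / t * gconv U (gauss t) x)"
proof -
  let ?h = "\<lambda>i z. - (1 / t) * (((axis i 1 \<bullet> (axis i 1::real^'n)) - (z \<bullet> axis i 1) * (z \<bullet> axis i 1) / t) * gauss t z)"
  have e: "(\<Sum>i\<in>UNIV. ?h i z) = (1 / t\<^sup>2) * ((z \<bullet> z) * gauss t z) - (real CARD('n) / t) * gauss t z" for z :: "real^'n"
  proof -
    have zz: "z \<bullet> z = (\<Sum>i\<in>UNIV. (z \<bullet> axis i 1) * (z \<bullet> axis i 1))" by (simp add: inner_axis inner_real_def) (simp add: inner_vec_def inner_real_def)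
    have "(\<Sum>i\<in>UNIV. ?h i z) = - (1 / t) * gauss t z * (\<Sum>i\<in>(UNIV::'n set). 1 - (z \<bullet> axis i 1) * (z \<bullet> axis i 1) / t)"
      by (simp add: sum_distrib_left inner_axis mult.commute mult.left_commute)
    also have "(\<Sum>i\<in>(UNIV::'n set). 1 - (z \<bullet> axis i 1) * (z \<bullet> axis i 1) / t) = real CARD('n) - (z \<bullet> z) / t"
      unfolding zz by (simp only: sum_subtractf sum_divide_distrib[symmetric]) simp
    finally show ?thesis using t by (simp add: field_simps power2_eq_square)
  qed
  have "trace (heat_hess U t x) = heat_coeff TYPE('n) t * (\<Sum>i\<in>UNIV. gconv U (?h i) x)"
    by (simp add: trace_def heat_hess_def sum_distrib_left)
  also have "(\<Sum>i\<in>UNIV. gconv U (?h i) x) = gconv U (\<lambda>z. \<Sum>i\<in>UNIV. ?h i z) x"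
    by (rule gconv_sum[OF U t heat_hess_kernel_in, symmetric])
  also have "\<dots> = (\<integral>y. (1 / t\<^sup>2) * (U y * (((x - y) \<bullet> (x - y)) * gauss t (x - y))) - (real CARD('n) / t) * (U y * gauss t (x - y)) \<partial>lborel)"
    unfolding gconv_def e by (rule arg_cong[where f="integral\<^sup>L lborel"]) (simp add: fun_eq_iff algebra_simps)
  also have "\<dots> = (1 / t\<^sup>2) * gconv U (\<lambda>z. (z \<bullet> z) * gauss t z) x - (real CARD('n) / t) * gconv U (gauss t) x"
    unfolding gconv_def
    by (subst Bochner_Integration.integral_diff)
       (auto intro!: integrable_mult_right gconv_integrable[OF U _ t] gauss_in poly_gauss_mult
          gconv_integrable[OF U poly_gauss_mult t])
  finally show ?thesis by simp
qed

text \<open>The heat equation, with the factor 1/2 because \<open>t\<close> is the variance.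
  Differentiating the exponential gives the term with \<open>z \<bullet> z\<close>, differentiating
  \<open>heat_coeff\<close> the term with the dimension.\<close>

lemma heat_time_derivative:
  fixes U :: "real^'n::finite \<Rightarrow> real"
  assumes U: "exp_growth U" and t: "t > 0"
  shows "((\<lambda>t. heat U (sqrt t) x) has_real_derivative trace (heat_hess U t x) / 2) (at t)"
proof -
  have [measurable]: "U \<in> borel_measurable borel" by (rule exp_growth_measurable[OF U])
  define N where "N y = (x - y) \<bullet> (x - y)" for y
  have N0: "N y \<ge> 0" for y by (simp add: N_def)
  \<comment> \<open>A majorant for all times between \<open>t / 2\<close> and
    \<open>3 * t / 2\<close>: the inverse power of the time is largest at the lower end, the
    Gaussian at the upper end.\<close>
  define D where "D y = (2 / t\<^sup>2) * (\<bar>U y\<bar> * (N y * gauss (3 * t / 2) (x - y)))" for y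
  have "((\<lambda>s. \<integral>y. U y * gauss s (x - y) \<partial>lborel) has_derivative (\<lambda>h. \<integral>y. U y * (N y / (2 * t\<^sup>2) * gauss t (x - y)) * h \<partial>lborel)) (at t)"
  proof (rule has_derivative_integral_dominated[where r="t/2" and D=D and f'="\<lambda>s y h. U y * (N y / (2 * s\<^sup>2) * gauss s (x - y)) * h"])
    show "t / 2 > 0" using t by simp
    have ball: "t / 2 < s" "s < 3 * t / 2" if "s \<in> ball t (t / 2)" for s
      using that by (auto simp: dist_real_def abs_if split: if_splits)
    show "integrable lborel (\<lambda>y. U y * gauss s (x - y))" if "s \<in> ball t (t / 2)" for s
      by (rule gconv_integrable[OF U gauss_in]) (use ball[OF that] t in auto)
    show "((\<lambda>s. U y * gauss s (x - y)) has_derivative (\<lambda>h. U y * (N y / (2 * s\<^sup>2) * gauss s (x - y)) * h)) (at s)"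
      if "s \<in> ball t (t / 2)" for s y
    proof -
      have s: "s > 0" using ball[OF that] t by simp
      have "((\<lambda>s. U y * gauss s (x - y)) has_real_derivative (U y * (N y / (2 * s\<^sup>2) * gauss s (x - y)))) (at s)"
        unfolding gauss_def N_def[symmetric] using s
        by (auto intro!: derivative_eq_intros simp: power2_eq_square)
      then show ?thesis unfolding has_field_derivative_def .
    qed
    show "\<bar>U y * (N y / (2 * s\<^sup>2) * gauss s (x - y)) * h\<bar> \<le> D y * norm h" if "s \<in> ball t (t / 2)" for s y h
    proof -
      have s: "s > 0" "t / 2 < s" "s < 3 * t / 2" using ball[OF that] t by auto
      have "(t / 2)\<^sup>2 \<le> s\<^sup>2" using s t by (intro power_mono) auto
      then have "N y / (2 * s\<^sup>2) \<le> N y / (2 * (t / 2)\<^sup>2)" using N0 s t by (intro divide_left_mono) auto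
      then have 1: "N y / (2 * s\<^sup>2) \<le> 2 / t\<^sup>2 * N y" by (simp add: power_divide mult.commute)
      have "N y / (2 * (3 * t / 2)) \<le> N y / (2 * s)" using N0 s t by (intro divide_left_mono) auto
      then have 2: "gauss s (x - y) \<le> gauss (3 * t / 2) (x - y)" by (simp add: gauss_def N_def)
      have "N y / (2 * s\<^sup>2) * gauss s (x - y) \<le> 2 / t\<^sup>2 * N y * gauss (3 * t / 2) (x - y)"
        using 1 2 N0[of y] by (intro mult_mono) (auto simp: less_imp_le[OF gauss_pos])
      then have "\<bar>U y\<bar> * (N y / (2 * s\<^sup>2) * gauss s (x - y)) * \<bar>h\<bar> \<le> \<bar>U y\<bar> * (2 / t\<^sup>2 * N y * gauss (3 * t / 2) (x - y)) * \<bar>h\<bar>"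
        by (intro mult_right_mono mult_left_mono) auto
      then show ?thesis using N0[of y] gauss_pos[of s "x - y"] by (simp add: D_def abs_mult ac_simps)
    qed
    show "integrable lborel D" unfolding D_def N_def
      by (intro integrable_mult_right gconv_integrable[OF exp_growth_abs[OF U] poly_gauss_mult]) (use t in auto)
    show "0 \<le> D y" for y using N0[of y] by (simp add: D_def less_imp_le[OF gauss_pos])
    show "(\<lambda>y. U y * (N y / (2 * t\<^sup>2) * gauss t (x - y)) * h) \<in> borel_measurable lborel" for h
      unfolding N_def by measurable
  qed
  moreover have "(\<integral>y. U y * (N y / (2 * t\<^sup>2) * gauss t (x - y)) * h \<partial>lborel) = gconv U (\<lambda>z. (z \<bullet> z) * gauss t z) x / (2 * t\<^sup>2) * h" for h
  proof -
    have "(\<integral>y. U y * (N y / (2 * t\<^sup>2) * gauss t (x - y)) * h \<partial>lborel) = (\<integral>y. (h / (2 * t\<^sup>2)) * (U y * (N y * gauss t (x - y))) \<partial>lborel)"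
      by (rule arg_cong[where f="integral\<^sup>L lborel"]) (simp add: fun_eq_iff)
    then show ?thesis by (simp add: gconv_def N_def)
  qed
  ultimately have "((\<lambda>s. gconv U (gauss s) x) has_derivative (\<lambda>h. gconv U (\<lambda>z. (z \<bullet> z) * gauss t z) x / (2 * t\<^sup>2) * h)) (at t)"
    by (simp only: gconv_def)
  then have G: "((\<lambda>s. gconv U (gauss s) x) has_real_derivative gconv U (\<lambda>z. (z \<bullet> z) * gauss t z) x / (2 * t\<^sup>2)) (at t)"
    unfolding has_field_derivative_def .
  define m where "m = gauss_mass TYPE(real^'n)"
  have c: "((\<lambda>s. heat_coeff TYPE('n) s) has_real_derivative - (real CARD('n) / (2 * t)) * heat_coeff TYPE('n) t) (at t)"
  proof -
    have "((\<lambda>s. s powr (- real CARD('n) / 2)) has_real_derivative (- real CARD('n) / 2) * t powr (- real CARD('n) / 2 - 1)) (at t)"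
      using t by (rule has_real_derivative_powr)
    from DERIV_cdivide[OF this, of m]
    show ?thesis using t by (simp add: heat_coeff_def m_def[symmetric] powr_diff)
  qed
  have "((\<lambda>s. heat_coeff TYPE('n) s * gconv U (gauss s) x) has_real_derivative trace (heat_hess U t x) / 2) (at t)"
    using DERIV_mult[OF c G]
    by (rule DERIV_cong) (simp add: heat_trace_hess[OF U t] field_simps)
  then show ?thesis
  proof (rule has_field_derivative_transform_within[where d=t])
    show "heat_coeff TYPE('n) s * gconv U (gauss s) x = heat U (sqrt s) x" if "dist s t < t" for s
    proof -
      have "s > 0" using that by (simp add: dist_real_def abs_if split: if_splits)
      then show ?thesis by (simp add: heat_eq_gconv heat_coeff_def)
    qed
  qed (use t in auto)
qed

text \<open>Maximum principle for \<open>U x - heat U (sqrt t) x + t (k x - \<eta>)\<close> with a concave paraboloid k of height \<open>\<kappa>\<close>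
  that vanishes on the sphere around \<open>x1\<close>; outside the ball Jensen's inequality suffices. This passes from
  touching functions to an integrated inequality.\<close>

lemma heat_lower_bound:
  fixes U :: "real^'n::finite \<Rightarrow> real" and q \<kappa> \<eta> :: real
  assumes mid: "\<And>x h. 2 * U x \<le> U (x + h) + U (x - h)"
    and lip: "L-lipschitz_on UNIV U" and q: "q > 0" and r: "r > 0" and \<eta>: "\<eta> > 0"
    and MA: "\<And>E. compact E \<Longrightarrow> E \<subseteq> ball x1 r \<Longrightarrow> q ^ CARD('n) * measure lebesgue E \<le> measure lebesgue (subdiff U E)"
    and \<kappa>: "\<kappa> = CARD('n) * q / 2"
    and t: "0 < t1" "t1 \<le> \<eta> * r\<^sup>2 / (2 * CARD('n) * \<kappa>)"
  shows "U x1 + t1 * (\<kappa> - \<eta>) \<le> heat U (sqrt t1) x1"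
proof (rule ccontr)
  assume contr: "\<not> ?thesis"
  let ?d = "CARD('n)"
  note U = lipschitz_exp_growth[OF lip]
  have contU: "continuous_on UNIV U" by (rule lipschitz_on_continuous_on[OF lip])
  have \<kappa>0: "\<kappa> > 0" unfolding \<kappa> using q by simp
  define k where "k x = \<kappa> * (1 - (x - x1) \<bullet> (x - x1) / r\<^sup>2)" for x
  have k_le: "k x \<le> \<kappa>" for x using \<kappa>0 by (simp add: k_def)
  define \<Phi> where "\<Phi> = (\<lambda>(t, x). U x - heat U (sqrt t) x + t * (k x - \<eta>))"
  define m where "m = (\<integral>z. norm z * gdens (z::real^'n) \<partial>lborel)"
  have heat_cont: "continuous_on UNIV (\<lambda>p::real \<times> (real^'n). heat U (sqrt (fst p)) (snd p))"
    unfolding continuous_on_eq_continuous_at[OF open_UNIV] isCont_def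
  proof safe
    fix a :: real and b :: "real^'n"
    have "((\<lambda>p. L * norm (snd p - b) + L * m * \<bar>sqrt (fst p) - sqrt a\<bar>) \<longlongrightarrow> L * norm (b - b) + L * m * \<bar>sqrt a - sqrt a\<bar>) (at (a, b))"
      by (intro tendsto_intros tendsto_eq_rhs[OF tendsto_fst[OF tendsto_ident_at]] tendsto_eq_rhs[OF tendsto_snd[OF tendsto_ident_at]]) auto
    then have "((\<lambda>p. L * norm (snd p - b) + L * m * \<bar>sqrt (fst p) - sqrt a\<bar>) \<longlongrightarrow> 0) (at (a, b))" by simp
    then have "((\<lambda>p. heat U (sqrt (fst p)) (snd p) - heat U (sqrt a) b) \<longlongrightarrow> 0) (at (a, b))"
      by (rule Lim_null_comparison[rotated]) (auto simp: m_def intro!: always_eventually heat_lipschitz[OF lip, THEN order_trans])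
    then show "((\<lambda>p. heat U (sqrt (fst p)) (snd p)) \<longlongrightarrow> heat U (sqrt (fst (a, b))) (snd (a, b))) (at (a, b))"
      by (simp add: LIM_zero_iff)
  qed
  let ?K = "{0..t1} \<times> cball x1 r"
  have \<Phi>_cont: "continuous_on ?K \<Phi>"
    unfolding \<Phi>_def k_def case_prod_beta
    by (intro continuous_intros continuous_on_subset[OF heat_cont] continuous_on_compose2[OF contU]) (use r in auto)
  have "compact ?K" by (intro compact_Times) auto
  moreover have "?K \<noteq> {}" using t r by auto
  ultimately obtain z where z: "z \<in> ?K" and zmax: "\<And>y. y \<in> ?K \<Longrightarrow> \<Phi> y \<le> \<Phi> z"
    using continuous_attains_sup[OF _ _ \<Phi>_cont] by blast
  obtain t0 x0 where z_eq: "z = (t0, x0)" by (cases z)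
  have t0: "0 \<le> t0" "t0 \<le> t1" and x0c: "x0 \<in> cball x1 r" using z by (auto simp: z_eq)
  have max: "\<Phi> (s, x) \<le> \<Phi> (t0, x0)" if "0 \<le> s" "s \<le> t1" "x \<in> cball x1 r" for s x
    using zmax[of "(s, x)"] that by (simp add: z_eq)
  have "0 < \<Phi> (t1, x1)" using contr by (simp add: \<Phi>_def k_def)
  also have "\<dots> \<le> \<Phi> (t0, x0)" using max[of t1 x1] t r by simp
  finally have pos: "0 < \<Phi> (t0, x0)" .
  have "t0 \<noteq> 0" using pos by (auto simp: \<Phi>_def)
  then have t0p: "t0 > 0" using t0 by simp
  have "dist x1 x0 \<noteq> r"
  proof
    assume "dist x1 x0 = r"
    then have "(x0 - x1) \<bullet> (x0 - x1) = r\<^sup>2" by (simp add: dot_square_norm dist_norm norm_minus_commute)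
    then have "k x0 = 0" using r by (simp add: k_def)
    then have "\<Phi> (t0, x0) \<le> - (t0 * \<eta>)"
      using heat_ge_self[OF U mid, of x0 "sqrt t0"] by (simp add: \<Phi>_def)
    moreover have "t0 * \<eta> > 0" using t0p \<eta> by simp
    ultimately show False using pos by simp
  qed
  then have x0: "x0 \<in> ball x1 r" using x0c by simp
  \<comment> \<open>At a maximum the left derivative in time cannot be negative. Only earlier times
    are compared, since \<open>t0\<close> may be the final time \<open>t1\<close>.\<close>
  have time: "trace (heat_hess U t0 x0) / 2 \<le> k x0 - \<eta>"
  proof (rule ccontr)
    assume "\<not> ?thesis"
    then have neg: "- (trace (heat_hess U t0 x0) / 2) + (k x0 - \<eta>) < 0" by simp
    have "((\<lambda>t. \<Phi> (t, x0)) has_real_derivative - (trace (heat_hess U t0 x0) / 2) + (k x0 - \<eta>)) (at t0)"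
      unfolding \<Phi>_def case_prod_conv
      by (auto intro!: derivative_eq_intros heat_time_derivative[OF U t0p])
    from DERIV_neg_dec_left[OF this neg] obtain e where e: "e > 0"
      and dec: "\<And>h. 0 < h \<Longrightarrow> h < e \<Longrightarrow> \<Phi> (t0, x0) < \<Phi> (t0 - h, x0)" by blast
    define h where "h = min e t0 / 2"
    have h: "0 < h" "h < e" "h \<le> t0" using e t0p by (auto simp: h_def)
    show False using dec[OF h(1,2)] max[of "t0 - h" x0] h t0 x0c by simp
  qed
  \<comment> \<open>Maximality of \<open>\<Phi> (t0, x)\<close> in \<open>x\<close> says that this
    function, up to a constant, touches \<open>U\<close> from above at \<open>x0\<close>. The term
    \<open>- t0 * k\<close> contributes \<open>c *\<^sub>R mat 1\<close> to its Hessian.\<close>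
  define \<phi> where "\<phi> x = heat U (sqrt t0) x - t0 * k x" for x
  define c where "c = t0 * (2 * \<kappa> / r\<^sup>2)"
  define p where "p x = heat_grad U t0 x + c *\<^sub>R (x - x1)" for x
  define H where "H x = heat_hess U t0 x + c *\<^sub>R mat 1" for x
  have "?d * q \<le> trace (H x0)"
  proof (rule convex_touching_trace_ge[OF lip q MA x0, where \<phi>=\<phi> and p=p])
    show "0 < r - dist x1 x0" using x0 by simp
    show "(\<phi> has_derivative (\<lambda>v. p x \<bullet> v)) (at x)" for x
    proof -
      have 1: "((\<lambda>x. x - x1) has_derivative (\<lambda>v. v)) (at x)" by (auto intro!: derivative_eq_intros)
      have 2: "((\<lambda>x. (- t0 * \<kappa>) + (c / 2) * ((x - x1) \<bullet> (x - x1))) has_derivative (\<lambda>v. 0 + (c / 2) * ((x - x1) \<bullet> v + v \<bullet> (x - x1)))) (at x)"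
        by (rule has_derivative_add[OF has_derivative_const has_derivative_mult_right[OF has_derivative_inner[OF 1 1]]])
      have "\<phi> = (\<lambda>x. heat U (sqrt t0) x + ((- t0 * \<kappa>) + (c / 2) * ((x - x1) \<bullet> (x - x1))))"
      proof -
        have "a - t0 * (\<kappa> * (1 - n / r\<^sup>2)) = a + ((- t0 * \<kappa>) + (t0 * (2 * \<kappa> / r\<^sup>2) / 2) * n)" for a n :: real
          by (simp add: algebra_simps)
        then show ?thesis by (simp only: fun_eq_iff \<phi>_def k_def c_def simp_thms)
      qed
      moreover have "heat_grad U t0 x \<bullet> v + (0 + (c / 2) * ((x - x1) \<bullet> v + v \<bullet> (x - x1))) = p x \<bullet> v" for v
        by (simp add: p_def inner_add_left inner_commute[of v])
      ultimately show ?thesis using has_derivative_add[OF heat_has_derivative[OF U t0p, of x] 2] by simp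
    qed
    show "(p has_derivative (\<lambda>v. H x *v v)) (at x)" for x
    proof -
      have "((\<lambda>x. c *\<^sub>R (x - x1)) has_derivative (\<lambda>v. c *\<^sub>R v)) (at x)"
        by (auto intro!: derivative_eq_intros)
      from has_derivative_add[OF heat_grad_has_derivative[OF U t0p, of x] this] show ?thesis
        by (simp add: p_def[abs_def] H_def matrix_vector_mult_add_rdistrib scaleR_matrix_vector_assoc[symmetric])
    qed
    show "transpose (H x) = H x" for x
      using heat_hess_sym[of U t0 x] by (auto simp: H_def transpose_def vec_eq_iff mat_def)
    show "continuous_on (ball x0 (r - dist x1 x0)) H"
      unfolding H_def by (intro continuous_intros heat_hess_continuous[OF U t0p])
    show "U x \<le> \<phi> x + (U x0 - \<phi> x0)" if "x \<in> ball x0 (r - dist x1 x0)" for x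
    proof -
      have "dist x1 x \<le> r" using that dist_triangle[of x1 x x0] by (simp add: dist_commute)
      then show ?thesis using max[of t0 x] t0 by (simp add: \<Phi>_def \<phi>_def algebra_simps)
    qed
  qed
  also have "trace (H x0) = trace (heat_hess U t0 x0) + c * ?d" by (simp add: H_def trace_plus_scaled_mat)
  \<comment> \<open>The bound on \<open>t1\<close> lets the paraboloid contribute at most
    \<open>\<eta>\<close>, half of what the time derivative has gained, so the trace stays below
    \<open>2 * \<kappa> = CARD('n) * q\<close>.\<close>
  also have "\<dots> \<le> 2 * (\<kappa> - \<eta>) + \<eta>"
  proof -
    have "c * ?d \<le> t1 * (2 * \<kappa> / r\<^sup>2) * ?d" unfolding c_def using t0 \<kappa>0 by (intro mult_right_mono) auto
    also have "\<dots> \<le> \<eta>"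
    proof -
      have "2 * ?d * \<kappa> > 0" using \<kappa>0 by simp
      then have "t1 * (2 * ?d * \<kappa>) \<le> \<eta> * r\<^sup>2" using t(2) by (simp add: pos_le_divide_eq)
      moreover have "r\<^sup>2 > 0" using r by simp
      ultimately show ?thesis by (simp add: field_simps)
    qed
    finally show ?thesis using time k_le[of x0] by simp
  qed
  finally show False using \<kappa> \<eta> by simp
qed

section \<open>Alexandrov solutions by Kantorovich duality\<close>

definition conjugate :: "'a::euclidean_space set \<Rightarrow> ('a \<Rightarrow> real) \<Rightarrow> 'a \<Rightarrow> real" where
  "conjugate X u y = (SUP x\<in>X. x \<bullet> y - u x)"

context
  fixes X :: "'a::euclidean_space set" and u :: "'a \<Rightarrow> real"
  assumes X: "compact X" "X \<noteq> {}" and u: "continuous_on X u"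
begin

lemma conjugate_attained:
  obtains x where "x \<in> X" "conjugate X u y = x \<bullet> y - u x" "\<And>z. z \<in> X \<Longrightarrow> z \<bullet> y - u z \<le> conjugate X u y"
proof -
  have "continuous_on X (\<lambda>x. x \<bullet> y - u x)" by (intro continuous_intros u)
  from continuous_attains_sup[OF X this] obtain x where x: "x \<in> X" "\<And>z. z \<in> X \<Longrightarrow> z \<bullet> y - u z \<le> x \<bullet> y - u x" by blast
  then have "conjugate X u y = x \<bullet> y - u x"
    unfolding conjugate_def by (intro cSup_eq_maximum) auto
  with x that show ?thesis by metis
qed

lemma conjugate_ge: "x \<in> X \<Longrightarrow> x \<bullet> y - u x \<le> conjugate X u y"
  using conjugate_attained by metis

lemma conjugate_le: "(\<And>x. x \<in> X \<Longrightarrow> x \<bullet> y - u x \<le> c) \<Longrightarrow> conjugate X u y \<le> c"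
  using conjugate_attained by metis

lemma conjugate_lipschitz:
  assumes R: "X \<subseteq> cball 0 R" "R \<ge> 0"
  shows "R-lipschitz_on UNIV (conjugate X u)"
proof (rule lipschitz_onI)
  have le: "conjugate X u y - conjugate X u z \<le> R * dist y z" for y z
  proof -
    obtain x where x: "x \<in> X" "conjugate X u y = x \<bullet> y - u x" using conjugate_attained by metis
    have "conjugate X u y - conjugate X u z \<le> (x \<bullet> y - u x) - (x \<bullet> z - u x)" using conjugate_ge[OF x(1), of z] x(2) by simp
    also have "\<dots> = x \<bullet> (y - z)" by (simp add: inner_diff_right)
    also have "\<dots> \<le> norm x * norm (y - z)" by (rule norm_cauchy_schwarz)
    also have "\<dots> \<le> R * dist y z" using x(1) R by (auto simp: dist_norm intro!: mult_right_mono)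
    finally show ?thesis .
  qed
  show "dist (conjugate X u y) (conjugate X u z) \<le> R * dist y z" for y z
    using le[of y z] le[of z y] by (simp add: dist_real_def dist_commute abs_le_iff)
qed (rule R)

lemma conjugate_midpoint:
  "2 * conjugate X u x \<le> conjugate X u (x + h) + conjugate X u (x - h)"
proof -
  obtain y where y: "y \<in> X" "conjugate X u x = y \<bullet> x - u y" using conjugate_attained by metis
  show ?thesis using conjugate_ge[OF y(1), of "x + h"] conjugate_ge[OF y(1), of "x - h"] y(2)
    by (simp add: inner_add_right inner_diff_right)
qed

end

lemma conjugate_shift_le:
  assumes X: "compact X" "X \<noteq> {}" and u: "continuous_on X u" and v: "continuous_on X v"
    and le: "\<And>x. x \<in> X \<Longrightarrow> v x \<le> u x + e"
  shows "conjugate X u y \<le> conjugate X v y + e"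
proof (rule conjugate_le[OF X u])
  fix x assume x: "x \<in> X"
  show "x \<bullet> y - u x \<le> conjugate X v y + e"
    using conjugate_ge[OF X v x, of y] le[OF x] by simp
qed

lemma set_integrable_compact_continuous:
  fixes f :: "'a::euclidean_space \<Rightarrow> real"
  shows "compact S \<Longrightarrow> continuous_on S f \<Longrightarrow> set_integrable lborel S f"
  unfolding set_integrable_def by (rule borel_integrable_compact)

lemma set_integral_const_lborel:
  fixes S :: "'a::euclidean_space set"
  assumes "compact S" shows "(LINT x:S|lborel. c) = c * measure lborel S"
  by (simp add: set_lebesgue_integral_def)

text \<open>The density \<open>g\<close> on the ball of radius \<open>R\<close> is to be transported
  to Lebesgue measure on the unit ball, hence the equality of masses. The unit ball as target makes
  the potential 1-Lipschitz.\<close>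

locale kantorovich =
  fixes g :: "'a::euclidean_space \<Rightarrow> real" and R :: real
  assumes g: "continuous_on UNIV g" and g0: "\<And>x. 0 \<le> g x" and R: "R > 0"
    and mass: "(LINT x:cball 0 R|lborel. g x) = measure lborel (cball (0::'a) 1)"
begin

abbreviation "X \<equiv> cball (0::'a) R"
abbreviation "B \<equiv> cball (0::'a) 1"

text \<open>The dual Kantorovich functional for the cost \<open>- (x \<bullet> y)\<close>, reduced
  to one potential: \<open>conjugate X u\<close> is the least partner \<open>c\<close> with
  \<open>x \<bullet> y \<le> u x + c y\<close> for all \<open>x \<in> X\<close>.\<close>

definition J :: "('a \<Rightarrow> real) \<Rightarrow> real" where
  "J u = (LINT x:X|lborel. u x * g x) + (LINT y:B|lborel. conjugate X u y)"

lemma X: "compact X" "X \<noteq> {}" "0 \<in> X" using R by auto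

lemma conj_int: "continuous_on X u \<Longrightarrow> set_integrable lborel B (conjugate X u)"
  using lipschitz_on_continuous_on[OF conjugate_lipschitz[OF X(1,2) _ order_refl]] R
  by (intro set_integrable_compact_continuous) (auto intro: continuous_on_subset)

lemma ug_int: "continuous_on X u \<Longrightarrow> set_integrable lborel X (\<lambda>x. u x * g x)"
  by (intro set_integrable_compact_continuous continuous_intros continuous_on_subset[OF g]) auto

text \<open>Each of the two terms changes by at most \<open>e\<close> times the common mass
  \<open>measure lborel B\<close>.\<close>

lemma J_le_shift:
  assumes u: "continuous_on X u" and v: "continuous_on X v" and e: "\<And>x. x \<in> X \<Longrightarrow> \<bar>u x - v x\<bar> \<le> e"
  shows "J u \<le> J v + 2 * e * measure lborel B"
proof -
  have "(LINT x:X|lborel. u x * g x) \<le> (LINT x:X|lborel. v x * g x + e * g x)"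
  proof (rule set_integral_mono[OF ug_int[OF u]])
    show "set_integrable lborel X (\<lambda>x. v x * g x + e * g x)"
      by (intro set_integral_add(1) ug_int v) (use ug_int[of "\<lambda>_. e"] in auto)
    show "u x * g x \<le> v x * g x + e * g x" if "x \<in> X" for x
      using mult_right_mono[of "u x" "v x + e" "g x"] e[OF that] g0[of x] by (simp add: distrib_right)
  qed
  also have "\<dots> = (LINT x:X|lborel. v x * g x) + (LINT x:X|lborel. e * g x)"
    by (rule set_integral_add(2)[OF ug_int[OF v]]) (use ug_int[of "\<lambda>_. e"] in auto)
  also have "(LINT x:X|lborel. e * g x) = e * measure lborel B" using mass by simp
  finally have 1: "(LINT x:X|lborel. u x * g x) \<le> (LINT x:X|lborel. v x * g x) + e * measure lborel B" .
  have ci: "set_integrable lborel B (\<lambda>_. e)" by (intro set_integrable_compact_continuous) auto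
  have "(LINT y:B|lborel. conjugate X u y) \<le> (LINT y:B|lborel. conjugate X v y + e)"
  proof (rule set_integral_mono[OF conj_int[OF u] set_integral_add(1)[OF conj_int[OF v] ci]])
    show "conjugate X u y \<le> conjugate X v y + e" for y
      by (rule conjugate_shift_le[OF X(1,2) u v]) (use e in \<open>force simp: abs_le_iff\<close>)
  qed
  also have "\<dots> = (LINT y:B|lborel. conjugate X v y) + e * measure lborel B"
    by (simp add: set_integral_add(2)[OF conj_int[OF v] ci] set_integral_const_lborel)
  finally show ?thesis using 1 by (simp add: J_def)
qed

text \<open>Adding \<open>c\<close> to \<open>u\<close> subtracts it from the conjugate, and the two
  masses are equal. This permits the normalization \<open>u 0 = 0\<close>, which bounds the class of
  competitors.\<close>

lemma J_add_const:
  assumes u: "continuous_on X u"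
  shows "J (\<lambda>x. u x + c) = J u"
proof -
  have ci: "set_integrable lborel B (\<lambda>_. - c)" by (intro set_integrable_compact_continuous) auto
  have gi: "set_integrable lborel X (\<lambda>x. c * g x)" using ug_int[of "\<lambda>_. c"] by auto
  have u': "continuous_on X (\<lambda>x. u x + c)" by (intro continuous_intros u)
  have "conjugate X (\<lambda>x. u x + c) y = conjugate X u y + - c" for y
  proof (rule antisym)
    show "conjugate X (\<lambda>x. u x + c) y \<le> conjugate X u y + - c"
      by (rule conjugate_shift_le[OF X(1,2) u' u]) auto
    have "conjugate X u y \<le> conjugate X (\<lambda>x. u x + c) y + c"
      by (rule conjugate_shift_le[OF X(1,2) u u']) auto
    then show "conjugate X u y + - c \<le> conjugate X (\<lambda>x. u x + c) y" by simp
  qed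
  then have "(LINT y:B|lborel. conjugate X (\<lambda>x. u x + c) y) = (LINT y:B|lborel. conjugate X u y) + (- c) * measure lborel B"
    by (simp add: set_integral_add(2)[OF conj_int[OF u] ci, simplified] set_integral_const_lborel)
  moreover have "(LINT x:X|lborel. (u x + c) * g x) = (LINT x:X|lborel. u x * g x) + c * measure lborel B"
    using set_integral_add(2)[OF ug_int[OF u] gi] mass by (simp add: distrib_right)
  ultimately show ?thesis by (simp add: J_def)
qed

definition K :: "('a \<Rightarrow> real) set" where
  "K = {u. 1-lipschitz_on X u \<and> u 0 = 0}"

lemma K_cont: "u \<in> K \<Longrightarrow> continuous_on X u"
  by (auto simp: K_def intro: lipschitz_on_continuous_on)

lemma K_bound: "u \<in> K \<Longrightarrow> x \<in> X \<Longrightarrow> \<bar>u x\<bar> \<le> R"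
  using lipschitz_onD[of 1 X u x 0] X(3) by (auto simp: K_def dist_real_def)

text \<open>The double conjugate lies below \<open>v\<close> on \<open>X\<close>, and its conjugate
  does not exceed that of \<open>v\<close> on \<open>B\<close>, so \<open>J\<close> does not
  increase. As a supremum of affine functions with slopes in the unit ball it is 1-Lipschitz, which
  reduces the minimization to the class \<open>K\<close>.\<close>

lemma J_biconjugate_le:
  assumes v: "continuous_on X v"
  obtains w where "w \<in> K" "J w \<le> J v"
proof -
  let ?c = "conjugate X v"
  have B: "compact B" "B \<noteq> {}" by auto
  have c: "continuous_on B ?c"
    using lipschitz_on_continuous_on[OF conjugate_lipschitz[OF X(1,2) v order_refl]] R
    by (auto intro: continuous_on_subset)
  define v' where "v' = conjugate B ?c"
  have lip: "1-lipschitz_on UNIV v'" unfolding v'_def by (rule conjugate_lipschitz[OF B c]) auto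
  have v'c: "continuous_on X v'" using lipschitz_on_continuous_on[OF lip] by (rule continuous_on_subset) auto
  have le: "v' x \<le> v x" if "x \<in> X" for x unfolding v'_def
  proof (rule conjugate_le[OF B c])
    fix y show "y \<bullet> x - ?c y \<le> v x" using conjugate_ge[OF X(1,2) v that, of y] by (simp add: inner_commute)
  qed
  have "(LINT x:X|lborel. v' x * g x) \<le> (LINT x:X|lborel. v x * g x)"
    by (rule set_integral_mono[OF ug_int[OF v'c] ug_int[OF v]]) (use le g0 in \<open>auto intro: mult_right_mono\<close>)
  moreover have "(LINT y:B|lborel. conjugate X v' y) \<le> (LINT y:B|lborel. ?c y)"
  proof (rule set_integral_mono[OF conj_int[OF v'c] conj_int[OF v]])
    fix y assume y: "y \<in> B"
    show "conjugate X v' y \<le> ?c y"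
    proof (rule conjugate_le[OF X(1,2) v'c])
      fix x show "x \<bullet> y - v' x \<le> ?c y"
        using conjugate_ge[OF B c y, of x] by (simp add: v'_def inner_commute)
    qed
  qed
  ultimately have "J v' \<le> J v" by (simp add: J_def)
  moreover have "J (\<lambda>x. v' x + - v' 0) = J v'" by (rule J_add_const[OF v'c])
  moreover have "(\<lambda>x. v' x + - v' 0) \<in> K"
    using lip by (auto simp: K_def lipschitz_on_def dist_real_def)
  ultimately show ?thesis using that by metis
qed

text \<open>Direct method: a minimizing sequence in \<open>K\<close> has a uniformly convergent
  subsequence by Arzela-Ascoli, and \<open>J_le_shift\<close> makes \<open>J\<close> continuous
  under uniform convergence. Minimality is stated among all continuous functions because the later
  perturbations leave \<open>K\<close>.\<close>

lemma minimizer: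
  obtains u where "u \<in> K" "\<And>v. continuous_on X v \<Longrightarrow> J u \<le> J v"
proof -
  have zero: "(\<lambda>_. 0) \<in> K" by (auto simp: K_def lipschitz_on_def)
  have bd: "J (\<lambda>_. 0) - 2 * R * measure lborel B \<le> J u" if "u \<in> K" for u
    using J_le_shift[OF K_cont[OF zero] K_cont[OF that], of R] K_bound[OF that] by auto
  have bdd: "bdd_below (J ` K)" using bd by (auto intro!: bdd_belowI2)
  define m where "m = Inf (J ` K)"
  have "\<exists>u\<in>K. J u < m + 1 / Suc n" for n
  proof -
    have "Inf (J ` K) < m + 1 / Suc n" by (simp add: m_def)
    then show ?thesis using cInf_lessD[of "J ` K"] zero by blast
  qed
  then obtain f where f: "\<And>n. f n \<in> K" "\<And>n. J (f n) < m + 1 / Suc n" by metis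
  have equi: "\<exists>d>0. \<forall>n y. y \<in> X \<and> norm (x - y) < d \<longrightarrow> norm (f n x - f n y) < e" if "x \<in> X" "0 < e" for x e
  proof (intro exI[of _ e] conjI allI impI)
    fix n y assume y: "y \<in> X \<and> norm (x - y) < e"
    have "dist (f n x) (f n y) \<le> 1 * dist x y"
      using f(1)[of n] that(1) y by (intro lipschitz_onD[of 1 X]) (auto simp: K_def)
    then show "norm (f n x - f n y) < e" using y by (simp add: dist_norm)
  qed (use that in auto)
  have fb: "norm (f n x) \<le> R" if "x \<in> X" for n x using K_bound[OF f(1) that] by simp
  obtain u k where u: "continuous_on X u" and k: "strict_mono (k :: nat \<Rightarrow> nat)"
    and lim: "\<And>e. 0 < e \<Longrightarrow> \<exists>N. \<forall>n x. n \<ge> N \<and> x \<in> X \<longrightarrow> norm (f (k n) x - u x) < e"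
    using Arzela_Ascoli[OF X(1) fb equi] by metis
  have ptw: "(\<lambda>n. f (k n) x) \<longlonglongrightarrow> u x" if "x \<in> X" for x
    unfolding LIMSEQ_iff using lim that by blast
  have "1-lipschitz_on X u"
  proof (rule lipschitz_onI)
    fix x y assume xy: "x \<in> X" "y \<in> X"
    show "dist (u x) (u y) \<le> 1 * dist x y"
    proof (rule LIMSEQ_le_const2[OF tendsto_dist[OF ptw[OF xy(1)] ptw[OF xy(2)]]])
      show "\<exists>N. \<forall>n\<ge>N. dist (f (k n) x) (f (k n) y) \<le> 1 * dist x y"
        using f(1) xy by (auto simp: K_def intro!: lipschitz_onD[of 1 X, simplified])
    qed
  qed simp
  moreover have "u 0 = 0"
    using LIMSEQ_unique[OF ptw[OF X(3)], of 0] f(1) by (simp add: K_def)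
  ultimately have uK: "u \<in> K" by (simp add: K_def)
  have "J u \<le> m"
  proof (rule field_le_epsilon)
    fix e :: real assume e: "e > 0"
    define V where "V = 2 * measure lborel B + 1"
    have V: "V > 0" unfolding V_def by (simp add: add_nonneg_pos)
    define e' where "e' = e / (2 * V)"
    have e': "e' > 0" using e V by (simp add: e'_def)
    obtain N where N: "\<And>n x. n \<ge> N \<Longrightarrow> x \<in> X \<Longrightarrow> norm (f (k n) x - u x) < e'" using lim[OF e'] by blast
    obtain N' where N': "1 / Suc N' < e / 2" using e nat_approx_posE[of "e/2"] by auto
    define n where "n = max N N'"
    have "J u \<le> J (f (k n)) + 2 * e' * measure lborel B"
      using N[of n] by (intro J_le_shift u K_cont f) (auto simp: n_def less_imp_le abs_minus_commute)
    also have "J (f (k n)) \<le> m + e / 2"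
    proof -
      have "Suc N' \<le> Suc (k n)" using seq_suble[OF k, of n] by (simp add: n_def)
      then have "1 / Suc (k n) \<le> 1 / real (Suc N')" by (intro divide_left_mono) auto
      then show ?thesis using f(2)[of "k n"] N' by linarith
    qed
    also have "2 * e' * measure lborel B \<le> e / 2"
    proof -
      have "2 * e' * measure lborel B \<le> e' * V" unfolding V_def using e' by (simp add: algebra_simps)
      also have "\<dots> = e / 2" using V by (simp add: e'_def)
      finally show ?thesis .
    qed
    finally show "J u \<le> m + e" by linarith
  qed
  have mle: "m \<le> J v" if "v \<in> K" for v unfolding m_def using bdd that by (intro cInf_lower) auto
  have "J u \<le> J v" if vc: "continuous_on X v" for v
  proof -
    obtain w where "w \<in> K" "J w \<le> J v" using J_biconjugate_le[OF vc] .
    with \<open>J u \<le> m\<close> mle[of w] show ?thesis by linarith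
  qed
  with uK that show ?thesis by blast
qed

text \<open>Compare the minimizer u with \<open>u - t v\<close> for a bump function v of E: the conjugate grows, by at most t,
  only at those y whose supremum is nearly attained close to E.\<close>

lemma alexandrov_solution:
  obtains U where "1-lipschitz_on UNIV U" "\<And>x h. 2 * U x \<le> U (x + h) + U (x - h)"
    "\<And>E. compact E \<Longrightarrow> E \<subseteq> X \<Longrightarrow> (LINT x:E|lborel. g x) \<le> measure lebesgue (subdiff U E)"
proof -
  obtain u where uK: "u \<in> K" and min: "\<And>v. continuous_on X v \<Longrightarrow> J u \<le> J v" using minimizer by blast
  have u: "continuous_on X u" by (rule K_cont[OF uK])
  let ?c = "conjugate X u"
  have B: "compact B" "B \<noteq> {}" by auto
  have clip: "R-lipschitz_on UNIV ?c" by (rule conjugate_lipschitz[OF X(1,2) u order_refl]) (use R in simp)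
  have cU: "continuous_on UNIV ?c" by (rule lipschitz_on_continuous_on[OF clip])
  have c: "continuous_on B ?c" using cU by (rule continuous_on_subset) auto
  \<comment> \<open>The double conjugate is a convex function on the whole space that lies below the
    minimizer on \<open>X\<close>.\<close>
  define U where "U = conjugate B ?c"
  have lip: "1-lipschitz_on UNIV U" unfolding U_def by (rule conjugate_lipschitz[OF B c]) auto
  have mid: "2 * U x \<le> U (x + h) + U (x - h)" for x h unfolding U_def by (rule conjugate_midpoint[OF B c])
  have U_le: "U x \<le> u x" if "x \<in> X" for x unfolding U_def
  proof (rule conjugate_le[OF B c])
    fix y show "y \<bullet> x - ?c y \<le> u x" using conjugate_ge[OF X(1,2) u that, of y] by (simp add: inner_commute)
  qed
  have "(LINT x:E|lborel. g x) \<le> measure lebesgue (subdiff U E)" if E: "compact E" "E \<subseteq> X" for E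
  proof (cases "E = {}")
    case True then show ?thesis by (simp add: set_lebesgue_integral_def)
  next
    case False
    \<comment> \<open>\<open>t n\<close> is both the size of the perturbation and the width of the
      bump \<open>v n\<close>, so a single limit shrinks both.\<close>
    define t :: "nat \<Rightarrow> real" where "t n = 1 / Suc n" for n
    have t: "t n > 0" for n by (simp add: t_def)
    define v where "v n x = max 0 (1 - infdist x E / t n)" for n x
    have vc: "continuous_on S (v n)" for S n unfolding v_def by (intro continuous_intros) (use t[of n] in auto)
    have v01: "0 \<le> v n x" "v n x \<le> 1" for n x using t[of n] by (auto simp: v_def infdist_nonneg)
    have vE: "v n x = 1" if "x \<in> E" for n x using that by (simp add: v_def)
    define Z where "Z n = {y\<in>B. \<exists>x\<in>X. infdist x E \<le> t n \<and> ?c y \<le> x \<bullet> y - u x + t n}" for n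
    have Zc: "compact (Z n)" for n
    proof -
      let ?P = "{q \<in> X \<times> B. infdist (fst q) E \<le> t n} \<inter> {q \<in> X \<times> B. ?c (snd q) \<le> fst q \<bullet> snd q - u (fst q) + t n}"
      have "closed ?P"
        by (intro closed_Int continuous_on_closed_Collect_le continuous_intros
            continuous_on_compose2[OF cU] continuous_on_compose2[OF u] closed_Times) auto
      then have "compact ((X \<times> B) \<inter> ?P)" by (intro compact_Int_closed compact_Times compact_cball)
      moreover have "(X \<times> B) \<inter> ?P = ?P" by blast
      ultimately have "compact ?P" by simp
      moreover have "Z n = snd ` ?P"
      proof (rule set_eqI)
        fix y
        have img: "y \<in> snd ` P \<longleftrightarrow> (\<exists>x. (x, y) \<in> P)" for P :: "('a \<times> 'a) set" by force
        show "y \<in> Z n \<longleftrightarrow> y \<in> snd ` ?P" unfolding img Z_def by auto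
      qed
      ultimately show ?thesis by (simp add: compact_continuous_image continuous_on_snd)
    qed
    have key: "(LINT x:E|lborel. g x) \<le> measure lborel (Z n)" for n
    proof -
      define w where "w x = u x - t n * v n x" for x
      have wc: "continuous_on X w" unfolding w_def by (intro continuous_intros u vc)
      have vi: "set_integrable lborel X (\<lambda>x. v n x * g x)" by (rule ug_int[OF vc])
      have "J u \<le> J w" by (rule min[OF wc])
      moreover have "(LINT x:X|lborel. w x * g x) = (LINT x:X|lborel. u x * g x) - t n * (LINT x:X|lborel. v n x * g x)"
        using set_integral_diff(2)[OF ug_int[OF u] set_integrable_mult_right[of "t n" lborel X, OF vi]]
        by (simp add: w_def left_diff_distrib mult.assoc)
      ultimately have 1: "t n * (LINT x:X|lborel. v n x * g x) \<le> (LINT y:B|lborel. conjugate X w y) - (LINT y:B|lborel. ?c y)"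
        by (simp add: J_def)
      have "(LINT y:B|lborel. conjugate X w y) - (LINT y:B|lborel. ?c y) = (LINT y:B|lborel. conjugate X w y - ?c y)"
        by (rule set_integral_diff(2)[OF conj_int[OF wc] conj_int[OF u], symmetric])
      also have "\<dots> \<le> (LINT y:B|lborel. t n * indicator (Z n) y)"
      proof (rule set_integral_mono)
        show "set_integrable lborel B (\<lambda>y. conjugate X w y - ?c y)"
          by (rule set_integral_diff(1)[OF conj_int[OF wc] conj_int[OF u]])
        show "set_integrable lborel B (\<lambda>y. t n * indicator (Z n) y)"
        proof -
          have "set_integrable lborel (Z n) (\<lambda>_. t n)" by (intro set_integrable_compact_continuous Zc) auto
          moreover have eq: "(\<lambda>y. indicator B y *\<^sub>R (t n * indicator (Z n) y)) = (\<lambda>y. indicator (Z n) y *\<^sub>R t n)"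
            by (rule ext) (auto simp: indicator_def Z_def)
          ultimately show ?thesis unfolding set_integrable_def eq by simp
        qed
        fix y assume y: "y \<in> B"
        obtain x where x: "x \<in> X" "conjugate X w y = x \<bullet> y - w x" using conjugate_attained[OF X(1,2) wc] by metis
        have le: "x \<bullet> y - u x \<le> ?c y" by (rule conjugate_ge[OF X(1,2) u x(1)])
        have tv: "0 \<le> t n * v n x" "t n * v n x \<le> t n" using v01[of n x] t[of n] by (auto simp: mult_left_le)
        have dw: "conjugate X w y = x \<bullet> y - u x + t n * v n x" using x(2) by (simp add: w_def)
        show "conjugate X w y - ?c y \<le> t n * indicator (Z n) y"
        proof (cases "y \<in> Z n")
          case True then show ?thesis using le tv dw by simp
        next
          case False
          have "conjugate X w y \<le> ?c y"
          proof (rule ccontr)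
            assume gt: "\<not> conjugate X w y \<le> ?c y"
            then have "t n * v n x > 0" using le dw by simp
            then have "v n x > 0" using t[of n] by (simp add: zero_less_mult_iff)
            then have "infdist x E \<le> t n" using t[of n] by (auto simp: v_def less_max_iff_disj pos_divide_le_eq divide_simps)
            with gt tv dw x y have "y \<in> Z n" by (auto simp: Z_def intro!: bexI[of _ x])
            with False show False by simp
          qed
          then show ?thesis using False by simp
        qed
      qed
      also have "\<dots> = t n * measure lborel (Z n)"
      proof -
        have "(LINT y:B|lborel. t n * indicator (Z n) y) = (LINT y:Z n|lborel. t n)"
          unfolding set_lebesgue_integral_def
          by (rule Bochner_Integration.integral_cong) (auto simp: indicator_def Z_def)
        then show ?thesis by (simp add: set_integral_const_lborel[OF Zc])
      qed
      finally have "t n * (LINT x:X|lborel. v n x * g x) \<le> t n * measure lborel (Z n)" using 1 by simp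
      then have 2: "(LINT x:X|lborel. v n x * g x) \<le> measure lborel (Z n)" using t[of n] by simp
      have "(LINT x:E|lborel. g x) \<le> (LINT x:X|lborel. v n x * g x)"
        unfolding set_lebesgue_integral_def
      proof (rule integral_mono)
        show "integrable lborel (\<lambda>x. indicator E x *\<^sub>R g x)"
          by (rule borel_integrable_compact[OF E(1)]) (use g in \<open>auto intro: continuous_on_subset\<close>)
        show "integrable lborel (\<lambda>x. indicator X x *\<^sub>R (v n x * g x))" using vi by (simp add: set_integrable_def)
        show "indicator E x *\<^sub>R g x \<le> indicator X x *\<^sub>R (v n x * g x)" for x
          using E(2) vE[of x n] v01[of n x] g0[of x] by (auto simp: indicator_def)
      qed
      with 2 show ?thesis by simp
    qed
    have Zdec: "decseq Z"
    proof (rule decseq_SucI)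
      fix n have "t (Suc n) \<le> t n" by (simp add: t_def divide_simps)
      then show "Z (Suc n) \<subseteq> Z n" unfolding Z_def by force
    qed
    have "(\<lambda>n. measure lborel (Z n)) \<longlonglongrightarrow> measure lborel (\<Inter>n. Z n)"
    proof (rule Lim_measure_decseq[OF _ Zdec])
      show "range Z \<subseteq> sets lborel" using Zc by (auto intro: borel_compact)
      show "emeasure lborel (Z n) \<noteq> \<infinity>" for n
        using emeasure_bounded_finite[OF compact_imp_bounded[OF Zc[of n]]] by simp
    qed
    moreover have ZI: "(\<Inter>n. Z n) \<in> sets borel"
      by (intro borel_closed closed_INT ballI compact_imp_closed Zc)
    ultimately have "(LINT x:E|lborel. g x) \<le> measure lborel (\<Inter>n. Z n)"
      using key by (intro LIMSEQ_le_const[where X="\<lambda>n. measure lborel (Z n)"]) auto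
    also have "\<dots> = measure lebesgue (\<Inter>n. Z n)"
      using ZI by (intro measure_completion[symmetric]) simp
    also have "\<dots> \<le> measure lebesgue (subdiff U E)"
    proof (rule measure_mono_fmeasurable)
      \<comment> \<open>For \<open>y\<close> in all \<open>Z n\<close>, near-maximizers approaching
        \<open>E\<close> accumulate at some \<open>x \<in> E\<close> that is an exact maximizer.
        There \<open>U x \<le> u x \<le> x \<bullet> y - ?c y\<close>, while
        \<open>U z \<ge> y \<bullet> z - ?c y\<close> for every \<open>z\<close>, so
        \<open>y\<close> is a subgradient at \<open>x\<close>.\<close>
      show "(\<Inter>n. Z n) \<subseteq> subdiff U E"
      proof
        fix y assume "y \<in> (\<Inter>n. Z n)"
        then have "\<forall>n. \<exists>x\<in>X. infdist x E \<le> t n \<and> ?c y \<le> x \<bullet> y - u x + t n" by (auto simp: Z_def)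
        then obtain s where s: "\<And>n. s n \<in> X" "\<And>n. infdist (s n) E \<le> t n" "\<And>n. ?c y \<le> s n \<bullet> y - u (s n) + t n" by metis
        obtain x k where x: "x \<in> X" and k: "strict_mono (k :: nat \<Rightarrow> nat)" and sl: "(s \<circ> k) \<longlonglongrightarrow> x"
          using X(1) s(1) unfolding compact_def by metis
        have t0: "(\<lambda>n. t (k n)) \<longlonglongrightarrow> 0"
          using LIMSEQ_subseq_LIMSEQ[OF LIMSEQ_inverse_real_of_nat k] by (simp add: t_def o_def divide_inverse)
        have sl': "(\<lambda>n. s (k n)) \<longlonglongrightarrow> x" using sl by (simp add: o_def)
        have "(\<lambda>n. infdist (s (k n)) E) \<longlonglongrightarrow> infdist x E" by (rule tendsto_infdist[OF sl'])
        then have "infdist x E \<le> 0" by (rule LIMSEQ_le[OF _ t0]) (use s in auto)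
        then have xE: "x \<in> E" using E(1) False infdist_nonneg[of x E]
          by (simp add: in_closed_iff_infdist_zero compact_imp_closed)
        have "(\<lambda>n. u (s (k n))) \<longlonglongrightarrow> u x"
          using continuous_on_tendsto_compose[OF u sl' x] s(1) by simp
        then have "(\<lambda>n. s (k n) \<bullet> y - u (s (k n)) + t (k n)) \<longlonglongrightarrow> x \<bullet> y - u x + 0"
          by (intro tendsto_intros sl' t0)
        then have cy: "?c y \<le> x \<bullet> y - u x + 0" by (rule LIMSEQ_le_const) (use s in auto)
        have yB: "y \<in> B" using \<open>y \<in> (\<Inter>n. Z n)\<close> by (auto simp: Z_def)
        have "U x + y \<bullet> (z - x) \<le> U z" for z
          using conjugate_ge[OF B c yB, of z] cy U_le[OF x]
          by (simp add: U_def inner_diff_right inner_commute)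
        with xE show "y \<in> subdiff U E" by (auto simp: subdiff_def)
      qed
      show "(\<Inter>n. Z n) \<in> sets lebesgue" using ZI by (intro sets_completionI_sets) simp
      show "subdiff U E \<in> lmeasurable" by (rule lmeasurable_compact[OF compact_subdiff[OF lip E(1)]])
    qed
    finally show ?thesis .
  qed
  with lip mid that show ?thesis by blast
qed

end

section \<open>Vector measures\<close>

definition bounded_signed_measure :: "'a measure \<Rightarrow> ('a set \<Rightarrow> real) \<Rightarrow> bool" where
  "bounded_signed_measure M \<nu> \<longleftrightarrow> \<nu> {} = 0
     \<and> (\<forall>F :: nat \<Rightarrow> 'a set. range F \<subseteq> sets M \<longrightarrow> disjoint_family F \<longrightarrow> (\<lambda>n. \<nu> (F n)) sums \<nu> (\<Union>n. F n))
     \<and> (\<exists>K. \<forall>E\<in>sets M. \<bar>\<nu> E\<bar> \<le> K)"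

lemma bounded_signed_measure_minus:
  "bounded_signed_measure M \<nu> \<Longrightarrow> bounded_signed_measure M (\<lambda>E. - \<nu> E)"
  unfolding bounded_signed_measure_def by (auto intro: sums_minus)

lemma ennreal_sum_le: "ennreal (\<Sum>i\<in>I. f i) \<le> (\<Sum>i\<in>I. ennreal (f i))"
proof (cases "finite I")
  case True
  then show ?thesis
  proof induction
    case (insert i I)
    have "ennreal (f i + sum f I) \<le> ennreal (max 0 (f i) + max 0 (sum f I))" by (intro ennreal_leI) auto
    also have "\<dots> = ennreal (f i) + ennreal (sum f I)" by (simp add: max_def ennreal_neg)
    also have "\<dots> \<le> ennreal (f i) + (\<Sum>i\<in>I. ennreal (f i))" using insert.IH by (intro add_left_mono)
    finally show ?case using insert.hyps by simp
  qed simp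
qed simp

context
  fixes M :: "'a measure" and \<nu> :: "'a set \<Rightarrow> real"
  assumes \<nu>: "bounded_signed_measure M \<nu>"
begin

lemma signed_empty: "\<nu> {} = 0"
  using \<nu> by (simp add: bounded_signed_measure_def)

lemma signed_sums: "range F \<subseteq> sets M \<Longrightarrow> disjoint_family F \<Longrightarrow> (\<lambda>n. \<nu> (F n)) sums \<nu> (\<Union>n::nat. F n)"
  using \<nu> by (simp add: bounded_signed_measure_def)

lemma signed_union:
  assumes "A \<in> sets M" "B \<in> sets M" "A \<inter> B = {}"
  shows "\<nu> (A \<union> B) = \<nu> A + \<nu> B"
proof -
  have "(\<lambda>n. \<nu> (binaryset A B n)) sums \<nu> (\<Union>n. binaryset A B n)"
    using assms by (intro signed_sums) (auto simp: range_binaryset_eq disjoint_family_on_def binaryset_def)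
  moreover have "(\<lambda>n. \<nu> (binaryset A B n)) sums (\<nu> A + \<nu> B)"
    by (rule binaryset_sums) (rule signed_empty)
  ultimately show ?thesis by (simp add: UN_binaryset_eq sums_unique2)
qed

text \<open>Competitors for disjoint sets may be united, which gives superadditivity. Conversely a
  competitor for the union is cut along the \<open>A i\<close>, and countable additivity of
  \<open>\<nu>\<close> adds up the pieces.\<close>

lemma upper_variation_additive:
  defines "up \<equiv> \<lambda>E. SUP F\<in>{F\<in>sets M. F \<subseteq> E}. ennreal (\<nu> F)"
  assumes A: "range A \<subseteq> sets M" "disjoint_family (A :: nat \<Rightarrow> 'a set)"
  shows "(\<Sum>i. up (A i)) = up (\<Union>i. A i)"
proof (rule antisym)
  have up_eq: "up E = (SUP F\<in>{F\<in>sets M. F \<subseteq> E}. ennreal (\<nu> F))" for E by (simp add: up_def)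
  have up_ge: "ennreal (\<nu> F) \<le> up E" if "F \<in> sets M" "F \<subseteq> E" for E F
    unfolding up_def using that by (intro SUP_upper) auto
  have up_mono: "up E \<le> up E'" if "E \<subseteq> E'" for E E'
    unfolding up_def using that by (intro SUP_subset_mono) auto
  have super: "up E + up E' \<le> up (E \<union> E')" if "E \<inter> E' = {}" for E E'
  proof -
    have ne: "{F\<in>sets M. F \<subseteq> G} \<noteq> {}" for G by auto
    have "ennreal (\<nu> F) + ennreal (\<nu> G) \<le> up (E \<union> E')" if FG: "F \<in> sets M" "F \<subseteq> E" "G \<in> sets M" "G \<subseteq> E'" for F G
    proof (cases "0 \<le> \<nu> F \<and> 0 \<le> \<nu> G")
      case True
      then have "ennreal (\<nu> F) + ennreal (\<nu> G) = ennreal (\<nu> (F \<union> G))"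
        using FG \<open>E \<inter> E' = {}\<close> by (subst signed_union) auto
      also have "\<dots> \<le> up (E \<union> E')" using FG by (intro up_ge) auto
      finally show ?thesis .
    next
      \<comment> \<open>A set of negative value contributes 0 after truncation, so the other set
        alone is a competitor.\<close>
      case False
      then consider "\<nu> F < 0" | "\<nu> G < 0" by linarith
      then show ?thesis
      proof cases
        case 1 then show ?thesis using up_ge[of G "E \<union> E'"] FG by (auto simp: ennreal_neg)
      next
        case 2 then show ?thesis using up_ge[of F "E \<union> E'"] FG by (auto simp: ennreal_neg)
      qed
    qed
    then have "ennreal (\<nu> F) + up E' \<le> up (E \<union> E')" if "F \<in> sets M" "F \<subseteq> E" for F
      unfolding up_eq[of E'] ennreal_SUP_add_right[OF ne[of E']] using that
      by (auto intro!: SUP_least)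
    then show ?thesis
      unfolding up_eq[of E] ennreal_SUP_add_left[OF ne[of E], symmetric]
      by (auto intro!: SUP_least)
  qed
  have fin: "(\<Sum>i<n. up (A i)) \<le> up (\<Union>i<n. A i)" for n
  proof (induction n)
    case (Suc n)
    have "(\<Sum>i<Suc n. up (A i)) \<le> up (\<Union>i<n. A i) + up (A n)" using Suc by (simp add: add_right_mono)
    also have "\<dots> \<le> up ((\<Union>i<n. A i) \<union> A n)"
    proof (rule super)
      have "A i \<inter> A n = {}" if "i < n" for i
        using that by (intro disjoint_family_onD[OF A(2)]) auto
      then show "(\<Union>i<n. A i) \<inter> A n = {}" by blast
    qed
    also have "(\<Union>i<n. A i) \<union> A n = (\<Union>i<Suc n. A i)" by (auto simp: lessThan_Suc)
    finally show ?case .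
  qed simp
  show "(\<Sum>i. up (A i)) \<le> up (\<Union>i. A i)"
    unfolding suminf_eq_SUP by (intro SUP_least order_trans[OF fin] up_mono) auto
  show "up (\<Union>i. A i) \<le> (\<Sum>i. up (A i))"
    unfolding up_eq[of "\<Union>i. A i"]
  proof (rule SUP_least)
    fix F assume "F \<in> {F \<in> sets M. F \<subseteq> (\<Union>i. A i)}"
    then have F: "F \<in> sets M" "F = (\<Union>i. F \<inter> A i)" by auto
    have "(\<lambda>i. \<nu> (F \<inter> A i)) sums \<nu> (\<Union>i. F \<inter> A i)"
      using A F by (intro signed_sums) (auto simp: disjoint_family_on_def)
    then have "(\<lambda>n. \<Sum>i<n. \<nu> (F \<inter> A i)) \<longlonglongrightarrow> \<nu> F" using F(2) by (simp add: sums_def)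
    then have "(\<lambda>n. ennreal (\<Sum>i<n. \<nu> (F \<inter> A i))) \<longlonglongrightarrow> ennreal (\<nu> F)" by (rule tendsto_ennrealI)
    moreover have "ennreal (\<Sum>i<n. \<nu> (F \<inter> A i)) \<le> (\<Sum>i. up (A i))" for n
    proof -
      have "ennreal (\<Sum>i<n. \<nu> (F \<inter> A i)) \<le> (\<Sum>i<n. ennreal (\<nu> (F \<inter> A i)))" by (rule ennreal_sum_le)
      also have "\<dots> \<le> (\<Sum>i<n. up (A i))" using A F by (intro sum_mono up_ge) auto
      also have "\<dots> \<le> (\<Sum>i. up (A i))" by (rule sum_le_suminf) auto
      finally show ?thesis .
    qed
    ultimately show "ennreal (\<nu> F) \<le> (\<Sum>i. up (A i))" by (intro LIMSEQ_le_const2) auto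
  qed
qed

lemma emeasure_upper_variation:
  assumes "E \<in> sets M"
  shows "emeasure (upper_variation M \<nu>) E = (SUP F\<in>{F\<in>sets M. F \<subseteq> E}. ennreal (\<nu> F))"
  unfolding upper_variation_def
proof (rule emeasure_measure_of_sigma)
  show "sigma_algebra (space M) (sets M)" by (rule sets.sigma_algebra_axioms)
  show "positive (sets M) (\<lambda>E. SUP F\<in>{F\<in>sets M. F \<subseteq> E}. ennreal (\<nu> F))"
  proof -
    have "{F\<in>sets M. F \<subseteq> {}} = {{}}" by auto
    then show ?thesis by (simp add: positive_def signed_empty)
  qed
  show "countably_additive (sets M) (\<lambda>E. SUP F\<in>{F\<in>sets M. F \<subseteq> E}. ennreal (\<nu> F))"
    unfolding countably_additive_def using upper_variation_additive by auto
qed (rule assms)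

lemma sets_upper_variation [simp]: "sets (upper_variation M \<nu>) = sets M"
  by (simp add: upper_variation_def)

lemma space_upper_variation [simp]: "space (upper_variation M \<nu>) = space M"
  by (simp add: upper_variation_def)

lemma finite_upper_variation: "finite_measure (upper_variation M \<nu>)"
proof
  obtain K where K: "\<And>E. E \<in> sets M \<Longrightarrow> \<bar>\<nu> E\<bar> \<le> K" using \<nu> by (auto simp: bounded_signed_measure_def)
  have "emeasure (upper_variation M \<nu>) (space M) \<le> ennreal K"
    by (subst emeasure_upper_variation) (auto intro!: SUP_least ennreal_leI dest!: K)
  then show "emeasure (upper_variation M \<nu>) (space (upper_variation M \<nu>)) \<noteq> \<infinity>"
    by (simp add: top_unique less_top[symmetric]) (metis ennreal_neq_top top.extremum_unique)
qed

lemma upper_variation_ge: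
  assumes "F \<in> sets M" "F \<subseteq> E" "E \<in> sets M"
  shows "\<nu> F \<le> measure (upper_variation M \<nu>) E"
proof -
  interpret finite_measure "upper_variation M \<nu>" by (rule finite_upper_variation)
  have "ennreal (\<nu> F) \<le> emeasure (upper_variation M \<nu>) E"
    using assms by (subst emeasure_upper_variation) (auto intro!: SUP_upper)
  then show ?thesis by (simp add: emeasure_eq_measure)
qed

lemma upper_variation_le:
  assumes "\<And>F. F \<in> sets M \<Longrightarrow> F \<subseteq> E \<Longrightarrow> \<nu> F \<le> c" "E \<in> sets M"
  shows "measure (upper_variation M \<nu>) E \<le> c"
proof -
  interpret finite_measure "upper_variation M \<nu>" by (rule finite_upper_variation)
  have c: "0 \<le> c" using assms(1)[of "{}"] signed_empty by simp
  have "emeasure (upper_variation M \<nu>) E \<le> ennreal c"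
    using assms by (subst emeasure_upper_variation) (auto intro!: SUP_least ennreal_leI)
  then show ?thesis using c by (simp add: emeasure_eq_measure)
qed

end

text \<open>Every measurable \<open>F \<subseteq> E\<close> satisfies
  \<open>\<nu> F = \<nu> E - \<nu> (E - F)\<close>, so the suprema defining the two variations
  differ by \<open>\<nu> E\<close>. No Hahn decomposition enters.\<close>

lemma jordan_decomposition:
  assumes \<nu>: "bounded_signed_measure M \<nu>" and E: "E \<in> sets M"
  shows "\<nu> E = measure (upper_variation M \<nu>) E - measure (upper_variation M (\<lambda>E. - \<nu> E)) E"
proof -
  note \<nu>' = bounded_signed_measure_minus[OF \<nu>]
  have split: "\<nu> F = \<nu> E - \<nu> (E - F)" if "F \<in> sets M" "F \<subseteq> E" for F
    using signed_union[OF \<nu> that(1), of "E - F"] that E by (simp add: Un_absorb1 Un_Diff_cancel)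
  have "measure (upper_variation M \<nu>) E \<le> \<nu> E + measure (upper_variation M (\<lambda>E. - \<nu> E)) E"
  proof (rule upper_variation_le[OF \<nu> _ E])
    fix F assume F: "F \<in> sets M" "F \<subseteq> E"
    show "\<nu> F \<le> \<nu> E + measure (upper_variation M (\<lambda>E. - \<nu> E)) E"
      using upper_variation_ge[OF \<nu>', of "E - F" E] split[OF F] F E by simp
  qed
  moreover have "measure (upper_variation M (\<lambda>E. - \<nu> E)) E \<le> - \<nu> E + measure (upper_variation M \<nu>) E"
  proof (rule upper_variation_le[OF \<nu>' _ E])
    fix F assume F: "F \<in> sets M" "F \<subseteq> E"
    show "- \<nu> F \<le> - \<nu> E + measure (upper_variation M \<nu>) E"
      using upper_variation_ge[OF \<nu>, of "E - F" E] split[OF F] F E by simp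
  qed
  ultimately show ?thesis by simp
qed

section \<open>Total variation and the bound for vector integrals\<close>

lemma norm_le_total_variation:
  assumes E: "E \<in> sets M" and "\<mu> {} = 0"
  shows "ennreal (norm (\<mu> E)) \<le> total_variation M \<mu>"
proof -
  \<comment> \<open>A partition must not contain the empty set, hence the removal when
    \<open>E\<close> is empty or the whole space.\<close>
  define P where "P = {E, space M - E} - {{}}"
  have P: "finite P" "P \<subseteq> sets M" "partition_on (space M) P"
    using E sets.sets_into_space[OF E] by (auto simp: P_def partition_on_def disjoint_def)
  show ?thesis
  proof (cases "E = {}")
    case False
    then have "ennreal (norm (\<mu> E)) \<le> (\<Sum>E\<in>P. ennreal (norm (\<mu> E)))"
      using P by (intro member_le_sum) (auto simp: P_def)
    also have "\<dots> \<le> total_variation M \<mu>" unfolding total_variation_def using P by (intro SUP_upper) auto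
    finally show ?thesis .
  next
    case True
    then show ?thesis using assms(2) by simp
  qed
qed

lemma bounded_vector_measure_component:
  fixes \<mu> :: "'a set \<Rightarrow> real^'n"
  assumes "bounded_vector_measure M \<mu>"
  shows "bounded_signed_measure M (\<lambda>E. \<mu> E $ i)"
  unfolding bounded_signed_measure_def
proof (intro conjI allI impI)
  show "\<mu> {} $ i = 0" using assms by (simp add: bounded_vector_measure_def)
  show "(\<lambda>n. \<mu> (F n) $ i) sums \<mu> (\<Union>n. F n) $ i" if "range F \<subseteq> sets M" "disjoint_family F" for F :: "nat \<Rightarrow> 'a set"
  proof -
    have "(\<lambda>n. \<mu> (F n)) sums \<mu> (\<Union>n. F n)"
      using assms that by (simp add: bounded_vector_measure_def)
    then show ?thesis by (rule bounded_linear.sums[OF bounded_linear_vec_nth])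
  qed
  show "\<exists>K. \<forall>E\<in>sets M. \<bar>\<mu> E $ i\<bar> \<le> K"
  proof (intro exI ballI)
    fix E assume "E \<in> sets M"
    from norm_le_total_variation[OF this, of \<mu>] assms have "norm (\<mu> E) \<le> enn2real (total_variation M \<mu>)"
      using enn2real_mono[of "ennreal (norm (\<mu> E))" "total_variation M \<mu>"]
      by (simp add: bounded_vector_measure_def)
    then show "\<bar>\<mu> E $ i\<bar> \<le> enn2real (total_variation M \<mu>)"
      using component_le_norm_cart[of "\<mu> E" i] by simp
  qed
qed

lemma sum_norm_le_total_mass:
  fixes \<mu> :: "'a set \<Rightarrow> 'b::real_normed_vector" and E :: "nat \<Rightarrow> 'a set"
  assumes \<mu>: "bounded_vector_measure M \<mu>"
    and E: "\<And>k. E k \<in> sets M" "disjoint_family E" "(\<Union>k<m. E k) = space M"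
  shows "(\<Sum>k<m. norm (\<mu> (E k))) \<le> total_mass M \<mu>"
proof -
  define I where "I = {k. k < m \<and> E k \<noteq> {}}"
  have inj: "inj_on E I"
    using E(2) by (auto simp: inj_on_def I_def disjoint_family_on_def)
  have P: "finite (E ` I)" "E ` I \<subseteq> sets M" "partition_on (space M) (E ` I)"
  proof -
    show "finite (E ` I)" "E ` I \<subseteq> sets M" using E(1) by (auto simp: I_def)
    show "partition_on (space M) (E ` I)"
    proof (rule partition_onI)
      show "\<Union> (E ` I) = space M" unfolding E(3)[symmetric] by (auto simp: I_def)
      fix p q assume "p \<in> E ` I" "q \<in> E ` I" "p \<noteq> q"
      then obtain a b where "p = E a" "q = E b" "a \<noteq> b" by blast
      then show "disjnt p q" using disjoint_family_onD[OF E(2), of a b] by (simp add: disjnt_def)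
    qed (auto simp: I_def)
  qed
  have "(\<Sum>k<m. norm (\<mu> (E k))) = (\<Sum>k\<in>I. norm (\<mu> (E k)))"
    using \<mu> by (intro sum.mono_neutral_right) (auto simp: I_def bounded_vector_measure_def)
  also have "\<dots> = (\<Sum>F\<in>E ` I. norm (\<mu> F))" by (simp add: sum.reindex[OF inj])
  finally have "ennreal (\<Sum>k<m. norm (\<mu> (E k))) = (\<Sum>F\<in>E ` I. ennreal (norm (\<mu> F)))" by simp
  also have "\<dots> \<le> total_variation M \<mu>" unfolding total_variation_def using P by (intro SUP_upper) auto
  finally have "ennreal (\<Sum>k<m. norm (\<mu> (E k))) \<le> total_variation M \<mu>" .
  then have "enn2real (ennreal (\<Sum>k<m. norm (\<mu> (E k)))) \<le> enn2real (total_variation M \<mu>)"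
    using \<mu> by (intro enn2real_mono) (auto simp: bounded_vector_measure_def)
  then show ?thesis by (simp add: total_mass_def sum_nonneg)
qed

lemma integral_approx_finite_measure:
  fixes f s :: "'a \<Rightarrow> real"
  assumes "finite_measure N" and int: "integrable N f" "integrable N s"
    and le: "\<And>x. x \<in> space N \<Longrightarrow> \<bar>f x - s x\<bar> \<le> \<delta>"
  shows "\<bar>(\<integral>x. f x \<partial>N) - (\<integral>x. s x \<partial>N)\<bar> \<le> \<delta> * measure N (space N)"
proof -
  interpret finite_measure N by fact
  have "\<bar>(\<integral>x. f x \<partial>N) - (\<integral>x. s x \<partial>N)\<bar> = \<bar>\<integral>x. f x - s x \<partial>N\<bar>" using int by simp
  also have "\<dots> \<le> (\<integral>x. \<bar>f x - s x\<bar> \<partial>N)" by (rule integral_abs_bound)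
  also have "\<dots> \<le> (\<integral>x. \<delta> \<partial>N)" by (rule integral_mono) (use int le in auto)
  finally show ?thesis by (simp add: mult.commute)
qed

text \<open>Approximate \<open>\<psi>\<close> by a function with finitely many vector values. On
  each cell Cauchy-Schwarz is applied to whole vectors, so the Euclidean total mass appears with
  constant 1; estimating each component separately would lose a factor depending on the
  dimension.\<close>

lemma abs_vector_integral_le:
  fixes \<mu> :: "'a set \<Rightarrow> real^'n::finite"
  assumes \<mu>: "bounded_vector_measure M \<mu>" and \<psi>: "\<psi> \<in> borel_measurable M"
    and C: "\<And>x. x \<in> space M \<Longrightarrow> norm (\<psi> x) \<le> C" and C0: "C \<ge> 0"
  shows "\<bar>vector_integral M \<mu> \<psi>\<bar> \<le> C * total_mass M \<mu>"
proof -
  let ?P = "\<lambda>i. upper_variation M (\<lambda>E. \<mu> E $ i)" and ?N = "\<lambda>i. upper_variation M (\<lambda>E. - (\<mu> E $ i))"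
  note sm = bounded_vector_measure_component[OF \<mu>]
  note sm' = bounded_signed_measure_minus[OF sm]
  define V where "V = (\<Sum>i\<in>UNIV. measure (?P i) (space M) + measure (?N i) (space M))"
  have V0: "V \<ge> 0" by (simp add: V_def sum_nonneg)
  have "\<bar>vector_integral M \<mu> \<psi>\<bar> \<le> C * total_mass M \<mu> + \<delta> * V" if \<delta>: "\<delta> > 0" for \<delta>
  proof -
    \<comment> \<open>The values of the step function form a finite \<open>\<delta>\<close>-net of
      the ball, chosen inside it so that their norms are still at most \<open>C\<close>.\<close>
    obtain K where K: "finite K" "K \<subseteq> cball (0::real^'n) C" "cball 0 C \<subseteq> (\<Union>c\<in>K. ball c \<delta>)"
    proof (rule compactE_image[of "cball (0::real^'n) C" "cball 0 C" "\<lambda>c. ball c \<delta>"])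
      show "cball 0 C \<subseteq> (\<Union>c\<in>cball (0::real^'n) C. ball c \<delta>)" using \<delta> by force
    qed auto
    obtain c m where c: "K = c ` {i::nat. i < m}" using finite_imp_nat_seg_image_inj_on[OF K(1)] by metis
    \<comment> \<open>The preimages of the small balls are made disjoint. From index
      \<open>m\<close> on the cells are empty, so this sequence is in effect a finite
      partition.\<close>
    define E where "E = disjointed (\<lambda>k. if k < m then \<psi> -` ball (c k) \<delta> \<inter> space M else {})"
    have Em: "E k \<in> sets M" for k
    proof -
      have "range (\<lambda>k. if k < m then \<psi> -` ball (c k) \<delta> \<inter> space M else {}) \<subseteq> sets M"
        using measurable_sets[OF \<psi>, of "ball _ \<delta>"] by auto
      from sets.range_disjointed_sets[OF this] show ?thesis by (auto simp: E_def)
    qed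
    have Ed: "disjoint_family E" unfolding E_def by (rule disjoint_family_disjointed)
    have Esub: "E k \<subseteq> \<psi> -` ball (c k) \<delta> \<inter> space M" if "k < m" for k
      using disjointed_subset[of "\<lambda>k. if k < m then \<psi> -` ball (c k) \<delta> \<inter> space M else {}" k] that by (simp add: E_def)
    have Eempty: "E k = {}" if "\<not> k < m" for k
      using disjointed_subset[of "\<lambda>k. if k < m then \<psi> -` ball (c k) \<delta> \<inter> space M else {}" k] that by (simp add: E_def)
    have EU: "(\<Union>k<m. E k) = space M"
    proof
      show "(\<Union>k<m. E k) \<subseteq> space M" using Esub by blast
      show "space M \<subseteq> (\<Union>k<m. E k)"
      proof
        fix x assume x: "x \<in> space M"
        then have "\<psi> x \<in> cball 0 C" using C by simp
        then obtain k where k: "k < m" "\<psi> x \<in> ball (c k) \<delta>" using K(3) c by auto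
        then have "x \<in> (\<Union>k. if k < m then \<psi> -` ball (c k) \<delta> \<inter> space M else {})" using x by auto
        then have "x \<in> (\<Union>k. E k)" unfolding E_def UN_disjointed_eq .
        then obtain k where "x \<in> E k" by blast
        with Eempty show "x \<in> (\<Union>k<m. E k)" by (cases "k < m") auto
      qed
    qed
    define s where "s i x = (\<Sum>k<m. c k $ i * indicator (E k) x)" for i x
    have s_eq: "s i x = c k $ i" if "x \<in> E k" "k < m" for i k x
    proof -
      have "x \<notin> E j" if "j \<noteq> k" for j using Ed that \<open>x \<in> E k\<close> by (auto simp: disjoint_family_on_def)
      then have "s i x = (\<Sum>j<m. if j = k then c k $ i else 0)"
        unfolding s_def using \<open>x \<in> E k\<close> by (intro sum.cong) auto
      then show ?thesis using that by simp
    qed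
    have close: "\<bar>\<psi> x $ i - s i x\<bar> \<le> \<delta>" if "x \<in> space M" for i x
    proof -
      have "x \<in> (\<Union>k<m. E k)" unfolding EU by (rule that)
      then obtain k where k: "k < m" "x \<in> E k" by auto
      have "norm (\<psi> x - c k) \<le> \<delta>" using Esub[OF k(1)] k(2) by (auto simp: dist_norm norm_minus_commute less_imp_le)
      then show ?thesis using component_le_norm_cart[of "\<psi> x - c k" i] by (simp add: s_eq[OF k(2,1)])
    qed
    have est: "\<bar>(\<integral>x. \<psi> x $ i \<partial>N) - (\<Sum>k<m. c k $ i * measure N (E k))\<bar> \<le> \<delta> * measure N (space M)"
      if N: "finite_measure N" "sets N = sets M" for N i
    proof -
      interpret finite_measure N by (rule N)
      have sp: "space N = space M" using N(2) by (rule sets_eq_imp_space_eq)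
      have "\<psi> \<in> borel_measurable N"
        unfolding measurable_cong_sets[OF N(2) refl, of borel] by (rule \<psi>)
      moreover have "(\<lambda>v::real^'n. v $ i) \<in> borel_measurable borel"
        by (intro borel_measurable_continuous_onI continuous_on_component continuous_on_id)
      ultimately have "(\<lambda>x. \<psi> x $ i) \<in> borel_measurable N" by (rule measurable_compose)
      moreover have "norm (\<psi> x $ i) \<le> C" if "x \<in> space N" for x
        using C[of x] that sp component_le_norm_cart[of "\<psi> x" i] by simp
      ultimately have i1: "integrable N (\<lambda>x. \<psi> x $ i)"
        by (intro integrable_const_bound[of _ C]) (auto intro!: AE_I2)
      have i2: "integrable N (s i)"
        unfolding s_def using Em N(2) by (intro Bochner_Integration.integrable_sum integrable_mult_right integrable_real_indicator) (auto simp: less_top[symmetric])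
      have "(\<integral>x. s i x \<partial>N) = (\<Sum>k<m. c k $ i * measure N (E k))"
        unfolding s_def using Em N(2) sets.sets_into_space[OF Em]
        by (subst Bochner_Integration.integral_sum) (auto simp: less_top[symmetric] sp Int_absorb2 intro!: integrable_real_indicator)
      then show ?thesis
        using integral_approx_finite_measure[OF N(1) i1 i2, of \<delta>] close sp by simp
    qed
    \<comment> \<open>The integral of the step function, written with the vector values of
      \<open>\<mu>\<close>. The finite Jordan parts of the components bound the error of this
      replacement by \<open>\<delta> * V\<close>.\<close>
    define T where "T = (\<Sum>k<m. c k \<bullet> \<mu> (E k))"
    have T_eq: "T = (\<Sum>i\<in>UNIV. (\<Sum>k<m. c k $ i * measure (?P i) (E k)) - (\<Sum>k<m. c k $ i * measure (?N i) (E k)))"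
    proof -
      have "T = (\<Sum>k<m. \<Sum>i\<in>UNIV. c k $ i * \<mu> (E k) $ i)" by (simp add: T_def inner_vec_def)
      also have "\<dots> = (\<Sum>i\<in>UNIV. \<Sum>k<m. c k $ i * \<mu> (E k) $ i)" by (rule sum.swap)
      also have "\<dots> = (\<Sum>i\<in>UNIV. \<Sum>k<m. c k $ i * measure (?P i) (E k) - c k $ i * measure (?N i) (E k))"
        by (intro sum.cong refl) (simp add: jordan_decomposition[OF sm Em] right_diff_distrib)
      finally show ?thesis by (simp add: sum_subtractf)
    qed
    have "\<bar>vector_integral M \<mu> \<psi> - T\<bar> \<le> (\<Sum>i\<in>UNIV. \<delta> * measure (?P i) (space M) + \<delta> * measure (?N i) (space M))"
      unfolding vector_integral_def signed_integral_def T_eq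
        sum_subtractf[of "\<lambda>i. (\<integral>x. \<psi> x $ i \<partial>?P i) - (\<integral>x. \<psi> x $ i \<partial>?N i)", symmetric]
    proof (rule order_trans[OF sum_abs sum_mono])
      fix i
      have "\<bar>(\<integral>x. \<psi> x $ i \<partial>?P i) - (\<Sum>k<m. c k $ i * measure (?P i) (E k))\<bar> \<le> \<delta> * measure (?P i) (space M)"
        by (rule est) (use finite_upper_variation[OF sm] sets_upper_variation[OF sm] in auto)
      moreover have "\<bar>(\<integral>x. \<psi> x $ i \<partial>?N i) - (\<Sum>k<m. c k $ i * measure (?N i) (E k))\<bar> \<le> \<delta> * measure (?N i) (space M)"
        by (rule est) (use finite_upper_variation[OF sm'] sets_upper_variation[OF sm'] in auto)
      ultimately show "\<bar>(\<integral>x. \<psi> x $ i \<partial>?P i) - (\<integral>x. \<psi> x $ i \<partial>?N i) - ((\<Sum>k<m. c k $ i * measure (?P i) (E k)) - (\<Sum>k<m. c k $ i * measure (?N i) (E k)))\<bar>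
          \<le> \<delta> * measure (?P i) (space M) + \<delta> * measure (?N i) (space M)" by linarith
    qed
    also have "\<dots> = \<delta> * V" by (simp add: V_def sum_distrib_left distrib_left)
    finally have 1: "\<bar>vector_integral M \<mu> \<psi> - T\<bar> \<le> \<delta> * V" .
    have "\<bar>T\<bar> \<le> (\<Sum>k<m. C * norm (\<mu> (E k)))"
      unfolding T_def
    proof (rule order_trans[OF sum_abs sum_mono])
      fix k assume "k \<in> {..<m}"
      then have "norm (c k) \<le> C" using K(2) c by auto
      then show "\<bar>c k \<bullet> \<mu> (E k)\<bar> \<le> C * norm (\<mu> (E k))"
        by (meson Cauchy_Schwarz_ineq2 mult_right_mono norm_ge_zero order_trans)
    qed
    also have "\<dots> = C * (\<Sum>k<m. norm (\<mu> (E k)))" by (simp add: sum_distrib_left)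
    also have "\<dots> \<le> C * total_mass M \<mu>"
      by (intro mult_left_mono sum_norm_le_total_mass[OF \<mu> Em Ed EU] C0)
    finally show ?thesis using 1 by linarith
  qed
  note b = this
  show ?thesis
  proof (rule field_le_epsilon)
    fix e :: real assume e: "e > 0"
    have "\<bar>vector_integral M \<mu> \<psi>\<bar> \<le> C * total_mass M \<mu> + (e / (V + 1)) * V"
      using e V0 by (intro b) auto
    also have "(e / (V + 1)) * V \<le> e" using e V0 by (simp add: divide_simps)
    finally show "\<bar>vector_integral M \<mu> \<psi>\<bar> \<le> C * total_mass M \<mu> + e" by simp
  qed
qed


lemma trace_integral_le:
  fixes \<Omega> :: "(real^'n::finite) set"
  assumes \<mu>: "bounded_vector_measure (borel_on \<Omega>) \<mu>" and \<nu>: "bounded_vector_measure (borel_on (frontier \<Omega>)) \<nu>"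
    and tr: "has_normal_trace \<Omega> A \<mu> \<nu>"
    and \<psi>: "smooth_on UNIV \<psi>" "\<And>x. norm (\<psi> x) \<le> 1"
  shows "(\<integral>x. trace (A x ** grad \<psi> x) \<partial>lebesgue_on \<Omega>)
      \<le> total_mass (borel_on (frontier \<Omega>)) \<nu> + total_mass (borel_on \<Omega>) \<mu>"
proof -
  have "Ck_on 0 UNIV \<psi>" using \<psi>(1) unfolding smooth_on_def by blast
  then have "\<psi> \<in> borel_measurable borel" by (intro borel_measurable_continuous_onI) simp
  then have m: "\<psi> \<in> borel_measurable (borel_on S)" for S by (rule measurable_restrict_space1)
  have "vector_integral (borel_on (frontier \<Omega>)) \<nu> \<psi>
      = (\<integral>x. trace (A x ** grad \<psi> x) \<partial>lebesgue_on \<Omega>) + vector_integral (borel_on \<Omega>) \<mu> \<psi>"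
    using tr \<psi>(1) by (simp add: has_normal_trace_def)
  moreover have "\<bar>vector_integral (borel_on (frontier \<Omega>)) \<nu> \<psi>\<bar> \<le> 1 * total_mass (borel_on (frontier \<Omega>)) \<nu>"
    by (rule abs_vector_integral_le[OF \<nu> m \<psi>(2)]) simp
  moreover have "\<bar>vector_integral (borel_on \<Omega>) \<mu> \<psi>\<bar> \<le> 1 * total_mass (borel_on \<Omega>) \<mu>"
    by (rule abs_vector_integral_le[OF \<mu> m \<psi>(2)]) simp
  ultimately show ?thesis by linarith
qed

section \<open>Lower bound for the mollified Hessian\<close>

text \<open>Average against the centred Gaussian with covariance \<open>s\<^sup>2 B B\<^sup>T\<close>; up to \<open>o(s\<^sup>2)\<close> it adds
  \<open>s\<^sup>2/2 Tr (B B\<^sup>T D\<^sup>2U)\<close>.\<close>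

definition aheat :: "(real^'n::finite \<Rightarrow> real) \<Rightarrow> real^'n^'n \<Rightarrow> real \<Rightarrow> real^'n \<Rightarrow> real" where
  "aheat U B s x = (\<integral>z. U (x + s *\<^sub>R (B *v z)) * gdens z \<partial>lborel)"

lemma lipschitz_compose_matrix:
  fixes U :: "real^'n::finite \<Rightarrow> real"
  assumes lip: "L-lipschitz_on UNIV U"
  shows "(L * onorm (\<lambda>v. B *v v))-lipschitz_on UNIV (\<lambda>z. U (x + B *v z))"
proof (rule lipschitz_onI)
  have bl: "bounded_linear (\<lambda>v. B *v v)" by simp
  show "0 \<le> L * onorm (\<lambda>v. B *v v)" using lipschitz_on_nonneg[OF lip] onorm_pos_le[OF bl] by simp
  fix y z
  have "dist (U (x + B *v y)) (U (x + B *v z)) \<le> L * norm (B *v (y - z))"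
    using lipschitz_onD[OF lip, of "x + B *v y" "x + B *v z"]
    by (simp add: dist_norm matrix_vector_mult_diff_distrib)
  also have "\<dots> \<le> L * (onorm (\<lambda>v. B *v v) * norm (y - z))"
    using onorm[OF bl] lipschitz_on_nonneg[OF lip] by (intro mult_left_mono) auto
  finally show "dist (U (x + B *v y)) (U (x + B *v z)) \<le> L * onorm (\<lambda>v. B *v v) * dist y z"
    by (simp add: dist_norm)
qed

lemma aheat_eq_heat: "aheat U B s x = heat (\<lambda>z. U (x + B *v z)) s 0"
  by (simp add: aheat_def heat_def matrix_vector_mult_scaleR)

lemma aheat_integrable:
  fixes U :: "real^'n::finite \<Rightarrow> real"
  assumes lip: "L-lipschitz_on UNIV U"
  shows "integrable lborel (\<lambda>z. U (x + s *\<^sub>R (B *v z)) * gdens z)"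
  using heat_integrable[OF lipschitz_exp_growth[OF lipschitz_compose_matrix[OF lip, of B x]], of 0 s]
  by (simp add: matrix_vector_mult_scaleR)

lemma aheat_ge_self:
  fixes U :: "real^'n::finite \<Rightarrow> real"
  assumes lip: "L-lipschitz_on UNIV U" and mid: "\<And>x h. 2 * U x \<le> U (x + h) + U (x - h)"
  shows "U x \<le> aheat U B s x"
proof -
  have "2 * U (x + B *v z) \<le> U (x + B *v (z + h)) + U (x + B *v (z - h))" for z h
    using mid[of "x + B *v z" "B *v h"]
    by (simp add: matrix_vector_right_distrib matrix_vector_mult_diff_distrib algebra_simps)
  from heat_ge_self[OF lipschitz_exp_growth[OF lipschitz_compose_matrix[OF lip, of B x]] this, of 0 s]
  show ?thesis by (simp add: aheat_eq_heat)
qed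

text \<open>Apply \<open>heat_lower_bound\<close> to \<open>W z = U (x1 + B *v z)\<close>. The
  determinant enters once through the domain and once through the slopes, which are mapped by
  \<open>transpose B\<close>; hence the square. \<open>T\<close> does not depend on
  \<open>x1\<close>, because the bound is integrated over base points later.\<close>

lemma aheat_lower_bound:
  fixes U :: "real^'n::finite \<Rightarrow> real" and q \<eta> :: real
  assumes mid: "\<And>x h. 2 * U x \<le> U (x + h) + U (x - h)"
    and lip: "L-lipschitz_on UNIV U" and q: "q > 0" and r: "r > 0" and \<eta>: "\<eta> > 0" and B: "det B \<noteq> 0"
    and \<kappa>: "\<kappa> = CARD('n) * ((\<bar>det B\<bar>\<^sup>2) powr (1 / CARD('n)) * q) / 2"
  shows "\<exists>T>0. \<forall>x1 t. (\<forall>E. compact E \<longrightarrow> E \<subseteq> ball x1 r \<longrightarrow> q ^ CARD('n) * measure lebesgue E \<le> measure lebesgue (subdiff U E))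
     \<longrightarrow> 0 < t \<longrightarrow> t \<le> T \<longrightarrow> U x1 + t * (\<kappa> - \<eta>) \<le> aheat U B (sqrt t) x1"
proof -
  let ?d = "CARD('n)"
  define K where "K = onorm (\<lambda>v. B *v v)"
  have bl: "bounded_linear (\<lambda>v. B *v v)" by simp
  have K0: "K \<ge> 0" unfolding K_def by (rule onorm_pos_le[OF bl])
  define r' where "r' = r / (K + 1)"
  have r': "r' > 0" using r K0 by (simp add: r'_def)
  define q' where "q' = (\<bar>det B\<bar>\<^sup>2) powr (1 / ?d) * q"
  have q': "q' > 0" using q B by (simp add: q'_def)
  have q'd: "q' ^ ?d = \<bar>det B\<bar>\<^sup>2 * q ^ ?d"
  proof -
    have "((\<bar>det B\<bar>\<^sup>2) powr (1 / ?d)) ^ ?d = \<bar>det B\<bar>\<^sup>2"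
      using B by (simp add: powr_powr flip: powr_realpow)
    then show ?thesis by (simp add: q'_def power_mult_distrib)
  qed
  have \<kappa>': "\<kappa> = ?d * q' / 2" by (simp add: \<kappa> q'_def)
  define T where "T = \<eta> * r'\<^sup>2 / (2 * ?d * \<kappa>)"
  have T: "T > 0" using \<eta> r' q' by (simp add: T_def \<kappa>')
  have "U x1 + t * (\<kappa> - \<eta>) \<le> aheat U B (sqrt t) x1"
    if MA: "\<And>E. compact E \<Longrightarrow> E \<subseteq> ball x1 r \<Longrightarrow> q ^ ?d * measure lebesgue E \<le> measure lebesgue (subdiff U E)"
      and t: "0 < t" "t \<le> T" for x1 t
  proof -
    define W where "W z = U (x1 + B *v z)" for z
    have lipW: "(L * K)-lipschitz_on UNIV W" unfolding W_def K_def by (rule lipschitz_compose_matrix[OF lip])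
    have midW: "2 * W z \<le> W (z + h) + W (z - h)" for z h
      using mid[of "x1 + B *v z" "B *v h"]
      by (simp add: W_def matrix_vector_right_distrib matrix_vector_mult_diff_distrib algebra_simps)
    have MAW: "q' ^ ?d * measure lebesgue E \<le> measure lebesgue (subdiff W E)" if E: "compact E" "E \<subseteq> ball 0 r'" for E
    proof -
      define F where "F = (\<lambda>z. x1 + B *v z) ` E"
      have cF: "compact F" unfolding F_def
        by (intro compact_continuous_image continuous_intros E linear_continuous_on) simp
      have Fb: "F \<subseteq> ball x1 r"
      proof
        fix y assume "y \<in> F"
        then obtain z where z: "z \<in> E" "y = x1 + B *v z" by (auto simp: F_def)
        have "norm (B *v z) \<le> K * norm z" unfolding K_def by (rule onorm[OF bl])
        also have "\<dots> \<le> K * r'" using z E K0 by (intro mult_left_mono) auto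
        also have "\<dots> < r" using r K0 by (simp add: r'_def divide_simps)
        finally show "y \<in> ball x1 r" using z by (simp add: dist_norm)
      qed
      have mF: "measure lebesgue F = \<bar>det B\<bar> * measure lebesgue E"
      proof -
        have "F = (+) x1 ` ((\<lambda>z. B *v z) ` E)" by (auto simp: F_def)
        then have "measure lebesgue F = measure lebesgue ((\<lambda>z. B *v z) ` E)" by (simp add: measure_translation)
        also have "\<dots> = \<bar>det (matrix (\<lambda>z. B *v z))\<bar> * measure lebesgue E"
          by (rule measure_linear_image_finite(2)) (auto intro: lmeasurable_compact E)
        finally show ?thesis by simp
      qed
      have sub: "(\<lambda>p. transpose B *v p) ` subdiff U F \<subseteq> subdiff W E"
      proof
        fix w assume "w \<in> (\<lambda>p. transpose B *v p) ` subdiff U F"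
        then obtain p z where w: "w = transpose B *v p" and z: "z \<in> E"
          and p: "\<And>y. U (x1 + B *v z) + p \<bullet> (y - (x1 + B *v z)) \<le> U y"
          by (auto simp: subdiff_def F_def)
        have "W z + w \<bullet> (y - z) \<le> W y" for y
        proof -
          have "w \<bullet> (y - z) = p \<bullet> (B *v (y - z))" by (simp add: w dot_lmul_matrix transpose_matrix_vector)
          then show ?thesis using p[of "x1 + B *v y"] by (simp add: W_def matrix_vector_mult_diff_distrib)
        qed
        with z show "w \<in> subdiff W E" by (auto simp: subdiff_def)
      qed
      have sU: "subdiff U F \<in> lmeasurable" by (rule lmeasurable_compact[OF compact_subdiff[OF lip cF]])
      have sW: "subdiff W E \<in> lmeasurable" by (rule lmeasurable_compact[OF compact_subdiff[OF lipW E(1)]])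
      have lin: "linear (\<lambda>p. transpose B *v p)" by (rule matrix_vector_mul_linear)
      have "q' ^ ?d * measure lebesgue E = \<bar>det B\<bar> * (q ^ ?d * measure lebesgue F)"
        by (simp add: q'd mF power2_eq_square)
      also have "\<dots> \<le> \<bar>det B\<bar> * measure lebesgue (subdiff U F)"
        by (intro mult_left_mono MA cF Fb) simp
      also have "\<dots> = measure lebesgue ((\<lambda>p. transpose B *v p) ` subdiff U F)"
        using measure_linear_image_finite(2)[OF lin sU]
        by (simp only: matrix_of_matrix_vector_mul det_transpose)
      also have "\<dots> \<le> measure lebesgue (subdiff W E)"
        using sub sW measure_linear_image_finite(1)[OF lin sU]
        by (intro measure_mono_fmeasurable) (auto intro: fmeasurableD)
      finally show ?thesis .
    qed
    have "W 0 + t * (\<kappa> - \<eta>) \<le> heat W (sqrt t) 0"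
      by (rule heat_lower_bound[OF midW lipW q' r' \<eta> MAW \<kappa>' t(1)]) (use t(2) in \<open>auto simp: T_def\<close>)
    then show ?thesis by (simp add: aheat_eq_heat W_def[abs_def])
  qed
  with T show ?thesis by blast
qed

section \<open>Second-order expansion of the anisotropic average\<close>

lemma second_difference_limit:
  fixes V :: "real^'n::finite \<Rightarrow> real"
  assumes V: "\<And>x. (V has_derivative (\<lambda>v. p x \<bullet> v)) (at x)"
    and p: "(p has_derivative (\<lambda>v. H *v v)) (at x)"
  shows "((\<lambda>s. (V (x + s *\<^sub>R v) + V (x - s *\<^sub>R v) - 2 * V x) / s\<^sup>2) \<longlongrightarrow> v \<bullet> (H *v v)) (at_right 0)"
proof -
  define f where "f s = V (x + s *\<^sub>R v) + V (x + s *\<^sub>R (- v)) - 2 * V x" for s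
  define f' where "f' s = p (x + s *\<^sub>R v) \<bullet> v + p (x + s *\<^sub>R (- v)) \<bullet> (- v)" for s
  have df: "(f has_real_derivative f' s) (at s)" for s
    proof -
      have "(f has_real_derivative (f' s - 0)) (at s)"
        unfolding f_def[abs_def] f'_def by (intro DERIV_diff DERIV_add has_real_derivative_along_line V DERIV_const)
      then show ?thesis by simp
    qed
  have "((\<lambda>s. f' s) has_real_derivative (H *v v) \<bullet> v + (H *v (- v)) \<bullet> (- v)) (at 0)"
    unfolding f'_def[abs_def] by (intro DERIV_add inner_has_real_derivative_along_line p)
  moreover have "(H *v v) \<bullet> v + (H *v (- v)) \<bullet> (- v) = 2 * (v \<bullet> (H *v v))"
    by (simp add: inner_commute vec.neg)
  moreover have "f' 0 = 0" by (simp add: f'_def)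
  ultimately have "((\<lambda>s. f' s / s) \<longlongrightarrow> 2 * (v \<bullet> (H *v v))) (at 0)"
    by (simp add: has_field_derivative_iff)
  then have "((\<lambda>s. f' s / s / 2) \<longlongrightarrow> 2 * (v \<bullet> (H *v v)) / 2) (at_right 0)"
    by (intro tendsto_divide tendsto_const) (auto intro: tendsto_mono[OF at_le])
  then have lim: "((\<lambda>s. f' s / (2 * s)) \<longlongrightarrow> v \<bullet> (H *v v)) (at_right 0)"
    by (simp add: mult.commute)
  have "((\<lambda>s. f s / s\<^sup>2) \<longlongrightarrow> v \<bullet> (H *v v)) (at_right 0)"
  proof (rule lhopital_right_0[where f'=f' and g'="\<lambda>s. 2 * s"])
    have "isCont f 0" using df by (rule DERIV_isCont)
    then show "(f \<longlongrightarrow> 0) (at_right 0)"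
      unfolding isCont_def by (auto simp: f_def intro: tendsto_mono[OF at_le])
    show "((\<lambda>s::real. s\<^sup>2) \<longlongrightarrow> 0) (at_right 0)" by (auto intro!: tendsto_eq_intros)
    show "\<forall>\<^sub>F s::real in at_right 0. s\<^sup>2 \<noteq> 0" by (auto simp: eventually_at_filter)
    show "\<forall>\<^sub>F s::real in at_right 0. 2 * s \<noteq> 0" by (auto simp: eventually_at_filter)
    show "\<forall>\<^sub>F s in at_right 0. (f has_real_derivative f' s) (at s)" using df by simp
    show "\<forall>\<^sub>F s::real in at_right 0. ((\<lambda>s. s\<^sup>2) has_real_derivative 2 * s) (at s)"
      by (intro always_eventually allI) (auto intro!: derivative_eq_intros)
  qed (rule lim)
  then show ?thesis by (simp add: f_def)
qed

text \<open>For \<open>norm h \<le> 1\<close> the gradient is Lipschitz on a compact ball; for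
  larger \<open>h\<close> the linear growth of a Lipschitz function lies below a quadratic one. This
  global bound supplies the majorant in \<open>aheat_second_order\<close>.\<close>

lemma second_difference_le:
  fixes V :: "real^'n::finite \<Rightarrow> real"
  assumes V: "\<And>x. (V has_derivative (\<lambda>v. p x \<bullet> v)) (at x)"
    and p: "\<And>x. (p has_derivative (\<lambda>v. H x *v v)) (at x)"
    and H: "continuous_on UNIV H" and lip: "L-lipschitz_on UNIV V"
  shows "\<exists>C\<ge>0. \<forall>h. \<bar>V (x + h) + V (x - h) - 2 * V x\<bar> \<le> C * (norm h)\<^sup>2"
proof -
  have "compact (H ` cball x 1)" by (intro compact_continuous_image continuous_on_subset[OF H]) auto
  then obtain M where M: "\<And>y. y \<in> cball x 1 \<Longrightarrow> norm (H y) \<le> M"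
    using compact_imp_bounded bounded_iff by (metis imageI)
  have M0: "M \<ge> 0" using M[of x] norm_ge_zero[of "H x"] by (simp del: norm_ge_zero)
  define N where "N = M * real CARD('n) * real CARD('n)"
  have N0: "N \<ge> 0" using M0 by (simp add: N_def)
  have on: "onorm (\<lambda>v. H y *v v) \<le> N" if "y \<in> cball x 1" for y
  proof (rule order_trans[OF onorm_le_matrix_component[where B=M]])
    show "\<bar>H y $ i $ j\<bar> \<le> M" for i j
      using component_le_norm_cart[of "H y $ i" j] Finite_Cartesian_Product.norm_nth_le[of "H y" i] M[OF that] by simp
  qed (simp add: N_def mult.commute)
  have plip: "norm (p y - p z) \<le> N * norm (y - z)" if "y \<in> cball x 1" "z \<in> cball x 1" for y z
    by (rule differentiable_bound[of "cball x 1" p "\<lambda>y v. H y *v v"])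
       (use that p on in \<open>auto intro: has_derivative_at_withinI\<close>)
  define C where "C = 2 * N + 2 * L"
  have L0: "L \<ge> 0" by (rule lipschitz_on_nonneg[OF lip])
  have "\<bar>V (x + h) + V (x - h) - 2 * V x\<bar> \<le> C * (norm h)\<^sup>2" for h
  proof (cases "norm h \<le> 1")
    case True
    define f where "f s = V (x + s *\<^sub>R h) + V (x + s *\<^sub>R (- h)) - 2 * V x" for s
    define f' where "f' s = p (x + s *\<^sub>R h) \<bullet> h + p (x + s *\<^sub>R (- h)) \<bullet> (- h)" for s
    have df: "(f has_real_derivative f' s) (at s)" for s
      proof -
      have "(f has_real_derivative (f' s - 0)) (at s)"
        unfolding f_def[abs_def] f'_def by (intro DERIV_diff DERIV_add has_real_derivative_along_line V DERIV_const)
      then show ?thesis by simp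
    qed
    obtain z where z: "0 < z" "z < 1" "f 1 - f 0 = (1 - 0) * f' z"
      using MVT2[of 0 1 f f'] df by auto
    have "norm (z *\<^sub>R h) \<le> 1" using True z mult_le_one[of z "norm h"] by simp
    then have in1: "x + z *\<^sub>R h \<in> cball x 1" "x - z *\<^sub>R h \<in> cball x 1" by (simp_all add: dist_norm)
    have "f' z = (p (x + z *\<^sub>R h) - p (x - z *\<^sub>R h)) \<bullet> h" by (simp add: f'_def inner_diff_left)
    then have "\<bar>f' z\<bar> \<le> norm (p (x + z *\<^sub>R h) - p (x - z *\<^sub>R h)) * norm h" by (simp add: Cauchy_Schwarz_ineq2)
    also have "\<dots> \<le> (N * norm ((2 * z) *\<^sub>R h)) * norm h"
      using plip[OF in1] by (intro mult_right_mono) (auto simp: algebra_simps scaleR_2 scaleR_scaleR[symmetric] simp del: scaleR_scaleR)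
    also have "\<dots> = (2 * N * z) * (norm h)\<^sup>2" using z by (simp add: power2_eq_square)
    also have "\<dots> \<le> C * (norm h)\<^sup>2"
    proof (rule mult_right_mono)
      have "2 * N * z \<le> 2 * N * 1" using z N0 by (intro mult_left_mono) auto
      then show "2 * N * z \<le> C" using L0 by (simp add: C_def)
    qed simp
    finally show ?thesis using z(3) by (simp add: f_def)
  next
    case False
    have 1: "\<bar>V (x + h) - V x\<bar> \<le> L * norm h" using lipschitz_onD[OF lip, of "x + h" x] by (simp add: dist_norm)
    have 2: "\<bar>V (x - h) - V x\<bar> \<le> L * norm h" using lipschitz_onD[OF lip, of "x - h" x] by (simp add: dist_norm)
    have "\<bar>V (x + h) + V (x - h) - 2 * V x\<bar> \<le> 2 * L * norm h" using 1 2 by linarith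
    also have "\<dots> \<le> C * (norm h)\<^sup>2"
    proof -
      have "norm h \<le> (norm h)\<^sup>2"
        using False mult_right_mono[of 1 "norm h" "norm h"] by (simp add: power2_eq_square)
      then have "2 * L * norm h \<le> 2 * L * (norm h)\<^sup>2" using L0 by (intro mult_left_mono) auto
      also have "\<dots> \<le> C * (norm h)\<^sup>2" using N0 by (intro mult_right_mono) (auto simp: C_def)
      finally show ?thesis .
    qed
    finally show ?thesis .
  qed
  moreover have "C \<ge> 0" using N0 L0 by (simp add: C_def)
  ultimately show ?thesis by blast
qed

text \<open>The standard Gaussian has identity covariance, so the mean of a quadratic form is the
  trace of its matrix, here permuted cyclically.\<close>

lemma gdens_quadratic:
  fixes B H :: "real^'n^'n::finite"
  shows "integrable lborel (\<lambda>z. ((B *v z) \<bullet> (H *v (B *v z))) * gdens z)"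
    and "(\<integral>z. ((B *v z) \<bullet> (H *v (B *v z))) * gdens z \<partial>lborel) = trace (B ** transpose B ** H)"
proof -
  define Q where "Q = transpose B ** H ** B"
  have q: "(B *v z) \<bullet> (H *v (B *v z)) = (\<Sum>i\<in>UNIV. \<Sum>j\<in>UNIV. Q $ i $ j * ((z \<bullet> axis i 1) * (z \<bullet> axis j 1)))" for z
  proof -
    have "(B *v z) \<bullet> (H *v (B *v z)) = z \<bullet> (Q *v z)"
    proof -
      have "Q *v z = transpose B *v (H *v (B *v z))" by (simp only: Q_def matrix_vector_mul_assoc matrix_mul_assoc)
      moreover have "z \<bullet> (transpose B *v w) = (B *v z) \<bullet> w" for w
        using dot_lmul_matrix[of z "transpose B" w] by (simp only: vector_transpose_matrix)
      ultimately show ?thesis by simp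
    qed
    also have "\<dots> = (\<Sum>i\<in>UNIV. \<Sum>j\<in>UNIV. Q $ i $ j * ((z \<bullet> axis i 1) * (z \<bullet> axis j 1)))"
      by (simp add: inner_axis) (simp add: inner_vec_def matrix_vector_mult_def sum_distrib_left ac_simps)
    finally show ?thesis .
  qed
  have i: "integrable lborel (\<lambda>z. Q $ i $ j * ((z \<bullet> axis i 1) * (z \<bullet> axis j 1) * gdens z))" for i j
    by (intro integrable_mult_right gdens_second_moment)
  have e: "((B *v z) \<bullet> (H *v (B *v z))) * gdens z = (\<Sum>i\<in>UNIV. \<Sum>j\<in>UNIV. Q $ i $ j * ((z \<bullet> axis i 1) * (z \<bullet> axis j 1) * gdens z))" for z
    by (simp add: q sum_distrib_right mult.assoc)
  show "integrable lborel (\<lambda>z. ((B *v z) \<bullet> (H *v (B *v z))) * gdens z)"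
    unfolding e by (intro Bochner_Integration.integrable_sum i)
  have "(\<integral>z. ((B *v z) \<bullet> (H *v (B *v z))) * gdens z \<partial>lborel) = (\<Sum>i\<in>UNIV. \<Sum>j\<in>UNIV. Q $ i $ j * (axis i 1 \<bullet> (axis j 1 :: real^'n)))"
    unfolding e
    by (simp add: Bochner_Integration.integral_sum Bochner_Integration.integrable_sum i gdens_second_moment)
  also have "\<dots> = trace Q" by (simp add: trace_def inner_axis_axis if_distrib cong: if_cong)
  also have "\<dots> = trace (B ** transpose B ** H)"
    unfolding Q_def by (metis matrix_mul_assoc trace_mul_sym)
  finally show "(\<integral>z. ((B *v z) \<bullet> (H *v (B *v z))) * gdens z \<partial>lborel) = trace (B ** transpose B ** H)" .
qed

text \<open>Averaging over \<open>z\<close> and \<open>- z\<close> removes the first-order term and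
  leaves second differences, whose quotients by the squared step converge and are dominated.\<close>

lemma aheat_second_order:
  fixes V :: "real^'n::finite \<Rightarrow> real"
  assumes V: "\<And>x. (V has_derivative (\<lambda>v. p x \<bullet> v)) (at x)"
    and p: "\<And>x. (p has_derivative (\<lambda>v. H x *v v)) (at x)"
    and H: "continuous_on UNIV H" and lip: "L-lipschitz_on UNIV V"
    and s: "\<And>n. s n > 0" "s \<longlonglongrightarrow> 0"
  shows "(\<lambda>n. (aheat V B (s n) x - V x) / (s n)\<^sup>2) \<longlonglongrightarrow> trace (B ** transpose B ** H x) / 2"
proof -
  obtain C where C: "C \<ge> 0" "\<And>h. \<bar>V (x + h) + V (x - h) - 2 * V x\<bar> \<le> C * (norm h)\<^sup>2"
    using second_difference_le[OF V p H lip] by blast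
  have Vm: "V \<in> borel_measurable borel"
    by (intro borel_measurable_continuous_onI lipschitz_on_continuous_on[OF lip])
  define D where "D n z = (V (x + s n *\<^sub>R (B *v z)) + V (x - s n *\<^sub>R (B *v z)) - 2 * V x) / (s n)\<^sup>2 / 2 * gdens z" for n z
  have Dint: "(\<integral>z. D n z \<partial>lborel) = (aheat V B (s n) x - V x) / (s n)\<^sup>2" for n
  proof -
    have refl: "aheat V B (- s n) x = aheat V B (s n) x"
      unfolding aheat_eq_heat
      by (rule heat_reflect[OF exp_growth_measurable[OF lipschitz_exp_growth[OF lipschitz_compose_matrix[OF lip]]]])
    have i: "integrable lborel (\<lambda>z. V (x + s n *\<^sub>R (B *v z)) * gdens z)"
      "integrable lborel (\<lambda>z. V (x + (- s n) *\<^sub>R (B *v z)) * gdens z)"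
      "integrable lborel (\<lambda>z::real^'n. (2 * V x) * gdens z)"
      by (intro aheat_integrable[OF lip] integrable_mult_right gdens_integral)+
    have "(\<integral>z. D n z \<partial>lborel) = (\<integral>z. (V (x + s n *\<^sub>R (B *v z)) * gdens z + V (x + (- s n) *\<^sub>R (B *v z)) * gdens z - (2 * V x) * gdens z) / ((s n)\<^sup>2 * 2) \<partial>lborel)"
      by (rule Bochner_Integration.integral_cong) (auto simp: D_def field_simps)
    also have "\<dots> = ((aheat V B (s n) x + aheat V B (- s n) x) - 2 * V x) / ((s n)\<^sup>2 * 2)"
      using i gdens_integral(2)[where 'a="real^'n"] by (simp add: aheat_def)
    also have "\<dots> = (aheat V B (s n) x - V x) / (s n)\<^sup>2" using s(1)[of n] unfolding refl by (simp add: field_simps)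
    finally show ?thesis .
  qed
  have "(\<lambda>n. \<integral>z. D n z \<partial>lborel) \<longlonglongrightarrow> (\<integral>z. ((B *v z) \<bullet> (H x *v (B *v z))) / 2 * gdens z \<partial>lborel)"
  \<comment> \<open>\<open>mat 1\<close> writes the squared norm of \<open>B *v z\<close> in the
    form to which \<open>gdens_quadratic\<close> applies.\<close>
  proof (rule integral_dominated_convergence[where w="\<lambda>z. C / 2 * (((B *v z) \<bullet> (mat 1 *v (B *v z))) * gdens z)"])
    have [measurable]: "(\<lambda>z. B *v z) \<in> borel_measurable borel" "(\<lambda>z. H x *v z) \<in> borel_measurable borel"
      by (intro borel_measurable_continuous_onI linear_continuous_on; simp)+
    have [measurable]: "V \<in> borel_measurable borel" by (rule Vm)
    show "(\<lambda>z. ((B *v z) \<bullet> (H x *v (B *v z))) / 2 * gdens z) \<in> borel_measurable lborel" by measurable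
    show "D n \<in> borel_measurable lborel" for n unfolding D_def[abs_def] by measurable
    show "integrable lborel (\<lambda>z. C / 2 * (((B *v z) \<bullet> (mat 1 *v (B *v z))) * gdens z))"
      by (intro integrable_mult_right gdens_quadratic)
    show "AE z in lborel. (\<lambda>n. D n z) \<longlonglongrightarrow> ((B *v z) \<bullet> (H x *v (B *v z))) / 2 * gdens z"
    proof (rule AE_I2)
      fix z
      have "filterlim s (at_right 0) sequentially"
        using s less_imp_neq[OF s(1), symmetric] by (simp add: filterlim_at)
      from filterlim_compose[OF second_difference_limit[OF V p, of x "B *v z"] this]
      show "(\<lambda>n. D n z) \<longlonglongrightarrow> ((B *v z) \<bullet> (H x *v (B *v z))) / 2 * gdens z"
        unfolding D_def by (intro tendsto_mult tendsto_divide tendsto_const) auto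
    qed
    show "AE z in lborel. norm (D n z) \<le> C / 2 * (((B *v z) \<bullet> (mat 1 *v (B *v z))) * gdens z)" for n
    proof (rule AE_I2)
      fix z
      have "\<bar>V (x + s n *\<^sub>R (B *v z)) + V (x - s n *\<^sub>R (B *v z)) - 2 * V x\<bar> \<le> C * (norm (s n *\<^sub>R (B *v z)))\<^sup>2" by (rule C(2))
      then have "\<bar>V (x + s n *\<^sub>R (B *v z)) + V (x - s n *\<^sub>R (B *v z)) - 2 * V x\<bar> / (s n)\<^sup>2 \<le> C * (norm (B *v z))\<^sup>2"
        using s(1)[of n] by (simp add: power_mult_distrib divide_simps mult.commute mult.left_commute)
      then have "\<bar>V (x + s n *\<^sub>R (B *v z)) + V (x - s n *\<^sub>R (B *v z)) - 2 * V x\<bar> / (s n)\<^sup>2 / 2 * gdens z \<le> C * (norm (B *v z))\<^sup>2 / 2 * gdens z"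
        by (intro mult_right_mono divide_right_mono) (auto intro: less_imp_le gdens_pos)
      then show "norm (D n z) \<le> C / 2 * (((B *v z) \<bullet> (mat 1 *v (B *v z))) * gdens z)"
        using gdens_pos[of z] by (simp add: D_def abs_mult dot_square_norm)
    qed
  qed
  moreover have "(\<integral>z. ((B *v z) \<bullet> (H x *v (B *v z))) / 2 * gdens z \<partial>lborel) = trace (B ** transpose B ** H x) / 2"
    using gdens_quadratic(2)[of B "H x"] by simp
  ultimately show ?thesis by (simp add: Dint)
qed

lemma heat_is_lipschitz:
  fixes U :: "'a::euclidean_space \<Rightarrow> real"
  assumes lip: "L-lipschitz_on UNIV U"
  shows "L-lipschitz_on UNIV (heat U s)"
proof (rule lipschitz_onI)
  show "dist (heat U s x) (heat U s y) \<le> L * dist x y" for x y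
    using heat_lipschitz[OF lip, of s x s y] by (simp add: dist_norm)
qed (rule lipschitz_on_nonneg[OF lip])

lemma lipschitz_abs: "L-lipschitz_on S f \<Longrightarrow> L-lipschitz_on S (\<lambda>x. \<bar>f x :: real\<bar>)"
  unfolding lipschitz_on_def dist_real_def by (meson abs_triangle_ineq3 order_trans)

text \<open>Both averages are taken over translations, so Fubini's theorem lets them commute. This
  is how an inequality for \<open>aheat U\<close> survives mollification.\<close>

lemma aheat_heat_commute:
  fixes U :: "real^'n::finite \<Rightarrow> real"
  assumes lip: "L-lipschitz_on UNIV U"
  shows "integrable lborel (\<lambda>w. aheat U B s (x + \<sigma> *\<^sub>R w) * gdens w)"
    and "aheat (heat U \<sigma>) B s x = (\<integral>w. aheat U B s (x + \<sigma> *\<^sub>R w) * gdens w \<partial>lborel)"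
proof -
  define f where "f = (\<lambda>(z, w). U (x + s *\<^sub>R (B *v z) + \<sigma> *\<^sub>R w) * gdens w * gdens z)"
  have [measurable]: "U \<in> borel_measurable borel"
    by (intro borel_measurable_continuous_onI lipschitz_on_continuous_on[OF lip])
  have [measurable]: "(\<lambda>z. B *v z) \<in> borel_measurable borel"
    by (intro borel_measurable_continuous_onI linear_continuous_on) simp
  have fm: "f \<in> borel_measurable (lborel \<Otimes>\<^sub>M lborel)" unfolding f_def by measurable
  note U = lipschitz_exp_growth[OF lip]
  have fint: "integrable (lborel \<Otimes>\<^sub>M lborel) f"
  proof (rule lborel_pair.Fubini_integrable[OF fm])
    have "(\<integral>w. norm (f (z, w)) \<partial>lborel) = heat (\<lambda>y. \<bar>U y\<bar>) \<sigma> (x + s *\<^sub>R (B *v z)) * gdens z" for z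
      unfolding f_def heat_def by (simp add: abs_mult abs_of_pos gdens_pos)
    moreover have "integrable lborel (\<lambda>z. heat (\<lambda>y. \<bar>U y\<bar>) \<sigma> (x + s *\<^sub>R (B *v z)) * gdens z)"
      by (rule aheat_integrable[OF heat_is_lipschitz[OF lipschitz_abs[OF lip]]])
    ultimately show "integrable lborel (\<lambda>z. \<integral>w. norm (f (z, w)) \<partial>lborel)" by simp
    show "AE z in lborel. integrable lborel (\<lambda>w. f (z, w))"
      unfolding f_def using heat_integrable[OF U] by (auto intro!: AE_I2)
  qed
  have sw: "(\<integral>z. f (z, w) \<partial>lborel) = aheat U B s (x + \<sigma> *\<^sub>R w) * gdens w" for w
  proof -
    have "(\<integral>z. f (z, w) \<partial>lborel) = (\<integral>z. U (x + \<sigma> *\<^sub>R w + s *\<^sub>R (B *v z)) * gdens z * gdens w \<partial>lborel)"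
      by (rule Bochner_Integration.integral_cong) (auto simp: f_def ac_simps)
    then show ?thesis by (simp add: aheat_def)
  qed
  have "integrable lborel (\<lambda>w. \<integral>z. f (z, w) \<partial>lborel)"
    using lborel_pair.integrable_snd[of "\<lambda>z w. f (z, w)"] fint by (simp add: case_prod_beta')
  then show "integrable lborel (\<lambda>w. aheat U B s (x + \<sigma> *\<^sub>R w) * gdens w)" by (simp add: sw)
  have "(\<integral>w. \<integral>z. f (z, w) \<partial>lborel \<partial>lborel) = (\<integral>z. \<integral>w. f (z, w) \<partial>lborel \<partial>lborel)"
    using lborel_pair.Fubini_integral[of "\<lambda>z w. f (z, w)"] fint by (simp add: case_prod_beta')
  moreover have "(\<integral>w. f (z, w) \<partial>lborel) = heat U \<sigma> (x + s *\<^sub>R (B *v z)) * gdens z" for z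
    by (simp add: f_def heat_def)
  ultimately show "aheat (heat U \<sigma>) B s x = (\<integral>w. aheat U B s (x + \<sigma> *\<^sub>R w) * gdens w \<partial>lborel)"
    by (simp add: sw aheat_def[of "heat U \<sigma>"])
qed

text \<open>The Gaussian probability of a ball. It measures the part of the mollification that sees
  only points where the lower bound on subgradients is available.\<close>

definition gauss_ball :: "real \<Rightarrow> 'a::euclidean_space itself \<Rightarrow> real" where
  "gauss_ball \<rho> _ = (\<integral>z. indicator (ball (0::'a) \<rho>) z * gdens z \<partial>lborel)"

lemma gauss_ball_integrable: "integrable lborel (\<lambda>z. indicator (ball (0::'a::euclidean_space) \<rho>) z * gdens z)"
  by (rule Bochner_Integration.integrable_bound[OF gdens_integral(1)])
     (auto intro!: AE_I2 simp: indicator_def)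

lemma gauss_ball_tendsto: "((\<lambda>\<rho>. gauss_ball \<rho> TYPE('a::euclidean_space)) \<longlongrightarrow> 1) at_top"
proof -
  have "((\<lambda>\<rho>. \<integral>z. indicator (ball (0::'a) \<rho>) z * gdens z \<partial>lborel) \<longlongrightarrow> (\<integral>z. gdens (z::'a) \<partial>lborel)) at_top"
  proof (rule integral_dominated_convergence_at_top[where w=gdens])
    show "AE z::'a in lborel. ((\<lambda>\<rho>. indicator (ball (0::'a) \<rho>) z * gdens z) \<longlongrightarrow> gdens z) at_top"
    proof (rule AE_I2)
      fix z :: 'a
      have "\<forall>\<^sub>F \<rho> in at_top. indicator (ball (0::'a) \<rho>) z * gdens z = gdens z"
        using eventually_gt_at_top[of "norm z"] by eventually_elim simp
      then show "((\<lambda>\<rho>. indicator (ball (0::'a) \<rho>) z * gdens z) \<longlongrightarrow> gdens z) at_top"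
        by (rule tendsto_eventually)
    qed
    show "\<forall>\<^sub>F \<rho> in at_top. AE z::'a in lborel. norm (indicator (ball 0 \<rho>) z * gdens z) \<le> gdens z"
      by (auto intro!: always_eventually AE_I2 simp: indicator_def less_imp_le[OF gdens_pos])
    show "(\<lambda>z::'a. indicator (ball 0 \<rho>) z * gdens z) \<in> borel_measurable lborel" for \<rho>
      by (rule borel_measurable_integrable[OF gauss_ball_integrable])
  qed (use gdens_integral[where 'a='a] in auto)
  then show ?thesis by (simp add: gauss_ball_def gdens_integral)
qed

lemma aheat_heat_diff:
  fixes U :: "real^'n::finite \<Rightarrow> real"
  assumes lip: "L-lipschitz_on UNIV U"
  shows "aheat (heat U \<sigma>) B s x - heat U \<sigma> x = (\<integral>w. (aheat U B s (x + \<sigma> *\<^sub>R w) - U (x + \<sigma> *\<^sub>R w)) * gdens w \<partial>lborel)"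
    and "integrable lborel (\<lambda>w. (aheat U B s (x + \<sigma> *\<^sub>R w) - U (x + \<sigma> *\<^sub>R w)) * gdens w)"
proof -
  note i = aheat_heat_commute(1)[OF lip, of B s x \<sigma>] heat_integrable[OF lipschitz_exp_growth[OF lip], of x \<sigma>]
  show "integrable lborel (\<lambda>w. (aheat U B s (x + \<sigma> *\<^sub>R w) - U (x + \<sigma> *\<^sub>R w)) * gdens w)"
    unfolding left_diff_distrib by (rule Bochner_Integration.integrable_diff[OF i])
  show "aheat (heat U \<sigma>) B s x - heat U \<sigma> x = (\<integral>w. (aheat U B s (x + \<sigma> *\<^sub>R w) - U (x + \<sigma> *\<^sub>R w)) * gdens w \<partial>lborel)"
    unfolding left_diff_distrib aheat_heat_commute(2)[OF lip] heat_def
    by (rule Bochner_Integration.integral_diff[OF i[unfolded heat_def], symmetric])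
qed

lemma heat_aheat_second_order:
  fixes U :: "real^'n::finite \<Rightarrow> real" and B :: "real^'n^'n"
  assumes lip: "L-lipschitz_on UNIV U" and \<sigma>: "\<sigma> > 0" and s: "\<And>n. s n > 0" "s \<longlonglongrightarrow> 0"
  shows "(\<lambda>n. (aheat (heat U \<sigma>) B (s n) x - heat U \<sigma> x) / (s n)\<^sup>2) \<longlonglongrightarrow> trace (B ** transpose B ** heat_hess U (\<sigma>\<^sup>2) x) / 2"
proof -
  note U = lipschitz_exp_growth[OF lip]
  have t: "\<sigma>\<^sup>2 > 0" using \<sigma> by simp
  have sq: "sqrt (\<sigma>\<^sup>2) = \<sigma>" using \<sigma> by simp
  show ?thesis
    by (rule aheat_second_order[OF heat_has_derivative[OF U t, unfolded sq] heat_grad_has_derivative[OF U t]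
        heat_hess_continuous[OF U t] heat_is_lipschitz[OF lip] s])
qed

lemma trace_hess_nonneg:
  fixes U :: "real^'n::finite \<Rightarrow> real" and B :: "real^'n^'n"
  assumes mid: "\<And>x h. 2 * U x \<le> U (x + h) + U (x - h)" and lip: "L-lipschitz_on UNIV U" and \<sigma>: "\<sigma> > 0"
  shows "0 \<le> trace (B ** transpose B ** heat_hess U (\<sigma>\<^sup>2) x)"
proof -
  have "(\<lambda>n. (aheat (heat U \<sigma>) B (1 / Suc n) x - heat U \<sigma> x) / (1 / Suc n)\<^sup>2) \<longlonglongrightarrow> trace (B ** transpose B ** heat_hess U (\<sigma>\<^sup>2) x) / 2"
    by (rule heat_aheat_second_order[OF lip \<sigma>]) (use LIMSEQ_inverse_real_of_nat in \<open>auto simp: divide_inverse\<close>)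
  then have "0 \<le> trace (B ** transpose B ** heat_hess U (\<sigma>\<^sup>2) x) / 2"
  proof (rule LIMSEQ_le_const, intro exI allI impI)
    fix n :: nat
    have "0 \<le> aheat (heat U \<sigma>) B (1 / Suc n) x - heat U \<sigma> x"
      unfolding aheat_heat_diff(1)[OF lip]
      by (intro integral_nonneg_AE AE_I2 mult_nonneg_nonneg)
         (use aheat_ge_self[OF lip mid] in \<open>auto intro: less_imp_le[OF gdens_pos]\<close>)
    then show "0 \<le> (aheat (heat U \<sigma>) B (1 / Suc n) x - heat U \<sigma> x) / (1 / Suc n)\<^sup>2" by simp
  qed
  then show ?thesis by simp
qed

text \<open>At mollification points within \<open>r / 2\<close> of \<open>x\<close> the increment of
  \<open>aheat\<close> is bounded below by \<open>aheat_lower_bound\<close>; elsewhere it is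
  nonnegative by Jensen's inequality. Averaging produces the factor \<open>gauss_ball\<close>, and
  dividing by the squared step before letting it tend to 0 turns increments into the trace.\<close>

lemma trace_hess_lower_bound:
  fixes U :: "real^'n::finite \<Rightarrow> real" and B :: "real^'n^'n" and q :: real
  assumes mid: "\<And>x h. 2 * U x \<le> U (x + h) + U (x - h)" and lip: "L-lipschitz_on UNIV U" and \<sigma>: "\<sigma> > 0"
    and q: "q > 0" and r: "r > 0"
    and MA: "\<And>E. compact E \<Longrightarrow> E \<subseteq> ball x r \<Longrightarrow> q ^ CARD('n) * measure lebesgue E \<le> measure lebesgue (subdiff U E)"
  shows "CARD('n) * ((\<bar>det B\<bar>\<^sup>2) powr (1 / CARD('n)) * q) * gauss_ball (r / (2 * \<sigma>)) TYPE(real^'n)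
      \<le> trace (B ** transpose B ** heat_hess U (\<sigma>\<^sup>2) x)"
proof (cases "det B = 0")
  \<comment> \<open>The power of 0 is 0 here, so the claim reduces to nonnegativity of the
    trace.\<close>
  case True
  then show ?thesis using trace_hess_nonneg[OF mid lip \<sigma>] by simp
next
  case False
  define \<kappa> where "\<kappa> = CARD('n) * ((\<bar>det B\<bar>\<^sup>2) powr (1 / CARD('n)) * q) / 2"
  define G where "G = gauss_ball (r / (2 * \<sigma>)) TYPE(real^'n)"
  define s where "s n = 1 / real (Suc n)" for n
  have s: "s n > 0" "s \<longlonglongrightarrow> 0" for n
    using LIMSEQ_inverse_real_of_nat by (simp_all add: s_def[abs_def] divide_inverse)
  have lim: "(\<lambda>n. (aheat (heat U \<sigma>) B (s n) x - heat U \<sigma> x) / (s n)\<^sup>2) \<longlonglongrightarrow> trace (B ** transpose B ** heat_hess U (\<sigma>\<^sup>2) x) / 2"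
    by (rule heat_aheat_second_order[OF lip \<sigma> s])
  have low: "(\<kappa> - \<eta>) * G \<le> trace (B ** transpose B ** heat_hess U (\<sigma>\<^sup>2) x) / 2" if \<eta>: "\<eta> > 0" for \<eta>
  proof -
    \<comment> \<open>Half of the radius serves the lower bound and half the displacement
      \<open>\<sigma> *\<^sub>R w\<close>, so that all balls in question stay in
      \<open>ball x r\<close>.\<close>
    have r2: "r / 2 > 0" using r by simp
    from aheat_lower_bound[OF mid lip q r2 \<eta> False \<kappa>_def]
    obtain T where T: "T > 0" and low: "\<And>y t. (\<forall>E. compact E \<longrightarrow> E \<subseteq> ball y (r / 2) \<longrightarrow> q ^ CARD('n) * measure lebesgue E \<le> measure lebesgue (subdiff U E))
        \<Longrightarrow> 0 < t \<Longrightarrow> t \<le> T \<Longrightarrow> U y + t * (\<kappa> - \<eta>) \<le> aheat U B (sqrt t) y"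
      by blast
    have "(\<lambda>n. (s n)\<^sup>2) \<longlonglongrightarrow> 0" using tendsto_power[OF s(2), of 2] by simp
    then have "\<forall>\<^sub>F n in sequentially. (s n)\<^sup>2 < T" using T by (rule order_tendstoD)
    then have "\<forall>\<^sub>F n in sequentially. (\<kappa> - \<eta>) * G \<le> (aheat (heat U \<sigma>) B (s n) x - heat U \<sigma> x) / (s n)\<^sup>2"
    proof eventually_elim
      case (elim n)
      have "(\<integral>w. ((s n)\<^sup>2 * (\<kappa> - \<eta>)) * (indicator (ball 0 (r / (2 * \<sigma>))) w * gdens (w::real^'n)) \<partial>lborel)
          \<le> (\<integral>w. (aheat U B (s n) (x + \<sigma> *\<^sub>R w) - U (x + \<sigma> *\<^sub>R w)) * gdens w \<partial>lborel)"
      proof (rule integral_mono[OF _ aheat_heat_diff(2)[OF lip]])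
        show "integrable lborel (\<lambda>w. ((s n)\<^sup>2 * (\<kappa> - \<eta>)) * (indicator (ball 0 (r / (2 * \<sigma>))) w * gdens (w::real^'n)))"
          by (intro integrable_mult_right gauss_ball_integrable)
        fix w :: "real^'n"
        have "((s n)\<^sup>2 * (\<kappa> - \<eta>)) * indicator (ball 0 (r / (2 * \<sigma>))) w \<le> aheat U B (s n) (x + \<sigma> *\<^sub>R w) - U (x + \<sigma> *\<^sub>R w)"
        proof (cases "w \<in> ball 0 (r / (2 * \<sigma>))")
          case True
          then have nw: "norm w * \<sigma> < r / 2" using \<sigma> by (simp add: divide_simps mult.commute mult.left_commute)
          have "ball (x + \<sigma> *\<^sub>R w) (r / 2) \<subseteq> ball x r"
          proof
            fix y assume "y \<in> ball (x + \<sigma> *\<^sub>R w) (r / 2)"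
            then have "dist (x + \<sigma> *\<^sub>R w) y < r / 2" by simp
            moreover have "dist x (x + \<sigma> *\<^sub>R w) < r / 2" using nw \<sigma> by (simp add: dist_norm mult.commute)
            ultimately show "y \<in> ball x r" using dist_triangle[of x y "x + \<sigma> *\<^sub>R w"] by simp
          qed
          then have "U (x + \<sigma> *\<^sub>R w) + (s n)\<^sup>2 * (\<kappa> - \<eta>) \<le> aheat U B (sqrt ((s n)\<^sup>2)) (x + \<sigma> *\<^sub>R w)"
            using MA s(1)[of n] elim by (intro low) auto
          then show ?thesis using True s(1)[of n] by simp
        next
          case False
          then show ?thesis using aheat_ge_self[OF lip mid] by simp
        qed
        from mult_right_mono[OF this less_imp_le[OF gdens_pos[of w]]]
        show "((s n)\<^sup>2 * (\<kappa> - \<eta>)) * (indicator (ball 0 (r / (2 * \<sigma>))) w * gdens w) \<le> (aheat U B (s n) (x + \<sigma> *\<^sub>R w) - U (x + \<sigma> *\<^sub>R w)) * gdens w"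
          by (simp only: mult.assoc)
      qed
      then have "(s n)\<^sup>2 * (\<kappa> - \<eta>) * G \<le> aheat (heat U \<sigma>) B (s n) x - heat U \<sigma> x"
        unfolding aheat_heat_diff(1)[OF lip] by (simp add: G_def gauss_ball_def)
      then show ?case using s(1)[of n] by (simp add: pos_le_divide_eq ac_simps)
    qed
    then show ?thesis by (rule tendsto_lowerbound[OF lim]) simp
  qed
  have "((\<lambda>\<eta>. (\<kappa> - \<eta>) * G) \<longlongrightarrow> (\<kappa> - 0) * G) (at_right 0)" by (intro tendsto_intros)
  then have "(\<kappa> - 0) * G \<le> trace (B ** transpose B ** heat_hess U (\<sigma>\<^sup>2) x) / 2"
  proof (rule tendsto_upperbound)
    show "\<forall>\<^sub>F \<eta> in at_right 0. (\<kappa> - \<eta>) * G \<le> trace (B ** transpose B ** heat_hess U (\<sigma>\<^sup>2) x) / 2"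
      using eventually_at_right_less[of "0::real"] by eventually_elim (rule low)
  qed simp
  then show ?thesis by (simp add: \<kappa>_def G_def)
qed

section \<open>Smoothness and gradients of mollified functions\<close>

lemma smooth_on_UNIV_closed_class:
  assumes diff: "\<And>f x. f \<in> F \<Longrightarrow> f differentiable (at x)"
    and der: "\<And>f v. f \<in> F \<Longrightarrow> (\<lambda>x. frechet_derivative f (at x) v) \<in> F"
    and f: "f \<in> F"
  shows "smooth_on UNIV f"
proof -
  have "Ck_on k UNIV g" if "g \<in> F" for k g
    using that
  proof (induction k arbitrary: g)
    case 0
    then show ?case
      using diff by (auto intro!: continuous_at_imp_continuous_on differentiable_imp_continuous_within)
  next
    case (Suc k)
    then show ?case using diff der by auto
  qed
  with f show ?thesis by (simp add: smooth_on_def)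
qed

lemma smooth_on_gconv:
  fixes U :: "'a::euclidean_space \<Rightarrow> real" and k :: "'n::finite \<Rightarrow> 'a \<Rightarrow> real"
  assumes U: "exp_growth U" and t: "t > 0" and k: "\<And>i. k i \<in> poly_gauss t"
  shows "smooth_on UNIV (\<lambda>x. \<chi> i. gconv U (k i) x)"
proof -
  define F where "F = {\<lambda>x. \<chi> i. gconv U (k i) x | k :: 'n \<Rightarrow> 'a \<Rightarrow> real. \<forall>i. k i \<in> poly_gauss t}"
  have step: "f differentiable (at x) \<and> (\<lambda>x. frechet_derivative f (at x) v) \<in> F" if fF: "f \<in> F" for f x v
  proof -
    obtain k :: "'n \<Rightarrow> 'a \<Rightarrow> real" where f: "f = (\<lambda>x. \<chi> i. gconv U (k i) x)" and k: "\<And>i. k i \<in> poly_gauss t"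
      using fF unfolding F_def by blast
    have "\<forall>i. \<exists>dk. (\<forall>z. (k i has_derivative dk z) (at z)) \<and> (\<forall>v. (\<lambda>z. dk z v) \<in> poly_gauss t)"
      using poly_gauss_has_derivative[OF k t] by blast
    from choice[OF this] obtain dk where dk: "\<And>i z. (k i has_derivative dk i z) (at z)" "\<And>i v. (\<lambda>z. dk i z v) \<in> poly_gauss t"
      by blast
    have d: "(f has_derivative (\<lambda>v. \<chi> i. gconv U (\<lambda>z. dk i z v) x)) (at x)" for x
      unfolding f has_derivative_componentwise_within[of "\<lambda>x. \<chi> i. gconv U (k i) x"]
      using gconv_has_derivative[OF U k t dk] by (auto simp: Basis_vec_def inner_axis)
    then have "frechet_derivative f (at x) v = (\<chi> i. gconv U (\<lambda>z. dk i z v) x)" for x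
      using frechet_derivative_at[OF d] by metis
    then have "(\<lambda>x. frechet_derivative f (at x) v) \<in> F"
      unfolding F_def using dk(2) by auto
    with d show ?thesis by (auto simp: differentiable_def)
  qed
  show ?thesis by (rule smooth_on_UNIV_closed_class[of F]) (use step k in \<open>auto simp: F_def\<close>)
qed

lemma smooth_heat_grad:
  fixes U :: "real^'n::finite \<Rightarrow> real"
  assumes U: "exp_growth U" and t: "t > 0"
  shows "smooth_on UNIV (heat_grad U t)"
proof -
  have eq: "heat_grad U t = (\<lambda>x. \<chi> i. gconv U (\<lambda>z. (heat_coeff TYPE('n) t * - (1 / t)) * (z \<bullet> axis i 1) * gauss t z) x)"
    by (simp only: heat_grad_def fun_eq_iff gconv_cmult mult.assoc simp_thms)
  show ?thesis unfolding eq
  proof (rule smooth_on_gconv[OF U t])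
    show "(\<lambda>z. (heat_coeff TYPE('n) t * - (1 / t)) * (z \<bullet> axis i 1) * gauss t z) \<in> poly_gauss t" for i :: 'n
    by (rule poly_gauss_mult[OF real_polynomial_function.intros(4)[OF real_polynomial_function.intros(2)]]) auto
  qed
qed

lemma grad_heat_grad:
  fixes U :: "real^'n::finite \<Rightarrow> real"
  assumes U: "exp_growth U" and t: "t > 0"
  shows "grad (heat_grad U t) x = heat_hess U t x"
proof -
  have "partial j (\<lambda>y. heat_grad U t y $ i) x = heat_hess U t x $ i $ j" for i j
  proof -
    have "((\<lambda>y. heat_grad U t y $ i) has_derivative (\<lambda>v. (heat_hess U t x *v v) $ i)) (at x)"
      by (rule bounded_linear.has_derivative[OF bounded_linear_vec_nth heat_grad_has_derivative[OF U t]])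
    from frechet_derivative_at[OF this, symmetric] show ?thesis
      unfolding partial_def by (simp add: matrix_vector_mul_component inner_axis)
  qed
  then have "grad (heat_grad U t) x = transpose (heat_hess U t x)"
    by (simp add: grad_def transpose_def vec_eq_iff)
  then show ?thesis by (simp add: heat_hess_sym)
qed

text \<open>Differentiate along \<open>p\<close> itself. With \<open>L = 1\<close> this makes the
  mollified gradient an admissible field in the tested Green formula.\<close>

lemma lipschitz_gradient_le:
  fixes V :: "'a::real_inner \<Rightarrow> real"
  assumes lip: "L-lipschitz_on UNIV V" and d: "(V has_derivative (\<lambda>v. p \<bullet> v)) (at x)"
  shows "norm p \<le> L"
proof -
  have L: "L \<ge> 0" by (rule lipschitz_on_nonneg[OF lip])
  have "((\<lambda>t. V (x + t *\<^sub>R p)) has_real_derivative (p \<bullet> p)) (at 0)"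
    by (rule has_real_derivative_along_line) (simp add: d)
  then have "((\<lambda>h. (V (x + h *\<^sub>R p) - V x) / h) \<longlongrightarrow> p \<bullet> p) (at 0)"
    by (simp add: DERIV_def)
  moreover have "(V (x + h *\<^sub>R p) - V x) / h \<le> L * norm p" for h
  proof -
    have "\<bar>V (x + h *\<^sub>R p) - V x\<bar> \<le> L * norm p * \<bar>h\<bar>"
      using lipschitz_onD[OF lip, of "x + h *\<^sub>R p" x] by (simp add: dist_norm ac_simps)
    then have "\<bar>(V (x + h *\<^sub>R p) - V x) / h\<bar> \<le> L * norm p"
      using L by (cases "h = 0") (auto simp: abs_divide divide_simps)
    then show ?thesis by linarith
  qed
  ultimately have "p \<bullet> p \<le> L * norm p" by (intro tendsto_upperbound[where F="at (0::real)"]) auto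
  then have "norm p * norm p \<le> L * norm p" by (simp add: dot_square_norm power2_eq_square)
  then show ?thesis using L by (cases "p = 0") auto
qed

lemma integrable_trace_mult:
  fixes A H :: "real^'n::finite \<Rightarrow> real^'n^'n"
  assumes A: "integrable (lebesgue_on \<Omega>) A" and \<Omega>: "bounded \<Omega>" "\<Omega> \<in> sets lebesgue" and H: "continuous_on UNIV H"
  shows "integrable (lebesgue_on \<Omega>) (\<lambda>x. trace (A x ** H x))"
proof -
  have "compact (H ` closure \<Omega>)"
    using \<Omega> by (intro compact_continuous_image continuous_on_subset[OF H]) (auto simp: compact_closure)
  then obtain K where K: "\<And>x. x \<in> closure \<Omega> \<Longrightarrow> norm (H x) \<le> K"
    using compact_imp_bounded bounded_iff by (metis imageI)
  have Hb: "\<bar>H x $ i $ j\<bar> \<le> K" if "x \<in> \<Omega>" for x i j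
    using component_le_norm_cart[of "H x $ i" j] Finite_Cartesian_Product.norm_nth_le[of "H x" i] K[of x] that closure_subset[of \<Omega>]
    by force
  have Aij: "integrable (lebesgue_on \<Omega>) (\<lambda>x. A x $ i $ j)" for i j
    by (intro integrable_bounded_linear[OF bounded_linear_vec_nth] A)
  have "integrable (lebesgue_on \<Omega>) (\<lambda>x. A x $ i $ j * H x $ j $ i)" for i j
  proof (rule Bochner_Integration.integrable_bound[OF integrable_mult_left[OF integrable_abs[OF Aij], of i j K]])
    have "(\<lambda>x. H x $ j $ i) \<in> borel_measurable borel"
      by (intro borel_measurable_continuous_onI continuous_on_component H)
    then have [measurable]: "(\<lambda>x. H x $ j $ i) \<in> borel_measurable (lebesgue_on \<Omega>)"
      by (intro measurable_restrict_space1 measurable_completion) simp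
    have [measurable]: "(\<lambda>x. A x $ i $ j) \<in> borel_measurable (lebesgue_on \<Omega>)"
      by (rule borel_measurable_integrable[OF Aij])
    show "(\<lambda>x. A x $ i $ j * H x $ j $ i) \<in> borel_measurable (lebesgue_on \<Omega>)" by measurable
    show "AE x in lebesgue_on \<Omega>. norm (A x $ i $ j * H x $ j $ i) \<le> norm (\<bar>A x $ i $ j\<bar> * K)"
    proof (rule AE_I2)
      fix x assume "x \<in> space (lebesgue_on \<Omega>)"
      then have "\<bar>H x $ j $ i\<bar> \<le> K" using Hb by simp
      then show "norm (A x $ i $ j * H x $ j $ i) \<le> norm (\<bar>A x $ i $ j\<bar> * K)"
        by (simp add: abs_mult mult_left_mono)
    qed
  qed
  then show ?thesis unfolding trace_def matrix_matrix_mult_def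
    by (auto intro!: Bochner_Integration.integrable_sum)
qed

section \<open>The integral inequality\<close>

lemma det_measurable:
  fixes A :: "'a \<Rightarrow> real^'n::finite^'n"
  assumes "A \<in> borel_measurable M"
  shows "(\<lambda>x. det (A x)) \<in> borel_measurable M"
proof -
  have "continuous_on UNIV (\<lambda>A::real^'n^'n. det A)"
    unfolding det_def by (intro continuous_intros continuous_on_component)
  then have "(\<lambda>A::real^'n^'n. det A) \<in> borel_measurable borel" by (rule borel_measurable_continuous_onI)
  with assms show ?thesis by (rule measurable_compose)
qed

lemma lebesgue_on_continuous_measurable:
  fixes q :: "'a::euclidean_space \<Rightarrow> real"
  assumes "continuous_on UNIV q"
  shows "q \<in> borel_measurable (lebesgue_on S)"
proof -
  have "q \<in> borel_measurable borel" by (rule borel_measurable_continuous_onI[OF assms])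
  then show ?thesis by (intro measurable_restrict_space1 measurable_completion) simp
qed

text \<open>Test Green's formula with the gradient of a Gaussian mollification of the Alexandrov solution of
  \<open>det D\<^sup>2U = q\<^sup>d\<close> and let the width of the mollifier tend to 0.\<close>

lemma weighted_det_integral_le_normalized:
  fixes \<Omega> :: "(real^'n::finite) set" and A :: "real^'n \<Rightarrow> real^'n^'n" and q :: "real^'n \<Rightarrow> real"
  assumes \<Omega>: "bounded \<Omega>" "\<Omega> \<in> sets lebesgue" and A: "integrable (lebesgue_on \<Omega>) A"
    and psd: "AE x in lebesgue_on \<Omega>. A x \<in> Sym_plus"
    and M: "\<And>\<psi>. smooth_on UNIV \<psi> \<Longrightarrow> (\<And>x. norm (\<psi> x) \<le> 1) \<Longrightarrow> (\<integral>x. trace (A x ** grad \<psi> x) \<partial>lebesgue_on \<Omega>) \<le> M"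
    and q: "continuous_on UNIV q" "\<And>x. 0 \<le> q x" and R: "R > 0" and supp: "\<And>x. x \<notin> cball 0 R \<Longrightarrow> q x = 0"
    and mass: "(LINT x:cball 0 R|lborel. q x ^ CARD('n)) = measure lborel (cball (0::real^'n) 1)"
  shows "(\<integral>\<^sup>+x. ennreal (CARD('n) * (det (A x) powr (1 / CARD('n)) * q x)) \<partial>lebesgue_on \<Omega>) \<le> ennreal M"
proof -
  let ?d = "CARD('n)"
  interpret kantorovich "\<lambda>x. q x ^ ?d" R
    by unfold_locales (use q R mass in \<open>auto intro!: continuous_intros\<close>)
  obtain U where lip: "1-lipschitz_on UNIV U" and mid: "\<And>x h. 2 * U x \<le> U (x + h) + U (x - h)"
    and MA: "\<And>E. compact E \<Longrightarrow> E \<subseteq> cball 0 R \<Longrightarrow> (LINT x:E|lborel. q x ^ ?d) \<le> measure lebesgue (subdiff U E)"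
    using alexandrov_solution by metis
  note U = lipschitz_exp_growth[OF lip]
  define \<sigma> where "\<sigma> n = 1 / real (Suc n)" for n
  have \<sigma>: "\<sigma> n > 0" for n by (simp add: \<sigma>_def)
  then have \<sigma>2: "(\<sigma> n)\<^sup>2 > 0" for n by (simp add: less_imp_neq[symmetric])
  define h where "h n x = trace (A x ** heat_hess U ((\<sigma> n)\<^sup>2) x)" for n x
  have hi: "integrable (lebesgue_on \<Omega>) (h n)" for n
    unfolding h_def by (rule integrable_trace_mult[OF A \<Omega> heat_hess_continuous[OF U \<sigma>2]])
  have hM: "(\<integral>x. h n x \<partial>lebesgue_on \<Omega>) \<le> M" for n
  proof -
    have "norm (heat_grad U ((\<sigma> n)\<^sup>2) x) \<le> 1" for x
      by (rule lipschitz_gradient_le[OF heat_is_lipschitz[OF lip] heat_has_derivative[OF U \<sigma>2]])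
    from M[OF smooth_heat_grad[OF U \<sigma>2] this] show ?thesis
      by (simp add: h_def grad_heat_grad[OF U \<sigma>2])
  qed
  have root: "\<exists>B::real^'n^'n. A x = B ** transpose B" if "A x \<in> Sym_plus" for x
    using that psd_sqrt[of "A x"] unfolding Sym_plus_def by blast
  have h0: "0 \<le> h n x" if Ax: "A x \<in> Sym_plus" for n x
  proof -
    obtain B :: "real^'n^'n" where "A x = B ** transpose B" using root[OF Ax] by blast
    then show ?thesis using trace_hess_nonneg[OF mid lip \<sigma>] by (simp add: h_def)
  qed
  have low: "ennreal (?d * (det (A x) powr (1 / ?d) * q x)) \<le> liminf (\<lambda>n. ennreal (h n x))" if Ax: "A x \<in> Sym_plus" for x
  proof (cases "q x = 0")
    case False
    then have qx: "q x > 0" using q(2)[of x] by simp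
    obtain B :: "real^'n^'n" where B: "A x = B ** transpose B" using root[OF Ax] by blast
    define K where "K = ?d * det (A x) powr (1 / ?d)"
    have detB: "\<bar>det B\<bar>\<^sup>2 = det (A x)" by (simp add: B det_mul power2_eq_square)
    \<comment> \<open>For a constant \<open>c\<close> below \<open>q x\<close> continuity gives a
      ball on which \<open>q > c\<close>. As \<open>c > 0\<close>, this ball lies in
      \<open>cball 0 R\<close>, and there the potential satisfies the subgradient bound with
      constant density \<open>c ^ ?d\<close>.\<close>
    have lowc: "ennreal (K * c) \<le> liminf (\<lambda>n. ennreal (h n x))" if c: "0 < c" "c < q x" for c
    proof -
      have "open (q -` {c<..})" using q(1) by (intro open_vimage) auto
      then obtain \<epsilon> where \<epsilon>: "\<epsilon> > 0" "ball x \<epsilon> \<subseteq> q -` {c<..}" using c by (meson openE greaterThan_iff vimageI)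
      have MA': "c ^ ?d * measure lebesgue E \<le> measure lebesgue (subdiff U E)" if E: "compact E" "E \<subseteq> ball x \<epsilon>" for E
      proof -
        have qc: "c < q y" if "y \<in> E" for y using that E \<epsilon> by auto
        have "E \<subseteq> cball 0 R"
        proof
          fix y assume "y \<in> E"
          then have "q y \<noteq> 0" using qc[of y] c by simp
          then show "y \<in> cball 0 R" using supp by blast
        qed
        moreover have "c ^ ?d * measure lborel E \<le> (LINT x:E|lborel. q x ^ ?d)"
          unfolding set_integral_const_lborel[OF E(1), symmetric]
        proof (rule set_integral_mono)
          show "set_integrable lborel E (\<lambda>x. q x ^ ?d)"
            by (intro set_integrable_compact_continuous[OF E(1)] continuous_intros continuous_on_subset[OF q(1)]) auto
          show "set_integrable lborel E (\<lambda>x. c ^ ?d)"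
            by (intro set_integrable_compact_continuous[OF E(1)] continuous_intros)
          show "c ^ ?d \<le> q y ^ ?d" if "y \<in> E" for y
            using qc[OF that] c by (intro power_mono) auto
        qed
        moreover have "measure lebesgue E = measure lborel E"
          by (rule measure_completion) (simp add: borel_compact[OF E(1)])
        ultimately show ?thesis using MA[OF E(1)] by simp
      qed
      have le: "K * c * gauss_ball (\<epsilon> / (2 * \<sigma> n)) TYPE(real^'n) \<le> h n x" for n
        using trace_hess_lower_bound[OF mid lip \<sigma>[of n] c(1) \<epsilon>(1) MA', where B=B]
        unfolding detB h_def B[symmetric] K_def by (simp only: mult.assoc)
      \<comment> \<open>As the mollifier shrinks, the rescaled ball exhausts the space and its
        Gaussian probability tends to 1.\<close>
      have "filterlim (\<lambda>n. \<epsilon> / 2 * real (Suc n)) at_top sequentially"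
        by (rule filterlim_tendsto_pos_mult_at_top[OF tendsto_const _ filterlim_compose[OF filterlim_real_sequentially filterlim_Suc]])
           (use \<epsilon> in simp)
      then have "filterlim (\<lambda>n. \<epsilon> / (2 * \<sigma> n)) at_top sequentially" by (simp add: \<sigma>_def)
      from filterlim_compose[OF gauss_ball_tendsto this]
      have "(\<lambda>n. K * c * gauss_ball (\<epsilon> / (2 * \<sigma> n)) TYPE(real^'n)) \<longlonglongrightarrow> K * c * 1"
        by (intro tendsto_mult tendsto_const)
      then have "(\<lambda>n. ennreal (K * c * gauss_ball (\<epsilon> / (2 * \<sigma> n)) TYPE(real^'n))) \<longlonglongrightarrow> ennreal (K * c)"
        using tendsto_ennrealI by fastforce
      then have "liminf (\<lambda>n. ennreal (K * c * gauss_ball (\<epsilon> / (2 * \<sigma> n)) TYPE(real^'n))) = ennreal (K * c)"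
        by (rule lim_imp_Liminf[rotated]) simp
      moreover have "liminf (\<lambda>n. ennreal (K * c * gauss_ball (\<epsilon> / (2 * \<sigma> n)) TYPE(real^'n))) \<le> liminf (\<lambda>n. ennreal (h n x))"
        by (intro Liminf_mono always_eventually allI ennreal_leI le)
      ultimately show ?thesis by simp
    qed
    have "((\<lambda>c. ennreal (K * c)) \<longlongrightarrow> ennreal (K * q x)) (at_left (q x))"
      by (intro tendsto_ennrealI tendsto_intros)
    then have "ennreal (K * q x) \<le> liminf (\<lambda>n. ennreal (h n x))"
    proof (rule tendsto_upperbound)
      show "\<forall>\<^sub>F c in at_left (q x). ennreal (K * c) \<le> liminf (\<lambda>n. ennreal (h n x))"
        using eventually_at_left_real[OF qx] by eventually_elim (auto intro: lowc)
    qed simp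
    then show ?thesis by (simp add: K_def mult.assoc)
  qed simp
  have "(\<integral>\<^sup>+x. ennreal (?d * (det (A x) powr (1 / ?d) * q x)) \<partial>lebesgue_on \<Omega>) \<le> (\<integral>\<^sup>+x. liminf (\<lambda>n. ennreal (h n x)) \<partial>lebesgue_on \<Omega>)"
    by (rule nn_integral_mono_AE) (use psd low in \<open>auto elim: eventually_mono\<close>)
  \<comment> \<open>Fatou's lemma suffices, since \<open>low\<close> is only a lower bound for the
    limit.\<close>
  also have "\<dots> \<le> liminf (\<lambda>n. \<integral>\<^sup>+x. ennreal (h n x) \<partial>lebesgue_on \<Omega>)"
    by (rule nn_integral_liminf) (use borel_measurable_integrable[OF hi] in measurable)
  also have "\<dots> \<le> liminf (\<lambda>n. ennreal M)"
  proof (intro Liminf_mono always_eventually allI)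
    fix n
    have "AE x in lebesgue_on \<Omega>. 0 \<le> h n x" using psd by eventually_elim (rule h0)
    then have "(\<integral>\<^sup>+x. ennreal (h n x) \<partial>lebesgue_on \<Omega>) = ennreal (\<integral>x. h n x \<partial>lebesgue_on \<Omega>)"
      by (rule nn_integral_eq_integral[OF hi])
    then show "(\<integral>\<^sup>+x. ennreal (h n x) \<partial>lebesgue_on \<Omega>) \<le> ennreal M" using hM by (simp add: ennreal_leI)
  qed
  also have "\<dots> = ennreal M" by (rule Liminf_const) simp
  finally show ?thesis .
qed

text \<open>Both sides are homogeneous of degree 1 in \<open>q\<close>; the factor \<open>c\<close>
  scales the mass \<open>N\<close> to that of the unit ball.\<close>

lemma weighted_det_integral_le:
  fixes \<Omega> :: "(real^'n::finite) set" and A :: "real^'n \<Rightarrow> real^'n^'n" and q :: "real^'n \<Rightarrow> real"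
  assumes \<Omega>: "bounded \<Omega>" "\<Omega> \<in> sets lebesgue" and A: "integrable (lebesgue_on \<Omega>) A"
    and psd: "AE x in lebesgue_on \<Omega>. A x \<in> Sym_plus"
    and M: "\<And>\<psi>. smooth_on UNIV \<psi> \<Longrightarrow> (\<And>x. norm (\<psi> x) \<le> 1) \<Longrightarrow> (\<integral>x. trace (A x ** grad \<psi> x) \<partial>lebesgue_on \<Omega>) \<le> M"
    and q: "continuous_on UNIV q" "\<And>x. 0 \<le> q x" and R: "R > 0" and supp: "\<And>x. x \<notin> cball 0 R \<Longrightarrow> q x = 0"
    and N: "N = (LINT x:cball 0 R|lborel. q x ^ CARD('n))" "N > 0"
  shows "(\<integral>\<^sup>+x. ennreal (CARD('n) * (det (A x) powr (1 / CARD('n)) * q x)) \<partial>lebesgue_on \<Omega>)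
     \<le> ennreal (M * (N / measure lborel (cball (0::real^'n) 1)) powr (1 / CARD('n)))"
proof -
  let ?d = "CARD('n)" and ?w = "measure lborel (cball (0::real^'n) 1)"
  have w: "?w > 0" by simp
  define c where "c = (?w / N) powr (1 / ?d)"
  have c: "c > 0" using w N by (simp add: c_def)
  have cd: "c ^ ?d = ?w / N"
    using w N(2) unfolding c_def by (subst powr_realpow[symmetric]) (auto simp: powr_powr)
  have ic: "1 / c = (N / ?w) powr (1 / ?d)"
    using w N(2) by (simp add: c_def powr_divide)
  have 1: "(\<integral>\<^sup>+x. ennreal (?d * (det (A x) powr (1 / ?d) * (c * q x))) \<partial>lebesgue_on \<Omega>) \<le> ennreal M"
  proof (rule weighted_det_integral_le_normalized[OF \<Omega> A psd M _ _ R])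
    show "continuous_on UNIV (\<lambda>x. c * q x)" by (intro continuous_intros q)
    show "0 \<le> c * q x" for x using c q(2)[of x] by simp
    show "c * q x = 0" if "x \<notin> cball 0 R" for x using supp[OF that] by simp
    have "(LINT x:cball 0 R|lborel. (c * q x) ^ ?d) = c ^ ?d * N"
      by (simp add: power_mult_distrib N(1))
    then show "(LINT x:cball 0 R|lborel. (c * q x) ^ ?d) = ?w" using N(2) by (simp add: cd)
  qed
  have m: "(\<lambda>x. ?d * (det (A x) powr (1 / ?d) * (c * q x))) \<in> borel_measurable (lebesgue_on \<Omega>)"
  proof -
    have [measurable]: "(\<lambda>x. det (A x)) \<in> borel_measurable (lebesgue_on \<Omega>)"
      by (rule det_measurable[OF borel_measurable_integrable[OF A]])
    have [measurable]: "q \<in> borel_measurable (lebesgue_on \<Omega>)" by (rule lebesgue_on_continuous_measurable[OF q(1)])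
    show ?thesis by measurable
  qed
  have "(\<integral>\<^sup>+x. ennreal (?d * (det (A x) powr (1 / ?d) * q x)) \<partial>lebesgue_on \<Omega>)
      = (\<integral>\<^sup>+x. ennreal (1 / c) * ennreal (?d * (det (A x) powr (1 / ?d) * (c * q x))) \<partial>lebesgue_on \<Omega>)"
  proof (rule nn_integral_cong)
    fix x
    have "?d * (det (A x) powr (1 / ?d) * q x) = (1 / c) * (?d * (det (A x) powr (1 / ?d) * (c * q x)))" using c by simp
    also have "ennreal \<dots> = ennreal (1 / c) * ennreal (?d * (det (A x) powr (1 / ?d) * (c * q x)))"
      using c q(2)[of x] by (intro ennreal_mult) auto
    finally show "ennreal (?d * (det (A x) powr (1 / ?d) * q x)) = ennreal (1 / c) * ennreal (?d * (det (A x) powr (1 / ?d) * (c * q x)))" .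
  qed
  also have "\<dots> = ennreal (1 / c) * (\<integral>\<^sup>+x. ennreal (?d * (det (A x) powr (1 / ?d) * (c * q x))) \<partial>lebesgue_on \<Omega>)"
    by (rule nn_integral_cmult[OF measurable_compose[OF m measurable_ennreal]])
  also have "\<dots> \<le> ennreal (1 / c) * ennreal M" by (intro mult_left_mono 1) simp
  also have "\<dots> = ennreal (M * (N / ?w) powr (1 / ?d))"
    using c unfolding ic[symmetric] by (subst ennreal_mult'[symmetric]) (auto simp: mult.commute)
  finally show ?thesis .
qed

text \<open>Divide by \<open>N powr (1 / d)\<close> and raise to the power
  \<open>d / (d - 1)\<close>. With \<open>w\<close> the volume of the unit ball,
  \<open>d * w\<close> is the area of the unit sphere.\<close>

lemma isoperimetric_arithmetic:
  fixes N w M d :: real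
  assumes N: "N > 0" and w: "w > 0" and d: "d > 1" and le: "d * N \<le> M * (N / w) powr (1 / d)"
  shows "N \<le> 1 / (d * (d * w) powr (1 / (d - 1))) * M powr (d / (d - 1))"
proof -
  have M: "M > 0"
  proof (rule ccontr)
    assume "\<not> M > 0"
    then have "M * (N / w) powr (1 / d) \<le> 0" by (intro mult_nonpos_nonneg) auto
    moreover have "d * N > 0" using N d by simp
    ultimately show False using le by linarith
  qed
  define p where "p = d / (d - 1)"
  have p: "p > 0" "(1 - 1 / d) * p = 1" "(1 / d) * p = 1 / (d - 1)" "p = 1 + 1 / (d - 1)"
    using d by (auto simp: p_def field_simps)
  have "N powr (1 - 1 / d) = N / N powr (1 / d)" using N by (simp add: powr_diff)
  also have "\<dots> \<le> M / (d * w powr (1 / d))"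
    using le N w d by (simp add: powr_divide field_simps)
  finally have "(N powr (1 - 1 / d)) powr p \<le> (M / (d * w powr (1 / d))) powr p"
    using p by (intro powr_mono2) auto
  also have "(N powr (1 - 1 / d)) powr p = N" using N unfolding powr_powr p(2) by simp
  also have "(M / (d * w powr (1 / d))) powr p = M powr p / (d powr p * w powr (1 / (d - 1)))"
    using M d w by (simp add: powr_divide powr_mult powr_powr p(3)[simplified])
  also have "d powr p = d * d powr (1 / (d - 1))" using d unfolding p(4) by (simp add: powr_add)
  also have "M powr p / (d * d powr (1 / (d - 1)) * w powr (1 / (d - 1))) = 1 / (d * (d * w) powr (1 / (d - 1))) * M powr p"
    using d w by (simp add: powr_mult)
  finally show ?thesis by (simp add: p_def)
qed

text \<open>The weight is \<open>q = m\<^bsup>1/d\<^esup>\<close> for the truncation m of \<open>(det A)\<^bsup>1/(d-1)\<^esup>\<close>, so that \<open>(det A)\<^bsup>1/d\<^esup> q \<ge> m\<close>.\<close>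

lemma truncated_det_integral_le:
  fixes \<Omega> :: "(real^'n::finite) set" and A :: "real^'n \<Rightarrow> real^'n^'n" and k :: real
  assumes d: "CARD('n) \<ge> 2" and \<Omega>: "bounded \<Omega>" "\<Omega> \<in> sets lebesgue" and A: "integrable (lebesgue_on \<Omega>) A"
    and psd: "AE x in lebesgue_on \<Omega>. A x \<in> Sym_plus"
    and M: "\<And>\<psi>. smooth_on UNIV \<psi> \<Longrightarrow> (\<And>x. norm (\<psi> x) \<le> 1) \<Longrightarrow> (\<integral>x. trace (A x ** grad \<psi> x) \<partial>lebesgue_on \<Omega>) \<le> M"
    and M0: "M \<ge> 0" and k: "k > 0"
  shows "(\<integral>\<^sup>+x. ennreal (min (det (A x) powr (1 / (real CARD('n) - 1))) k) \<partial>lebesgue_on \<Omega>)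
    \<le> ennreal (1 / (real CARD('n) * (real CARD('n) * measure lborel (cball (0::real^'n) 1)) powr (1 / (real CARD('n) - 1))) * M powr (real CARD('n) / (real CARD('n) - 1)))"
proof -
  let ?d = "CARD('n)" and ?w = "measure lborel (cball (0::real^'n) 1)"
  have d1: "real ?d > 1" using d by simp
  have w: "?w > 0" by simp
  define m where "m x = min (det (A x) powr (1 / (real ?d - 1))) k" for x
  have m0: "0 \<le> m x" "m x \<le> k" for x using k by (auto simp: m_def)
  have detm [measurable]: "(\<lambda>x. det (A x)) \<in> borel_measurable (lebesgue_on \<Omega>)"
    by (rule det_measurable[OF borel_measurable_integrable[OF A]])
  have mm [measurable]: "m \<in> borel_measurable (lebesgue_on \<Omega>)" unfolding m_def by measurable
  define K where "K = k powr (1 / ?d)"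
  define P where "P x = indicator \<Omega> x *\<^sub>R (m x powr (1 / ?d))" for x
  have P: "0 \<le> P x" "P x \<le> K" for x
    using m0[of x] by (auto simp: P_def K_def indicator_def intro!: powr_mono2)
  have Pm: "P \<in> borel_measurable lebesgue"
    unfolding P_def using \<Omega>(2) by (subst borel_measurable_restrict_space_iff[symmetric]) auto
  have Pd: "P x ^ ?d = indicator \<Omega> x * m x" for x
  proof -
    have "(m x powr (1 / ?d)) ^ ?d = m x"
      using m0[of x] by (cases "m x = 0") (auto simp: powr_powr simp flip: powr_realpow)
    then show ?thesis by (simp add: P_def indicator_def)
  qed
  \<comment> \<open>Lebesgue measurability provides continuous functions converging to
    \<open>P\<close> off a null set, and the duality argument is stated for continuous
    weights.\<close>
  have "P measurable_on UNIV" by (rule lebesgue_measurable_imp_measurable_on[OF Pm]) simp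
  then obtain Z g where Z: "negligible Z" and g: "\<And>n::nat. continuous_on UNIV (g n)"
    and glim: "\<And>x. x \<notin> Z \<Longrightarrow> (\<lambda>n. g n x) \<longlonglongrightarrow> P x"
    unfolding measurable_on_def by auto
  obtain R0 where R0: "\<Omega> \<subseteq> cball 0 R0" "R0 > 0"
    using bounded_subset_ballD[OF \<Omega>(1), of 0] ball_subset_cball by blast
  define R where "R = R0 + 1"
  have R: "R > 0" using R0 by (simp add: R_def)
  \<comment> \<open>Clamping to values between 0 and \<open>K\<close> and cutting off give compact
    support and a common integrable majorant. Since \<open>R = R0 + 1\<close>, the cut-off is 1 on
    \<open>\<Omega>\<close> and leaves the limit unchanged.\<close>
  define cut where "cut x = max 0 (min 1 (R - norm x))" for x :: "real^'n"
  define q where "q n x = max 0 (min K (g n x)) * cut x" for n x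
  have K0: "K \<ge> 0" by (simp add: K_def)
  have qc: "continuous_on S (q n)" for S n
    unfolding q_def cut_def by (intro continuous_intros continuous_on_subset[OF g]) auto
  have q0: "0 \<le> q n x" for n x by (simp add: q_def cut_def)
  have qsupp: "q n x = 0" if "x \<notin> cball 0 R" for n x using that by (simp add: q_def cut_def)
  have qK: "q n x \<le> K * indicator (cball 0 R) x" for n x
  proof (cases "x \<in> cball 0 R")
    case True
    have "q n x \<le> K * 1" unfolding q_def by (intro mult_mono) (auto simp: cut_def K0)
    then show ?thesis using True by simp
  qed (simp add: qsupp)
  have qlim: "(\<lambda>n. q n x) \<longlonglongrightarrow> P x" if "x \<notin> Z" for x
  proof -
    have "(\<lambda>n. q n x) \<longlonglongrightarrow> max 0 (min K (P x)) * cut x"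
      unfolding q_def by (intro tendsto_intros glim that)
    moreover have "max 0 (min K (P x)) * cut x = P x"
    proof (cases "x \<in> \<Omega>")
      case True
      then have "cut x = 1" using R0 by (auto simp: cut_def R_def)
      then show ?thesis using P[of x] by simp
    qed (use P[of x] K0 in \<open>simp add: P_def\<close>)
    ultimately show ?thesis by simp
  qed
  define Nn where "Nn n = (LINT x:cball 0 R|lborel. q n x ^ ?d)" for n
  define N where "N = (\<integral>x. P x ^ ?d \<partial>lebesgue)"
  have AEZ: "AE x in lebesgue. x \<notin> Z"
    using Z by (auto simp: negligible_iff_null_sets intro: AE_not_in)
  have Kint: "integrable lebesgue (\<lambda>x. K ^ ?d * indicator (cball (0::real^'n) R) x)"
    by (intro integrable_mult_right integrable_real_indicator) (auto simp: emeasure_bounded_finite[OF bounded_cball, unfolded infinity_ennreal_def])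
  have Nlim: "Nn \<longlonglongrightarrow> N"
  proof -
    have eq: "Nn n = (\<integral>x. q n x ^ ?d \<partial>lebesgue)" for n
    proof -
      have "Nn n = (\<integral>x. q n x ^ ?d \<partial>lborel)"
        unfolding Nn_def set_lebesgue_integral_def
        by (rule Bochner_Integration.integral_cong) (auto simp: indicator_def qsupp)
      also have "\<dots> = (\<integral>x. q n x ^ ?d \<partial>lebesgue)"
        by (rule integral_completion[symmetric])
           (use borel_measurable_continuous_onI[OF qc] in measurable)
      finally show ?thesis .
    qed
    have "(\<lambda>n. \<integral>x. q n x ^ ?d \<partial>lebesgue) \<longlonglongrightarrow> N"
      unfolding N_def
    proof (rule integral_dominated_convergence[OF _ _ Kint])
      show "(\<lambda>x. P x ^ ?d) \<in> borel_measurable lebesgue" using Pm by measurable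
      have "q n \<in> borel_measurable lebesgue" for n
        by (intro measurable_completion) (simp add: borel_measurable_continuous_onI[OF qc])
      then show "(\<lambda>x. q n x ^ ?d) \<in> borel_measurable lebesgue" for n by measurable
      show "AE x in lebesgue. (\<lambda>n. q n x ^ ?d) \<longlonglongrightarrow> P x ^ ?d"
        using AEZ by eventually_elim (intro tendsto_intros qlim)
      show "AE x in lebesgue. norm (q n x ^ ?d) \<le> K ^ ?d * indicator (cball 0 R) x" for n
      proof (rule AE_I2)
        fix x
        have "q n x ^ ?d \<le> (K * indicator (cball 0 R) x) ^ ?d" by (rule power_mono[OF qK q0])
        then show "norm (q n x ^ ?d) \<le> K ^ ?d * indicator (cball 0 R) x"
          using q0[of n x] by (auto simp: indicator_def power_0_left)
      qed
    qed
    then show ?thesis unfolding eq[symmetric] .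
  qed
  have Neq: "(\<integral>\<^sup>+x. ennreal (m x) \<partial>lebesgue_on \<Omega>) = ennreal N"
  proof -
    have "integrable lebesgue (\<lambda>x. P x ^ ?d)"
    proof (rule Bochner_Integration.integrable_bound[OF Kint])
      show "(\<lambda>x. P x ^ ?d) \<in> borel_measurable lebesgue" using Pm by measurable
      show "AE x in lebesgue. norm (P x ^ ?d) \<le> norm (K ^ ?d * indicator (cball 0 R) x)"
      proof (rule AE_I2)
        fix x
        have "P x ^ ?d \<le> K ^ ?d" by (intro power_mono P)
        moreover have "P x = 0" if "x \<notin> cball 0 R" using that R0 by (auto simp: P_def R_def indicator_def)
        ultimately show "norm (P x ^ ?d) \<le> norm (K ^ ?d * indicator (cball 0 R) x)"
          using P(1)[of x] K0 by (cases "x \<in> cball 0 R") (auto simp: power_0_left)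
      qed
    qed
    then have "ennreal N = (\<integral>\<^sup>+x. ennreal (P x ^ ?d) \<partial>lebesgue)"
      unfolding N_def using P(1) by (intro nn_integral_eq_integral[symmetric]) auto
    also have "\<dots> = (\<integral>\<^sup>+x. ennreal (m x) * indicator \<Omega> x \<partial>lebesgue)"
      by (intro nn_integral_cong) (auto simp: Pd indicator_def)
    also have "\<dots> = (\<integral>\<^sup>+x. ennreal (m x) \<partial>lebesgue_on \<Omega>)"
      using \<Omega>(2) by (subst nn_integral_restrict_space) auto
    finally show ?thesis by simp
  qed
  show ?thesis
  proof (cases "N > 0")
    case False
    then have "(\<integral>\<^sup>+x. ennreal (m x) \<partial>lebesgue_on \<Omega>) = 0" by (simp add: Neq ennreal_neg)
    then show ?thesis by (simp add: m_def)
  next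
    case True
    have AEZ': "AE x in lebesgue_on \<Omega>. x \<notin> Z"
      using AEZ \<Omega>(2) by (subst AE_restrict_space_iff) (auto elim: eventually_mono)
    have qm [measurable]: "q n \<in> borel_measurable (lebesgue_on \<Omega>)" for n
      by (rule lebesgue_on_continuous_measurable[OF qc])
    have "ennreal (?d * N) = ennreal ?d * (\<integral>\<^sup>+x. ennreal (m x) \<partial>lebesgue_on \<Omega>)"
      unfolding Neq using True by (intro ennreal_mult) auto
    also have "\<dots> = (\<integral>\<^sup>+x. ennreal ?d * ennreal (m x) \<partial>lebesgue_on \<Omega>)"
      by (rule nn_integral_cmult[symmetric]) measurable
    also have "\<dots> \<le> (\<integral>\<^sup>+x. liminf (\<lambda>n. ennreal (?d * (det (A x) powr (1 / ?d) * q n x))) \<partial>lebesgue_on \<Omega>)"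
    proof (rule nn_integral_mono_AE)
      have "AE x in lebesgue_on \<Omega>. x \<in> \<Omega>" by (rule AE_I2) simp
      with psd AEZ' show "AE x in lebesgue_on \<Omega>. ennreal ?d * ennreal (m x) \<le> liminf (\<lambda>n. ennreal (?d * (det (A x) powr (1 / ?d) * q n x)))"
      proof eventually_elim
        case (elim x)
        have det0: "0 \<le> det (A x)" using elim(1) det_psd_le(1)[of "A x"] by (auto simp: Sym_plus_def)
        \<comment> \<open>As \<open>m x\<close> is at most the power \<open>1 / (d - 1)\<close> of
          the determinant, its power \<open>(d - 1) / d\<close> is at most the power
          \<open>1 / d\<close> of the determinant; the remaining factor of \<open>m x\<close> is
          \<open>P x\<close>.\<close>
        have ml: "m x \<le> det (A x) powr (1 / ?d) * P x"
        proof -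
          have "m x = m x powr ((real ?d - 1) / ?d) * m x powr (1 / ?d)"
          proof (cases "m x = 0")
            case False
            have "(real ?d - 1) / ?d + 1 / ?d = 1" by (simp add: diff_divide_distrib)
            then show ?thesis using m0[of x] False by (simp flip: powr_add)
          qed simp
          also have "\<dots> \<le> det (A x) powr (1 / ?d) * m x powr (1 / ?d)"
          proof (rule mult_right_mono)
            have "m x powr ((real ?d - 1) / ?d) \<le> (det (A x) powr (1 / (real ?d - 1))) powr ((real ?d - 1) / ?d)"
              using m0[of x] d1 by (intro powr_mono2) (auto simp: m_def)
            also have "\<dots> = det (A x) powr (1 / ?d)" using d1 by (simp add: powr_powr)
            finally show "m x powr ((real ?d - 1) / ?d) \<le> det (A x) powr (1 / ?d)" .
          qed simp
          finally show ?thesis using elim(3) by (simp add: P_def)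
        qed
        have "(\<lambda>n. ?d * (det (A x) powr (1 / ?d) * q n x)) \<longlonglongrightarrow> ?d * (det (A x) powr (1 / ?d) * P x)"
          by (intro tendsto_intros qlim elim)
        then have "liminf (\<lambda>n. ennreal (?d * (det (A x) powr (1 / ?d) * q n x))) = ennreal (?d * (det (A x) powr (1 / ?d) * P x))"
          by (intro lim_imp_Liminf tendsto_ennrealI) auto
        moreover have "ennreal ?d * ennreal (m x) \<le> ennreal (?d * (det (A x) powr (1 / ?d) * P x))"
          using ml m0[of x] by (subst ennreal_mult[symmetric]) (auto intro!: ennreal_leI mult_left_mono)
        ultimately show ?case by simp
      qed
    qed
    also have "\<dots> \<le> liminf (\<lambda>n. \<integral>\<^sup>+x. ennreal (?d * (det (A x) powr (1 / ?d) * q n x)) \<partial>lebesgue_on \<Omega>)"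
      by (rule nn_integral_liminf) measurable
    also have "\<dots> \<le> liminf (\<lambda>n. ennreal (M * (Nn n / ?w) powr (1 / ?d)))"
    \<comment> \<open>The scaling in \<open>weighted_det_integral_le\<close> asks for positive mass,
      which holds eventually because \<open>Nn\<close> tends to \<open>N > 0\<close>.\<close>
    proof (rule Liminf_mono)
      have "\<forall>\<^sub>F n in sequentially. 0 < Nn n" using Nlim True by (rule order_tendstoD)
      then show "\<forall>\<^sub>F n in sequentially. (\<integral>\<^sup>+x. ennreal (?d * (det (A x) powr (1 / ?d) * q n x)) \<partial>lebesgue_on \<Omega>) \<le> ennreal (M * (Nn n / ?w) powr (1 / ?d))"
        by eventually_elim (rule weighted_det_integral_le[OF \<Omega> A psd M qc q0 R qsupp Nn_def])
    qed
    also have "\<dots> = ennreal (M * (N / ?w) powr (1 / ?d))"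
    proof (intro lim_imp_Liminf tendsto_ennrealI tendsto_mult tendsto_const tendsto_powr tendsto_divide Nlim)
    qed (use w True in auto)
    \<comment> \<open>\<open>N\<close> occurs on both sides. It is a finite real number thanks to
      the truncation, so the inequality can be solved for it.\<close>
    finally have "?d * N \<le> M * (N / ?w) powr (1 / ?d)"
      using M0 by (subst (asm) ennreal_le_iff) auto
    from isoperimetric_arithmetic[OF True w d1 this]
    show ?thesis unfolding m_def[symmetric] Neq by (rule ennreal_leI)
  qed
qed

theorem theorem2p2:
  fixes \<Omega> :: "(real^'n::finite) set"
    and A :: "real^'n \<Rightarrow> real^'n^'n"
    and \<mu> \<nu> :: "(real^'n) set \<Rightarrow> real^'n"
  assumes "CARD('n) \<ge> 2"
    and "open \<Omega>" and "bounded \<Omega>" and "smooth_boundary \<Omega>"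
    and "integrable (lebesgue_on \<Omega>) A"
    and "AE x in lebesgue_on \<Omega>. A x \<in> Sym_plus"
    and "bounded_vector_measure (borel_on \<Omega>) \<mu>" and "has_Div \<Omega> A \<mu>"
    and "bounded_vector_measure (borel_on (frontier \<Omega>)) \<nu>" and "has_normal_trace \<Omega> A \<mu> \<nu>"
  shows "integrable (lebesgue_on \<Omega>) (\<lambda>x. det (A x) powr (1 / (real CARD('n) - 1)))
    \<and> (\<integral>x. det (A x) powr (1 / (real CARD('n) - 1)) \<partial>lebesgue_on \<Omega>)
       \<le> 1 / (real CARD('n) * hypersurface_area (sphere (0::real^'n) 1) powr (1 / (real CARD('n) - 1)))
          * (total_mass (borel_on (frontier \<Omega>)) \<nu> + total_mass (borel_on \<Omega>) \<mu>) powr (real CARD('n) / (real CARD('n) - 1))"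
proof -
  let ?d = "CARD('n)"
  define M where "M = total_mass (borel_on (frontier \<Omega>)) \<nu> + total_mass (borel_on \<Omega>) \<mu>"
  define f where "f x = det (A x) powr (1 / (real ?d - 1))" for x
  define C where "C = 1 / (real ?d * (real ?d * measure lborel (cball (0::real^'n) 1)) powr (1 / (real ?d - 1))) * M powr (real ?d / (real ?d - 1))"
  have \<Omega>: "\<Omega> \<in> sets lebesgue" using \<open>open \<Omega>\<close> by (intro sets_completionI_sets) simp
  have M0: "M \<ge> 0" by (simp add: M_def total_mass_def)
  have C0: "C \<ge> 0" by (simp add: C_def)
  have tr: "(\<integral>x. trace (A x ** grad \<psi> x) \<partial>lebesgue_on \<Omega>) \<le> M"
    if "smooth_on UNIV \<psi>" "\<And>x. norm (\<psi> x) \<le> 1" for \<psi>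
    unfolding M_def by (rule trace_integral_le[OF assms(7,9,10) that])
  \<comment> \<open>The bound is the same for every truncation level, so it passes to the limit and
    also yields the integrability of \<open>f\<close>.\<close>
  have bound: "(\<integral>\<^sup>+x. ennreal (min (f x) (real (Suc k))) \<partial>lebesgue_on \<Omega>) \<le> ennreal C" for k
    unfolding f_def C_def
    by (rule truncated_det_integral_le[OF assms(1,3) \<Omega> assms(5,6) tr M0]) auto
  have [measurable]: "(\<lambda>x. det (A x)) \<in> borel_measurable (lebesgue_on \<Omega>)"
    by (rule det_measurable[OF borel_measurable_integrable[OF assms(5)]])
  have [measurable]: "f \<in> borel_measurable (lebesgue_on \<Omega>)" unfolding f_def by measurable
  have f0: "0 \<le> f x" for x by (simp add: f_def)
  have "(\<integral>\<^sup>+x. ennreal (f x) \<partial>lebesgue_on \<Omega>) = (\<integral>\<^sup>+x. liminf (\<lambda>k. ennreal (min (f x) (real (Suc k)))) \<partial>lebesgue_on \<Omega>)"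
  proof (rule nn_integral_cong)
    fix x
    have "\<forall>\<^sub>F k in sequentially. ennreal (min (f x) (real (Suc k))) = ennreal (f x)"
      using eventually_ge_at_top[of "nat \<lceil>f x\<rceil>"]
    proof eventually_elim
      case (elim k)
      have "f x \<le> real (nat \<lceil>f x\<rceil>)" by (rule real_nat_ceiling_ge)
      also have "\<dots> \<le> real (Suc k)"
        unfolding of_nat_Suc using of_nat_mono[OF elim, where 'a=real] by linarith
      finally show ?case by (simp only: min_absorb1)
    qed
    then have "(\<lambda>k. ennreal (min (f x) (real (Suc k)))) \<longlonglongrightarrow> ennreal (f x)" by (rule tendsto_eventually)
    then show "ennreal (f x) = liminf (\<lambda>k. ennreal (min (f x) (real (Suc k))))"
      by (intro lim_imp_Liminf[symmetric]) auto
  qed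
  also have "\<dots> \<le> liminf (\<lambda>k. \<integral>\<^sup>+x. ennreal (min (f x) (real (Suc k))) \<partial>lebesgue_on \<Omega>)"
    by (rule nn_integral_liminf) measurable
  also have "\<dots> \<le> liminf (\<lambda>k. ennreal C)" by (intro Liminf_mono always_eventually allI bound)
  also have "\<dots> = ennreal C" by (rule Liminf_const) simp
  finally have le: "(\<integral>\<^sup>+x. ennreal (f x) \<partial>lebesgue_on \<Omega>) \<le> ennreal C" .
  have int: "integrable (lebesgue_on \<Omega>) f"
  proof (rule integrableI_bounded)
    show "(\<integral>\<^sup>+x. ennreal (norm (f x)) \<partial>lebesgue_on \<Omega>) < \<infinity>"
      using le f0 by (simp add: order.strict_trans1)
  qed measurable
  have "ennreal (\<integral>x. f x \<partial>lebesgue_on \<Omega>) \<le> ennreal C"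
    using le nn_integral_eq_integral[OF int] f0 by simp
  then have "(\<integral>x. f x \<partial>lebesgue_on \<Omega>) \<le> C" using C0 by (simp add: ennreal_le_iff)
  moreover have "hypersurface_area (sphere (0::real^'n) 1) = real ?d * measure lborel (cball (0::real^'n) 1)"
    using hypersurface_area_unit_sphere[where 'a="real^'n"] by (simp add: content_cball)
  ultimately show ?thesis using int by (simp add: f_def[abs_def] C_def M_def)
qed

end
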